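(* Let $\mathbf A\in K(\mathsf{SRL})$ be finite and subdirectly irreducible. Then $\mathbb V(\mathbf A)$ is a cover of $\mathbb V(\mathbf K_8)$ but not of $\mathbb V(\mathbf K_4)=K(\mathsf{BA})$ if and only if $\mathbf A\cong K_0(\mathbf 2\oplus\mathbf D)$ for some finite subdirectly irreducible $\mathbf D\in\mathsf{CIRL}$ that generates a cover of $\mathbb V(\mathbf 2)$ (the variety of generalized Boolean algebras) in the lattice of subvarieties of $\mathsf{CIRL}$.
   Context: $\mathsf{CIRL}$: commutative integral residuated lattices $(A,\vee,\wedge,\cdot,\to,1)$ (lattice, commutative monoid, $ab\le c$ iff $a\le b\to c$, $1$ greatest). $\mathsf{BCRL}$: members of $\mathsf{CIRL}$ with an extra constant $0$ that is the least element; $\neg x:=x\to0$. $\mathsf{SRL}$: the subvariety of $\mathsf{BCRL}$ defined by $\neg x\vee\neg\neg x=1$. For $\mathbf D\in\mathsf{CIRL}$, $\mathbf 2\oplus\mathbf D\in\mathsf{BCRL}$ has universe $\{0\}\cup D$ with $0$ below every element of $D$, $0\cdot x=0$, $0\to x=1$, $x\to0=0$ for $x\in D$, and product and implication of $D$ on $D$. For $\mathbf A\in\mathsf{BCRL}$, $K(\mathbf A)$ is the algebra on $A\times A$ with $(a,b)\vee(c,d)=(a\vee c,b\wedge d)$, $(a,b)\wedge(c,d)=(a\wedge c,b\vee d)$, $(a,b)(c,d)=(ac,(a\to d)\wedge(c\to b))$, $(a,b)\to(c,d)=((a\to c)\wedge(d\to b),ad)$, unit $(1,1)$, constant $0$ as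 $(0,1)$. With $\sim x:=x\to1$, a bounded K-lattice is a commutative residuated lattice with extra constant $0\le x$ satisfying $\sim\sim x=x$, the lattice distributive laws whenever one of the three elements is $1$, and $xy\wedge 1=(x\wedge1)(y\wedge1)$, $((x\wedge1)\to y)\wedge((\sim y\wedge 1)\to\sim x)=x\to y$. For such $\mathbf A$, $\mathbf A^-$ is the algebra on $\{a\le1\}$ with the same $\vee,\wedge,\cdot,0,1$ and $a\to^-b=(a\to b)\wedge1$; $K(\mathsf{SRL})$ is the class of bounded K-lattices $\mathbf A$ with $\mathbf A^-\in\mathsf{SRL}$. A subalgebra $\mathbf S$ of a bounded K-lattice $\mathbf A$ is admissible if $S^-=A^-$; $K_0(\mathbf B)$ is the smallest admissible subalgebra of $K(\mathbf B)$. $\mathbf 2$ is the two-element Boolean algebra (resp. generalized Boolean algebra in $\mathsf{CIRL}$), $\mathbf K_4=K(\mathbf 2)$, $\mathbf K_8=K_0(\mathbf2\oplus\mathbf2)$. *)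

theory Defs
  imports Main
begin

section \<open>Universal algebra\<close>

class signature =
  fixes arity :: "'a \<Rightarrow> nat"

text \<open>
  Operations take argument lists; their values on lists of the wrong length or with entries
  outside the universe carry no meaning, and no notion below depends on them.
\<close>

record ('f, 'a) algebra =
  univ :: "'a set"
  oper :: "'f \<Rightarrow> 'a list \<Rightarrow> 'a"

definition args :: "('f::signature, 'a) algebra \<Rightarrow> 'f \<Rightarrow> 'a list set" where
  "args A f = {xs. length xs = arity f \<and> set xs \<subseteq> univ A}"

definition is_algebra :: "('f::signature, 'a) algebra \<Rightarrow> bool" where
  "is_algebra A \<longleftrightarrow> univ A \<noteq> {} \<and> (\<forall>f. \<forall>xs \<in> args A f. oper A f xs \<in> univ A)"

definition is_hom :: "('a \<Rightarrow> 'b) \<Rightarrow> ('f::signature, 'a) algebra \<Rightarrow> ('f, 'b) algebra \<Rightarrow> bool" where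
  "is_hom h A B \<longleftrightarrow> h ` univ A \<subseteq> univ B \<and>
     (\<forall>f. \<forall>xs \<in> args A f. h (oper A f xs) = oper B f (map h xs))"

definition isomorphic :: "('f::signature, 'a) algebra \<Rightarrow> ('f, 'b) algebra \<Rightarrow> bool"
    (infix "\<simeq>" 50) where
  "A \<simeq> B \<longleftrightarrow> (\<exists>h. is_hom h A B \<and> bij_betw h (univ A) (univ B))"

definition subuniverse :: "'a set \<Rightarrow> ('f::signature, 'a) algebra \<Rightarrow> bool" where
  "subuniverse S A \<longleftrightarrow> S \<subseteq> univ A \<and> is_algebra (A\<lparr>univ := S\<rparr>)"

subsection \<open>Subdirect irreducibility\<close>

text \<open>
  A subdirect representation of \<open>A\<close> by \<open>(B i)\<close>, \<open>i \<in> I\<close>, is an embedding of \<open>A\<close> into the product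
  of the \<open>B i\<close>, here given by its coordinate maps \<open>h i\<close>, all of which are onto.
\<close>

definition subdirect_representation ::
    "('f::signature, 'a) algebra \<Rightarrow> 'i set \<Rightarrow> ('i \<Rightarrow> ('f, 'b) algebra) \<Rightarrow> ('i \<Rightarrow> 'a \<Rightarrow> 'b) \<Rightarrow> bool" where
  "subdirect_representation A I B h \<longleftrightarrow>
     (\<forall>i\<in>I. is_algebra (B i) \<and> is_hom (h i) A (B i) \<and> h i ` univ A = univ (B i)) \<and>
     (\<forall>x\<in>univ A. \<forall>y\<in>univ A. (\<forall>i\<in>I. h i x = h i y) \<longrightarrow> x = y)"

text \<open>
  Every factor of a subdirect representation is isomorphic to a quotient of \<open>A\<close>, determined by
  a congruence (the kernel of the coordinate map). So it is enough to let the factors live on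
  \<open>'a set\<close> and to use relations on \<open>'a\<close> as indices. The index set may be empty, whence
  one-element algebras do not count as subdirectly irreducible.
\<close>

definition subdirectly_irreducible :: "('f::signature, 'a) algebra \<Rightarrow> bool" where
  "subdirectly_irreducible A \<longleftrightarrow> is_algebra A \<and>
     (\<forall>(I :: 'a rel set) (B :: 'a rel \<Rightarrow> ('f, 'a set) algebra) h.
        subdirect_representation A I B h \<longrightarrow>
          (\<exists>i\<in>I. is_hom (h i) A (B i) \<and> bij_betw (h i) (univ A) (univ (B i))))"

subsection \<open>Identities and varieties\<close>

datatype 'f trm = Var nat | App 'f "'f trm list"

fun wf_trm :: "'f::signature trm \<Rightarrow> bool" where
  "wf_trm (Var n) \<longleftrightarrow> True"
| "wf_trm (App f ts) \<longleftrightarrow> length ts = arity f \<and> (\<forall>t\<in>set ts. wf_trm t)"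

fun eval_trm :: "('f, 'a) algebra \<Rightarrow> (nat \<Rightarrow> 'a) \<Rightarrow> 'f trm \<Rightarrow> 'a" where
  "eval_trm A v (Var n) = v n"
| "eval_trm A v (App f ts) = oper A f (map (eval_trm A v) ts)"

definition identities :: "('f::signature trm \<times> 'f trm) set" where
  "identities = {(s, t). wf_trm s \<and> wf_trm t}"

definition satisfies :: "('f, 'a) algebra \<Rightarrow> 'f trm \<times> 'f trm \<Rightarrow> bool"  (infix "\<Turnstile>" 50) where
  "A \<Turnstile> e \<longleftrightarrow> (\<forall>v. range v \<subseteq> univ A \<longrightarrow> eval_trm A v (fst e) = eval_trm A v (snd e))"

text \<open>
  HOL has no type of all algebras, so a class of algebras is a set of algebras whose universes are
  subsets of a type \<open>'u\<close>. A variety in the language \<open>'f\<close> is determined by its members on any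
  infinite \<open>'u\<close> when \<open>'f\<close> is countable: its free algebra on countably many generators has
  a copy there and refutes every identity failing in the variety. Hence inclusion of
  varieties, and with it the covering relation, does not depend on the choice of \<open>'u\<close>.
\<close>

definition models :: "('f::signature trm \<times> 'f trm) set \<Rightarrow> ('f, 'u) algebra set" where
  "models E = {A. is_algebra A \<and> (\<forall>e\<in>E. A \<Turnstile> e)}"

definition variety :: "('f::signature, 'u) algebra set \<Rightarrow> bool" where
  "variety W \<longleftrightarrow> (\<exists>E. E \<subseteq> identities \<and> W = models E)"

text \<open>
  The least variety containing \<open>A\<close>. The universe of \<open>A\<close> need not lie in the type \<open>'u\<close> on which
  the classes are formed, so membership of \<open>A\<close> in \<open>models E\<close> is expressed by \<open>A \<Turnstile> e\<close>, \<open>e \<in> E\<close>.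
\<close>

definition generated_variety :: "('f::signature, 'a) algebra \<Rightarrow> ('f, 'u) algebra set"
    ("\<V>") where
  "\<V> A = \<Inter> {models E |E. E \<subseteq> identities \<and> (\<forall>e\<in>E. A \<Turnstile> e)}"

definition subvarieties :: "('f::signature, 'u) algebra set \<Rightarrow> ('f, 'u) algebra set set" where
  "subvarieties C = {W. variety W \<and> W \<subseteq> C}"

text \<open>\<open>W\<close> is a cover of \<open>V\<close> in the family \<open>L\<close> ordered by inclusion.\<close>

definition is_cover_in :: "'c set set \<Rightarrow> 'c set \<Rightarrow> 'c set \<Rightarrow> bool" where
  "is_cover_in L W V \<longleftrightarrow> V \<in> L \<and> W \<in> L \<and> V \<subset> W \<and> \<not> (\<exists>U\<in>L. V \<subset> U \<and> U \<subset> W)"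


section \<open>Residuated lattices\<close>

text \<open>The symbols \<open>\<or>, \<and>, \<cdot>, \<rightarrow>, 1\<close>, and the same language with an extra constant \<open>0\<close>.\<close>

datatype rl_sym = Join | Meet | Mult | Impl | One

datatype brl_sym = RL rl_sym | Zero

instantiation rl_sym :: signature
begin
fun arity_rl_sym :: "rl_sym \<Rightarrow> nat" where
  "arity_rl_sym One = 0"
| "arity_rl_sym _ = 2"
instance ..
end

instantiation brl_sym :: signature
begin
fun arity_brl_sym :: "brl_sym \<Rightarrow> nat" where
  "arity_brl_sym (RL f) = arity f"
| "arity_brl_sym Zero = 0"
instance ..
end

definition rl_algebra ::
    "'a set \<Rightarrow> ('a \<Rightarrow> 'a \<Rightarrow> 'a) \<Rightarrow> ('a \<Rightarrow> 'a \<Rightarrow> 'a) \<Rightarrow> ('a \<Rightarrow> 'a \<Rightarrow> 'a) \<Rightarrow> ('a \<Rightarrow> 'a \<Rightarrow> 'a) \<Rightarrow> 'a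
      \<Rightarrow> (rl_sym, 'a) algebra" where
  "rl_algebra U jn mt ml im e =
     \<lparr>univ = U,
      oper = (\<lambda>f xs. case f of
          Join \<Rightarrow> jn (xs ! 0) (xs ! 1)
        | Meet \<Rightarrow> mt (xs ! 0) (xs ! 1)
        | Mult \<Rightarrow> ml (xs ! 0) (xs ! 1)
        | Impl \<Rightarrow> im (xs ! 0) (xs ! 1)
        | One \<Rightarrow> e)\<rparr>"

definition with_zero :: "(rl_sym, 'a) algebra \<Rightarrow> 'a \<Rightarrow> (brl_sym, 'a) algebra" where
  "with_zero R z =
     \<lparr>univ = univ R, oper = (\<lambda>f xs. case f of RL g \<Rightarrow> oper R g xs | Zero \<Rightarrow> z)\<rparr>"

text \<open>The reduct forgetting \<open>0\<close>.\<close>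

definition rl :: "(brl_sym, 'a) algebra \<Rightarrow> (rl_sym, 'a) algebra" where
  "rl A = \<lparr>univ = univ A, oper = (\<lambda>f. oper A (RL f))\<rparr>"

definition zero :: "(brl_sym, 'a) algebra \<Rightarrow> 'a" where
  "zero A = oper A Zero []"

definition join :: "(rl_sym, 'a) algebra \<Rightarrow> 'a \<Rightarrow> 'a \<Rightarrow> 'a"  (infixl "\<squnion>\<index>" 65) where
  "x \<squnion>\<^bsub>R\<^esub> y = oper R Join [x, y]"

definition meet :: "(rl_sym, 'a) algebra \<Rightarrow> 'a \<Rightarrow> 'a \<Rightarrow> 'a"  (infixl "\<sqinter>\<index>" 70) where
  "x \<sqinter>\<^bsub>R\<^esub> y = oper R Meet [x, y]"

definition mult :: "(rl_sym, 'a) algebra \<Rightarrow> 'a \<Rightarrow> 'a \<Rightarrow> 'a"  (infixl "\<odot>\<index>" 75) where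
  "x \<odot>\<^bsub>R\<^esub> y = oper R Mult [x, y]"

definition impl :: "(rl_sym, 'a) algebra \<Rightarrow> 'a \<Rightarrow> 'a \<Rightarrow> 'a"  (infixr "\<rightarrow>\<index>" 60) where
  "x \<rightarrow>\<^bsub>R\<^esub> y = oper R Impl [x, y]"

definition one :: "(rl_sym, 'a) algebra \<Rightarrow> 'a"  ("\<one>\<index>") where
  "\<one>\<^bsub>R\<^esub> = oper R One []"

definition le :: "(rl_sym, 'a) algebra \<Rightarrow> 'a \<Rightarrow> 'a \<Rightarrow> bool"  (infix "\<sqsubseteq>\<index>" 50) where
  "x \<sqsubseteq>\<^bsub>R\<^esub> y \<longleftrightarrow> x \<sqinter>\<^bsub>R\<^esub> y = x"

definition is_CRL :: "(rl_sym, 'a) algebra \<Rightarrow> bool" where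
  "is_CRL R \<longleftrightarrow> is_algebra R \<and>
     (\<forall>x\<in>univ R. \<forall>y\<in>univ R. \<forall>z\<in>univ R.
        (x \<squnion>\<^bsub>R\<^esub> y) \<squnion>\<^bsub>R\<^esub> z = x \<squnion>\<^bsub>R\<^esub> (y \<squnion>\<^bsub>R\<^esub> z) \<and> x \<squnion>\<^bsub>R\<^esub> y = y \<squnion>\<^bsub>R\<^esub> x \<and> x \<squnion>\<^bsub>R\<^esub> (x \<sqinter>\<^bsub>R\<^esub> y) = x \<and>
        (x \<sqinter>\<^bsub>R\<^esub> y) \<sqinter>\<^bsub>R\<^esub> z = x \<sqinter>\<^bsub>R\<^esub> (y \<sqinter>\<^bsub>R\<^esub> z) \<and> x \<sqinter>\<^bsub>R\<^esub> y = y \<sqinter>\<^bsub>R\<^esub> x \<and> x \<sqinter>\<^bsub>R\<^esub> (x \<squnion>\<^bsub>R\<^esub> y) = x \<and>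
        (x \<odot>\<^bsub>R\<^esub> y) \<odot>\<^bsub>R\<^esub> z = x \<odot>\<^bsub>R\<^esub> (y \<odot>\<^bsub>R\<^esub> z) \<and> x \<odot>\<^bsub>R\<^esub> y = y \<odot>\<^bsub>R\<^esub> x \<and> x \<odot>\<^bsub>R\<^esub> \<one>\<^bsub>R\<^esub> = x \<and>
        (x \<odot>\<^bsub>R\<^esub> y \<sqsubseteq>\<^bsub>R\<^esub> z \<longleftrightarrow> x \<sqsubseteq>\<^bsub>R\<^esub> y \<rightarrow>\<^bsub>R\<^esub> z))"

definition CIRL :: "(rl_sym, 'a) algebra set" where
  "CIRL = {R. is_CRL R \<and> (\<forall>x\<in>univ R. x \<sqsubseteq>\<^bsub>R\<^esub> \<one>\<^bsub>R\<^esub>)}"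

definition BCRL :: "(brl_sym, 'a) algebra set" where
  "BCRL = {A. is_algebra A \<and> rl A \<in> CIRL \<and> (\<forall>x\<in>univ A. zero A \<sqsubseteq>\<^bsub>rl A\<^esub> x)}"

definition neg :: "(brl_sym, 'a) algebra \<Rightarrow> 'a \<Rightarrow> 'a" where
  "neg A x = x \<rightarrow>\<^bsub>rl A\<^esub> zero A"

definition SRL :: "(brl_sym, 'a) algebra set" where
  "SRL = {A \<in> BCRL. \<forall>x\<in>univ A. neg A x \<squnion>\<^bsub>rl A\<^esub> neg A (neg A x) = \<one>\<^bsub>rl A\<^esub>}"

text \<open>Boolean algebras, as bounded residuated lattices with \<open>xy = x \<and> y\<close>.\<close>

definition BA :: "(brl_sym, 'a) algebra set" where
  "BA = {A \<in> BCRL. (\<forall>x\<in>univ A. \<forall>y\<in>univ A. x \<odot>\<^bsub>rl A\<^esub> y = x \<sqinter>\<^bsub>rl A\<^esub> y) \<and>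
                   (\<forall>x\<in>univ A. x \<squnion>\<^bsub>rl A\<^esub> neg A x = \<one>\<^bsub>rl A\<^esub>)}"

text \<open>The two-element algebra, in \<open>CIRL\<close> and in \<open>BCRL\<close> respectively.\<close>

definition two :: "(rl_sym, bool) algebra" where
  "two = rl_algebra UNIV (\<or>) (\<and>) (\<and>) (\<longrightarrow>) True"

definition two_b :: "(brl_sym, bool) algebra" where
  "two_b = with_zero two False"

text \<open>\<open>2 \<oplus> D\<close>; the new least element is \<open>None\<close>.\<close>

definition two_plus :: "(rl_sym, 'a) algebra \<Rightarrow> (brl_sym, 'a option) algebra" where
  "two_plus D = with_zero
     (rl_algebra (insert None (Some ` univ D))
       (\<lambda>x y. case (x, y) of (None, _) \<Rightarrow> y | (_, None) \<Rightarrow> x | (Some a, Some b) \<Rightarrow> Some (a \<squnion>\<^bsub>D\<^esub> b))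
       (\<lambda>x y. case (x, y) of (Some a, Some b) \<Rightarrow> Some (a \<sqinter>\<^bsub>D\<^esub> b) | _ \<Rightarrow> None)
       (\<lambda>x y. case (x, y) of (Some a, Some b) \<Rightarrow> Some (a \<odot>\<^bsub>D\<^esub> b) | _ \<Rightarrow> None)
       (\<lambda>x y. case (x, y) of (None, _) \<Rightarrow> Some \<one>\<^bsub>D\<^esub> | (_, None) \<Rightarrow> None | (Some a, Some b) \<Rightarrow> Some (a \<rightarrow>\<^bsub>D\<^esub> b))
       (Some \<one>\<^bsub>D\<^esub>))
     None"


section \<open>Bounded K-lattices\<close>

definition K :: "(brl_sym, 'a) algebra \<Rightarrow> (brl_sym, 'a \<times> 'a) algebra" where
  "K A = (let R = rl A in with_zero
     (rl_algebra (univ A \<times> univ A)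
       (\<lambda>(a, b) (c, d). (a \<squnion>\<^bsub>R\<^esub> c, b \<sqinter>\<^bsub>R\<^esub> d))
       (\<lambda>(a, b) (c, d). (a \<sqinter>\<^bsub>R\<^esub> c, b \<squnion>\<^bsub>R\<^esub> d))
       (\<lambda>(a, b) (c, d). (a \<odot>\<^bsub>R\<^esub> c, (a \<rightarrow>\<^bsub>R\<^esub> d) \<sqinter>\<^bsub>R\<^esub> (c \<rightarrow>\<^bsub>R\<^esub> b)))
       (\<lambda>(a, b) (c, d). ((a \<rightarrow>\<^bsub>R\<^esub> c) \<sqinter>\<^bsub>R\<^esub> (d \<rightarrow>\<^bsub>R\<^esub> b), a \<odot>\<^bsub>R\<^esub> d))
       (\<one>\<^bsub>R\<^esub>, \<one>\<^bsub>R\<^esub>))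
     (zero A, \<one>\<^bsub>R\<^esub>))"

text \<open>The involution \<open>\<sim>x = x \<rightarrow> 1\<close>, distinct from \<open>neg\<close>.\<close>

definition inv_neg :: "(rl_sym, 'a) algebra \<Rightarrow> 'a \<Rightarrow> 'a" where
  "inv_neg R x = x \<rightarrow>\<^bsub>R\<^esub> \<one>\<^bsub>R\<^esub>"

definition is_K_lattice :: "(rl_sym, 'a) algebra \<Rightarrow> bool" where
  "is_K_lattice R \<longleftrightarrow> is_CRL R \<and>
     (\<forall>x\<in>univ R. inv_neg R (inv_neg R x) = x) \<and>
     (\<forall>x\<in>univ R. \<forall>y\<in>univ R. \<forall>z\<in>univ R. \<one>\<^bsub>R\<^esub> \<in> {x, y, z} \<longrightarrow>
        x \<sqinter>\<^bsub>R\<^esub> (y \<squnion>\<^bsub>R\<^esub> z) = (x \<sqinter>\<^bsub>R\<^esub> y) \<squnion>\<^bsub>R\<^esub> (x \<sqinter>\<^bsub>R\<^esub> z) \<and>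
        x \<squnion>\<^bsub>R\<^esub> (y \<sqinter>\<^bsub>R\<^esub> z) = (x \<squnion>\<^bsub>R\<^esub> y) \<sqinter>\<^bsub>R\<^esub> (x \<squnion>\<^bsub>R\<^esub> z)) \<and>
     (\<forall>x\<in>univ R. \<forall>y\<in>univ R.
        (x \<odot>\<^bsub>R\<^esub> y) \<sqinter>\<^bsub>R\<^esub> \<one>\<^bsub>R\<^esub> = (x \<sqinter>\<^bsub>R\<^esub> \<one>\<^bsub>R\<^esub>) \<odot>\<^bsub>R\<^esub> (y \<sqinter>\<^bsub>R\<^esub> \<one>\<^bsub>R\<^esub>) \<and>
        ((x \<sqinter>\<^bsub>R\<^esub> \<one>\<^bsub>R\<^esub>) \<rightarrow>\<^bsub>R\<^esub> y) \<sqinter>\<^bsub>R\<^esub> ((inv_neg R y \<sqinter>\<^bsub>R\<^esub> \<one>\<^bsub>R\<^esub>) \<rightarrow>\<^bsub>R\<^esub> inv_neg R x) = x \<rightarrow>\<^bsub>R\<^esub> y)"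

definition is_bounded_K_lattice :: "(brl_sym, 'a) algebra \<Rightarrow> bool" where
  "is_bounded_K_lattice A \<longleftrightarrow>
     is_algebra A \<and> is_K_lattice (rl A) \<and> (\<forall>x\<in>univ A. zero A \<sqsubseteq>\<^bsub>rl A\<^esub> x)"

text \<open>The algebra \<open>A\<^sup>-\<close> and, for a class \<open>C\<close>, the class \<open>K(C)\<close>.\<close>

definition neg_cone :: "(brl_sym, 'a) algebra \<Rightarrow> (brl_sym, 'a) algebra" where
  "neg_cone A = (let R = rl A in with_zero
     (rl_algebra {a \<in> univ A. a \<sqsubseteq>\<^bsub>R\<^esub> \<one>\<^bsub>R\<^esub>}
       (\<lambda>a b. a \<squnion>\<^bsub>R\<^esub> b) (\<lambda>a b. a \<sqinter>\<^bsub>R\<^esub> b) (\<lambda>a b. a \<odot>\<^bsub>R\<^esub> b) (\<lambda>a b. (a \<rightarrow>\<^bsub>R\<^esub> b) \<sqinter>\<^bsub>R\<^esub> \<one>\<^bsub>R\<^esub>) \<one>\<^bsub>R\<^esub>)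
     (zero A))"

definition K_class :: "(brl_sym, 'a) algebra set \<Rightarrow> (brl_sym, 'a) algebra set" where
  "K_class C = {A. is_bounded_K_lattice A \<and> neg_cone A \<in> C}"

definition admissible :: "'a set \<Rightarrow> (brl_sym, 'a) algebra \<Rightarrow> bool" where
  "admissible S A \<longleftrightarrow> subuniverse S A \<and> univ (neg_cone (A\<lparr>univ := S\<rparr>)) = univ (neg_cone A)"

definition K0 :: "(brl_sym, 'a) algebra \<Rightarrow> (brl_sym, 'a \<times> 'a) algebra" where
  "K0 B = (K B)\<lparr>univ := \<Inter> {S. admissible S (K B)}\<rparr>"

definition K4 :: "(brl_sym, bool \<times> bool) algebra" where
  "K4 = K two_b"

definition K8 :: "(brl_sym, bool option \<times> bool option) algebra" where
  "K8 = K0 (two_plus two)"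

end

theory Submission
  imports Defs
begin

text \<open>
  If \<open>A\<close> is subdirectly irreducible then \<open>1\<close> is join irreducible in \<open>A\<^sup>-\<close>, so the Stone identity forces
  \<open>A\<^sup>- \<cong> 2 \<oplus> E\<close>, and \<open>A\<close> embeds in \<open>K(2 \<oplus> E)\<close> via \<open>x \<mapsto> (x \<and> 1, \<sim>x \<and> 1)\<close>. The only admissible subalgebras of
  \<open>K(2 \<oplus> E)\<close> are \<open>K(2 \<oplus> E)\<close> itself and \<open>K\<^sub>0(2 \<oplus> E) = K(2 \<oplus> E) - {(0, 0)}\<close>; the former contains \<open>K\<^sub>4\<close> and
  then lies strictly above the join of \<open>\<V>(K\<^sub>4)\<close> and \<open>\<V>(K\<^sub>8)\<close>.

  For the covers, Jonsson's lemma is avoided by a syntactic argument. Whether \<open>K\<^sub>0(2 \<oplus> D)\<close> satisfies an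
  identity depends only on the identities of \<open>D\<close>, and conversely every identity of \<open>D\<close> is expressed by
  one of \<open>K\<^sub>0(2 \<oplus> D)\<close>, uniformly in \<open>D\<close>. So varieties strictly between \<open>\<V>(2)\<close> and \<open>\<V>(D)\<close> yield varieties
  strictly between \<open>\<V>(K\<^sub>8)\<close> and \<open>\<V>(K\<^sub>0(2 \<oplus> D))\<close>. In the other direction, an algebra outside \<open>\<V>(K\<^sub>8)\<close> is
  taken to some \<open>K\<^sub>0(2 \<oplus> E)\<close> outside \<open>\<V>(K\<^sub>8)\<close> by a prime filter of its negative cone.
\<close>

section \<open>Universal algebra\<close>

text \<open>Jonsson's lemma uses ultraproducts, which leave the fixed type \<open>'u\<close>, and
  even \<open>K0 (two_plus E)\<close> leaves it when \<open>E\<close> lives on \<open>'u\<close>. A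
  set of pairs of terms mentions no universe. Algebras are therefore compared by
  \<open>eq_theory\<close>, and a copy on \<open>'u\<close> is made only where a member of a variety
  has to be exhibited.

  No isomorphism between lattices of subvarieties is claimed. It suffices that a variety strictly
  between on one side produces one on the other. Such a variety is given by a whole family of
  algebras, so the translation of identities has to respect intersections of theories, not merely
  single theories.

  Prime filters take the place of subdirectly irreducible quotients: primeness is all that the Stone
  identity needs to split the quotient of the negative cone as 2 \<oplus> E. Whether the induced
  image in K(2 \<oplus> E) omits (0, 0) is controlled by one identity, which is inherited by every
  member of the variety of \<open>K0 (two_plus D)\<close>.\<close>

definition eq_theory :: "('f::signature, 'a) algebra \<Rightarrow> ('f trm \<times> 'f trm) set" where
  "eq_theory A = {e \<in> identities. A \<Turnstile> e}"

lemma eq_theory_sub_identities: "eq_theory A \<subseteq> identities"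
  by (auto simp: eq_theory_def)

lemma mem_eq_theory:
  "(s, t) \<in> eq_theory A \<longleftrightarrow> wf_trm s \<and> wf_trm t \<and>
     (\<forall>v. (\<forall>n. v n \<in> univ A) \<longrightarrow> eval_trm A v s = eval_trm A v t)"
  by (auto simp: eq_theory_def identities_def satisfies_def image_subset_iff)

lemma eq_theoryD:
  "(s, t) \<in> eq_theory A \<Longrightarrow> (\<And>n. v n \<in> univ A) \<Longrightarrow> eval_trm A v s = eval_trm A v t"
  by (simp add: mem_eq_theory)

lemma generated_variety_eq: "\<V> A = models (eq_theory A)"
proof
  show "\<V> A \<subseteq> models (eq_theory A)"
    unfolding generated_variety_def by (rule Inter_lower) (auto simp: eq_theory_def)
  show "models (eq_theory A) \<subseteq> \<V> A"
    unfolding generated_variety_def models_def eq_theory_def by auto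
qed

lemma models_iff: "E \<subseteq> identities \<Longrightarrow> B \<in> models E \<longleftrightarrow> is_algebra B \<and> E \<subseteq> eq_theory B"
  by (auto simp: models_def eq_theory_def)

lemma mem_generated_variety: "B \<in> \<V> A \<longleftrightarrow> is_algebra B \<and> eq_theory A \<subseteq> eq_theory B"
  by (simp add: generated_variety_eq models_iff eq_theory_sub_identities)

lemma variety_models: "E \<subseteq> identities \<Longrightarrow> variety (models E)"
  by (auto simp: variety_def)

lemma variety_generated: "variety (\<V> A)"
  by (simp add: generated_variety_eq variety_models eq_theory_sub_identities)

lemma eval_trm_closed:
  "is_algebra A \<Longrightarrow> wf_trm t \<Longrightarrow> (\<And>n. v n \<in> univ A) \<Longrightarrow> eval_trm A v t \<in> univ A"
  by (induction t) (auto simp: is_algebra_def args_def image_subset_iff)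

lemma is_homD:
  "is_hom h A B \<Longrightarrow> length xs = arity f \<Longrightarrow> set xs \<subseteq> univ A \<Longrightarrow> h (oper A f xs) = oper B f (map h xs)"
  by (auto simp: is_hom_def args_def)

lemma is_hom_univ: "is_hom h A B \<Longrightarrow> x \<in> univ A \<Longrightarrow> h x \<in> univ B"
  by (auto simp: is_hom_def)

lemma eval_hom:
  assumes "is_hom h A B" "is_algebra A" "wf_trm t" "\<And>n. v n \<in> univ A"
  shows "h (eval_trm A v t) = eval_trm B (\<lambda>n. h (v n)) t"
  using assms(3)
proof (induction t)
  case (App f ts)
  have "set (map (eval_trm A v) ts) \<subseteq> univ A"
    using App.prems assms(2,4) by (auto intro!: eval_trm_closed)
  then show ?case
    using App is_homD[OF assms(1), of "map (eval_trm A v) ts" f] by (simp cong: map_cong)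
qed simp

lemma eq_theory_inj:
  fixes A :: "('f::signature, 'a) algebra"
  assumes "is_hom h A B" "is_algebra A" "inj_on h (univ A)"
  shows "eq_theory B \<subseteq> eq_theory A"
proof safe
  fix s t assume st: "(s, t) \<in> eq_theory B"
  show "(s, t) \<in> eq_theory A"
    unfolding mem_eq_theory
  proof (intro conjI allI impI)
    fix v :: "nat \<Rightarrow> 'a" assume v: "\<forall>n. v n \<in> univ A"
    have "h (eval_trm A v s) = h (eval_trm A v t)"
      using st v is_hom_univ[OF assms(1)] by (simp add: eval_hom[OF assms(1,2)] mem_eq_theory)
    then show "eval_trm A v s = eval_trm A v t"
      using st v assms(2,3) by (auto simp: mem_eq_theory inj_on_def eval_trm_closed)
  qed (use st in \<open>auto simp: mem_eq_theory\<close>)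
qed

lemma eq_theory_surj:
  fixes B :: "('f::signature, 'b) algebra"
  assumes "is_hom h A B" "is_algebra A" "univ B \<subseteq> h ` univ A"
  shows "eq_theory A \<subseteq> eq_theory B"
proof safe
  fix s t assume st: "(s, t) \<in> eq_theory A"
  show "(s, t) \<in> eq_theory B"
    unfolding mem_eq_theory
  proof (intro conjI allI impI)
    fix v :: "nat \<Rightarrow> 'b" assume v: "\<forall>n. v n \<in> univ B"
    let ?w = "\<lambda>n. inv_into (univ A) h (v n)"
    have w: "\<And>n. ?w n \<in> univ A" "\<And>n. h (?w n) = v n"
      using v assms(3) by (auto intro!: inv_into_into f_inv_into_f)
    have "eval_trm A ?w s = eval_trm A ?w t"
      using st w by (simp add: mem_eq_theory)
    then have "h (eval_trm A ?w s) = h (eval_trm A ?w t)"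
      by simp
    moreover have "h (eval_trm A ?w u) = eval_trm B v u" if "wf_trm u" for u
      using eval_hom[OF assms(1,2) that, of ?w] w by simp
    ultimately show "eval_trm B v s = eval_trm B v t"
      using st by (simp add: mem_eq_theory)
  qed (use st in \<open>auto simp: mem_eq_theory\<close>)
qed

lemma eq_theory_isomorphic:
  assumes "is_algebra A" "A \<simeq> B"
  shows "eq_theory A = eq_theory B"
proof -
  obtain h where "is_hom h A B" "bij_betw h (univ A) (univ B)"
    using assms(2) by (auto simp: isomorphic_def)
  then show ?thesis
    using eq_theory_inj[of h A B] eq_theory_surj[of h A B] assms(1) by (auto simp: bij_betw_def)
qed

lemma eval_univ_update [simp]: "eval_trm (A\<lparr>univ := S\<rparr>) v t = eval_trm A v t"
  by (induction t) (simp_all cong: map_cong)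

lemma eq_theory_mono_univ: "S \<subseteq> univ A \<Longrightarrow> eq_theory A \<subseteq> eq_theory (A\<lparr>univ := S\<rparr>)"
  by (auto simp: mem_eq_theory) (meson subsetD)

lemma is_hom_compose:
  assumes g: "is_hom g A B" and h: "is_hom h B C" shows "is_hom (\<lambda>x. h (g x)) A C"
  unfolding is_hom_def
proof (intro conjI allI ballI)
  show "(\<lambda>x. h (g x)) ` univ A \<subseteq> univ C"
    using is_hom_univ[OF g] is_hom_univ[OF h] by blast
  fix f xs assume xs: "xs \<in> args A f"
  then have "set (map g xs) \<subseteq> univ B"
    using is_hom_univ[OF g] by (auto simp: args_def)
  then show "h (g (oper A f xs)) = oper C f (map (\<lambda>x. h (g x)) xs)"
    using xs is_homD[OF g, of xs f] is_homD[OF h, of "map g xs" f] by (simp add: args_def comp_def)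
qed

lemma is_hom_image_subuniverse:
  assumes "is_hom h A B" "is_algebra A" shows "subuniverse (h ` univ A) B"
proof -
  have "oper B f xs \<in> h ` univ A" if "length xs = arity f" "set xs \<subseteq> h ` univ A" for f xs
  proof -
    let ?ys = "map (inv_into (univ A) h) xs"
    have ys: "set ?ys \<subseteq> univ A" "map h ?ys = xs"
      using that(2) by (auto simp: inv_into_into f_inv_into_f subset_iff intro!: map_idI)
    then have "oper B f xs = h (oper A f ?ys)"
      using is_homD[OF assms(1), of ?ys f] that(1) by simp
    moreover have "oper A f ?ys \<in> univ A"
      using assms(2) ys that(1) by (auto simp: is_algebra_def args_def)
    ultimately show ?thesis by blast
  qed
  then show ?thesis
    using assms by (auto simp: subuniverse_def is_algebra_def args_def is_hom_def)
qed

subsection \<open>Images under maps whose kernel is a congruence\<close>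

text \<open>The quotient of \<open>A\<close> by the kernel of \<open>r\<close>, carried by the
  values of \<open>r\<close> instead of equivalence classes. An injective \<open>r\<close> gives a
  copy on another type, and a choice of representatives gives a quotient on the same type.\<close>

definition image_algebra :: "('a \<Rightarrow> 'b) \<Rightarrow> ('f::signature, 'a) algebra \<Rightarrow> ('f, 'b) algebra" where
  "image_algebra r A =
     \<lparr>univ = r ` univ A, oper = (\<lambda>f ys. r (oper A f (map (inv_into (univ A) r) ys)))\<rparr>"

definition congruence_map :: "('a \<Rightarrow> 'b) \<Rightarrow> ('f::signature, 'a) algebra \<Rightarrow> bool" where
  "congruence_map r A \<longleftrightarrow>
     (\<forall>f. \<forall>xs\<in>args A f. \<forall>ys\<in>args A f. map r xs = map r ys \<longrightarrow> r (oper A f xs) = r (oper A f ys))"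

lemma univ_image_algebra [simp]: "univ (image_algebra r A) = r ` univ A"
  by (simp add: image_algebra_def)

lemma is_hom_image_algebra:
  assumes "congruence_map r A" shows "is_hom r A (image_algebra r A)"
  unfolding is_hom_def
proof (intro conjI allI ballI)
  fix f xs assume xs: "xs \<in> args A f"
  let ?ys = "map (inv_into (univ A) r) (map r xs)"
  have "set ?ys \<subseteq> univ A" "map r ?ys = map r xs"
    using xs by (auto simp: args_def intro!: inv_into_into f_inv_into_f)
  then have "r (oper A f xs) = r (oper A f ?ys)"
    using xs assms[unfolded congruence_map_def, rule_format, of xs f ?ys] by (simp add: args_def)
  then show "r (oper A f xs) = oper (image_algebra r A) f (map r xs)"
    by (simp add: image_algebra_def)
qed simp

lemma is_algebra_hom_image:
  assumes "is_hom h A B" "is_algebra A" "univ B = h ` univ A"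
  shows "is_algebra B"
  using is_hom_image_subuniverse[OF assms(1,2)] assms(3)[symmetric] by (simp add: subuniverse_def)

lemma is_algebra_image_algebra:
  "congruence_map r A \<Longrightarrow> is_algebra A \<Longrightarrow> is_algebra (image_algebra r A)"
  by (rule is_algebra_hom_image[OF is_hom_image_algebra]) auto

lemma congruence_map_inj: "inj_on r (univ A) \<Longrightarrow> congruence_map r A"
  unfolding congruence_map_def args_def by (auto simp: inj_on_map_eq_map inj_on_subset)

section \<open>Copies of algebras on a given type\<close>

lemma copy:
  assumes "is_algebra A" "inj_on f (univ A)"
  shows "\<exists>C. is_algebra C \<and> eq_theory C = eq_theory A \<and> univ C = f ` univ A"
proof (intro exI conjI)
  have "congruence_map f A" by (rule congruence_map_inj[OF assms(2)])
  then show "is_algebra (image_algebra f A)" "eq_theory (image_algebra f A) = eq_theory A"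
    using is_hom_image_algebra[of f A] eq_theory_inj[of f A "image_algebra f A"]
      eq_theory_surj[of f A "image_algebra f A"] is_algebra_image_algebra[of f A] assms
    by auto
qed simp

text \<open>\<open>K4\<close>, \<open>K8\<close> and \<open>two\<close> live on types built from
  \<open>bool\<close>; this supplies members of their varieties on \<open>'u\<close>.\<close>

lemma copy_finite:
  assumes "is_algebra A" "finite (univ A)" "infinite (UNIV :: 'u set)"
  shows "\<exists>C :: ('f::signature, 'u) algebra. is_algebra C \<and> eq_theory C = eq_theory A"
proof -
  obtain T :: "'u set" where "finite T" "card T = card (univ A)"
    using infinite_arbitrarily_large[OF assms(3)] by blast
  then obtain f where "bij_betw f (univ A) T"
    using finite_same_card_bij[OF assms(2)] by metis
  then show ?thesis
    using copy[OF assms(1), of f] by (auto simp: bij_betw_def)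
qed

lemma inj_option_prod:
  assumes "infinite (UNIV :: 'u set)"
  shows "\<exists>f :: 'u option \<times> 'u option \<Rightarrow> 'u. inj f"
proof -
  have "(card_of ((UNIV :: 'u set) \<times> (UNIV :: 'u set)), card_of (UNIV :: 'u set)) \<in> ordIso"
    by (rule card_of_Times_same_infinite[OF assms])
  then obtain p :: "'u \<times> 'u \<Rightarrow> 'u" where p: "inj p"
    unfolding card_of_ordIso[symmetric] UNIV_Times_UNIV bij_betw_def by blast
  obtain z :: "nat \<Rightarrow> 'u" where z: "inj z"
    using infinite_countable_subset[OF assms] by blast
  \<comment> \<open>The first components \<open>z 0\<close> and \<open>z 1\<close> are tags that
    keep the value at \<open>None\<close> apart from the values at \<open>Some\<close>.\<close>
  define q :: "'u option \<Rightarrow> 'u" where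
    "q = (\<lambda>x. case x of None \<Rightarrow> p (z 0, z 0) | Some a \<Rightarrow> p (z 1, a))"
  have p_eq: "p a = p b \<longleftrightarrow> a = b" for a b
    using p by (rule inj_eq)
  have "q a = q b \<longleftrightarrow> a = b" for a b
    using inj_eq[OF z, of 0 1] by (cases a; cases b) (auto simp: q_def p_eq)
  then have "inj (\<lambda>(a, b). p (q a, q b))"
    by (auto intro!: injI simp: p_eq)
  then show ?thesis by blast
qed

text \<open>For \<open>E\<close> on \<open>'u\<close> the algebra \<open>K0 (two_plus E)\<close>
  lives on \<open>'u option \<times> 'u option\<close>; this brings it back to
  \<open>'u\<close>.\<close>

lemma copy_option_prod:
  assumes "is_algebra A" "infinite (UNIV :: 'u set)"
  shows "\<exists>C :: ('f::signature, 'u) algebra.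
    is_algebra C \<and> eq_theory C = eq_theory (A :: ('f, 'u option \<times> 'u option) algebra)"
proof -
  obtain f :: "'u option \<times> 'u option \<Rightarrow> 'u" where "inj f"
    using inj_option_prod[OF assms(2)] by blast
  then show ?thesis
    using copy[OF assms(1), of f] by (meson inj_on_subset subset_UNIV)
qed

subsection \<open>Subdirect irreducibility\<close>

text \<open>The targets \<open>C F\<close> may live on any type and have any index, whereas the
  definition admits only factors on \<open>'a set\<close> indexed by relations on \<open>'a\<close>.
  Each target is replaced by the quotient of \<open>A\<close> by the kernel of \<open>k F\<close>,
  and that kernel serves as the index.\<close>

lemma subdirectly_irreducible_separating:
  fixes A :: "('f::signature, 'a) algebra"
  assumes si: "subdirectly_irreducible A"
    and hom: "\<And>F. F \<in> \<F> \<Longrightarrow> is_hom (k F) A (C F)"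
    and sep: "\<And>x y. x \<in> univ A \<Longrightarrow> y \<in> univ A \<Longrightarrow> (\<And>F. F \<in> \<F> \<Longrightarrow> k F x = k F y) \<Longrightarrow> x = y"
  shows "\<exists>F\<in>\<F>. inj_on (k F) (univ A)"
proof -
  define ker where "ker F = {(x, y). x \<in> univ A \<and> y \<in> univ A \<and> k F x = k F y}" for F
  \<comment> \<open>\<open>h \<theta> x\<close> is the class of \<open>x\<close>, so
    \<open>h (ker F)\<close> and \<open>k F\<close> identify the same elements of
    \<open>A\<close>.\<close>
  define h :: "'a rel \<Rightarrow> 'a \<Rightarrow> 'a set" where "h \<theta> x = \<theta> `` {x}" for \<theta> x
  have h_eq: "h (ker F) x = h (ker F) y \<longleftrightarrow> k F x = k F y" if "x \<in> univ A" "y \<in> univ A" for F x y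
    using that by (auto simp: h_def ker_def)
  have A: "is_algebra A" using si by (simp add: subdirectly_irreducible_def)
  have cong: "congruence_map (h (ker F)) A" if F: "F \<in> \<F>" for F
    unfolding congruence_map_def
  proof (intro allI ballI impI)
    fix f xs ys
    assume xs: "xs \<in> args A f" and ys: "ys \<in> args A f" and eq: "map (h (ker F)) xs = map (h (ker F)) ys"
    have "map (k F) xs = map (k F) ys"
    proof (rule nth_equalityI)
      show "length (map (k F) xs) = length (map (k F) ys)"
        using xs ys by (simp add: args_def)
      fix i assume "i < length (map (k F) xs)"
      then have i: "i < length xs" "i < length ys" "xs ! i \<in> univ A" "ys ! i \<in> univ A"
        using xs ys by (auto simp: args_def subset_iff)
      then show "map (k F) xs ! i = map (k F) ys ! i"
        using arg_cong[OF eq, of "\<lambda>zs. zs ! i"] h_eq[of "xs ! i" "ys ! i" F] by simp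
    qed
    then have "k F (oper A f xs) = k F (oper A f ys)"
      using xs ys is_homD[OF hom[OF F]] by (auto simp: args_def)
    moreover have "oper A f xs \<in> univ A" "oper A f ys \<in> univ A"
      using A xs ys by (auto simp: is_algebra_def)
    ultimately show "h (ker F) (oper A f xs) = h (ker F) (oper A f ys)"
      by (simp add: h_eq)
  qed
  have "subdirect_representation A (ker ` \<F>) (\<lambda>\<theta>. image_algebra (h \<theta>) A) h"
    unfolding subdirect_representation_def
    using cong is_algebra_image_algebra[OF _ A] is_hom_image_algebra h_eq sep by auto
  then obtain F where F: "F \<in> \<F>" "bij_betw (h (ker F)) (univ A) (univ (image_algebra (h (ker F)) A))"
    using si unfolding subdirectly_irreducible_def by blast
  then have "inj_on (k F) (univ A)"
    using h_eq by (auto simp: bij_betw_def inj_on_def)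
  with F show ?thesis by blast
qed

section \<open>Residuated lattices\<close>

lemma is_algebra_rl_sym:
  "is_algebra (R :: (rl_sym, 'a) algebra) \<longleftrightarrow>
     oper R One [] \<in> univ R \<and>
     (\<forall>x\<in>univ R. \<forall>y\<in>univ R. oper R Join [x, y] \<in> univ R \<and> oper R Meet [x, y] \<in> univ R \<and>
        oper R Mult [x, y] \<in> univ R \<and> oper R Impl [x, y] \<in> univ R)"
proof -
  have *: "length xs = 2 \<and> set xs \<subseteq> U \<longleftrightarrow> (\<exists>x\<in>U. \<exists>y\<in>U. xs = [x, y])" for xs :: "'a list" and U
    by (auto simp: length_Suc_conv numeral_2_eq_2)
  have all: "(\<forall>f. P f) \<longleftrightarrow> P Join \<and> P Meet \<and> P Mult \<and> P Impl \<and> P One" for P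
    by (metis rl_sym.exhaust)
  show ?thesis
    unfolding is_algebra_def args_def all by (auto simp: *)
qed

locale crl =
  fixes R :: "(rl_sym, 'a) algebra" (structure)
  assumes CRL: "is_CRL R"
begin

lemma alg: "is_algebra R"
  using CRL by (simp add: is_CRL_def)

lemma closed [simp]:
  "x \<in> univ R \<Longrightarrow> y \<in> univ R \<Longrightarrow> x \<squnion> y \<in> univ R"
  "x \<in> univ R \<Longrightarrow> y \<in> univ R \<Longrightarrow> x \<sqinter> y \<in> univ R"
  "x \<in> univ R \<Longrightarrow> y \<in> univ R \<Longrightarrow> x \<odot> y \<in> univ R"
  "x \<in> univ R \<Longrightarrow> y \<in> univ R \<Longrightarrow> x \<rightarrow> y \<in> univ R"
  "\<one> \<in> univ R"
  using alg by (auto simp: is_algebra_rl_sym join_def meet_def mult_def impl_def one_def)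

lemma join_assoc: "x \<in> univ R \<Longrightarrow> y \<in> univ R \<Longrightarrow> z \<in> univ R \<Longrightarrow> (x \<squnion> y) \<squnion> z = x \<squnion> (y \<squnion> z)"
  and join_comm: "x \<in> univ R \<Longrightarrow> y \<in> univ R \<Longrightarrow> x \<squnion> y = y \<squnion> x"
  and join_absorb: "x \<in> univ R \<Longrightarrow> y \<in> univ R \<Longrightarrow> x \<squnion> (x \<sqinter> y) = x"
  and meet_assoc: "x \<in> univ R \<Longrightarrow> y \<in> univ R \<Longrightarrow> z \<in> univ R \<Longrightarrow> (x \<sqinter> y) \<sqinter> z = x \<sqinter> (y \<sqinter> z)"
  and meet_comm: "x \<in> univ R \<Longrightarrow> y \<in> univ R \<Longrightarrow> x \<sqinter> y = y \<sqinter> x"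
  and meet_absorb: "x \<in> univ R \<Longrightarrow> y \<in> univ R \<Longrightarrow> x \<sqinter> (x \<squnion> y) = x"
  and mult_assoc: "x \<in> univ R \<Longrightarrow> y \<in> univ R \<Longrightarrow> z \<in> univ R \<Longrightarrow> (x \<odot> y) \<odot> z = x \<odot> (y \<odot> z)"
  and mult_comm: "x \<in> univ R \<Longrightarrow> y \<in> univ R \<Longrightarrow> x \<odot> y = y \<odot> x"
  and mult_one [simp]: "x \<in> univ R \<Longrightarrow> x \<odot> \<one> = x"
  and residuation: "x \<in> univ R \<Longrightarrow> y \<in> univ R \<Longrightarrow> z \<in> univ R \<Longrightarrow> x \<odot> y \<sqsubseteq> z \<longleftrightarrow> x \<sqsubseteq> y \<rightarrow> z"
  using CRL unfolding is_CRL_def by blast+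

lemma one_mult [simp]: "x \<in> univ R \<Longrightarrow> \<one> \<odot> x = x"
  using mult_comm[of \<one> x] by simp

lemma meet_idem [simp]: "x \<in> univ R \<Longrightarrow> x \<sqinter> x = x"
  by (metis closed(2) join_absorb meet_absorb)

lemma join_idem [simp]: "x \<in> univ R \<Longrightarrow> x \<squnion> x = x"
  by (metis join_absorb meet_idem)

lemma le_iff_join: "x \<in> univ R \<Longrightarrow> y \<in> univ R \<Longrightarrow> x \<sqsubseteq> y \<longleftrightarrow> x \<squnion> y = y"
  unfolding le_def by (metis join_absorb join_comm meet_absorb meet_comm)

lemma le_refl [simp]: "x \<in> univ R \<Longrightarrow> x \<sqsubseteq> x"
  by (simp add: le_def)

lemma le_trans: "x \<sqsubseteq> y \<Longrightarrow> y \<sqsubseteq> z \<Longrightarrow> x \<in> univ R \<Longrightarrow> y \<in> univ R \<Longrightarrow> z \<in> univ R \<Longrightarrow> x \<sqsubseteq> z"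
  unfolding le_def by (metis meet_assoc)

lemma le_antisym: "x \<sqsubseteq> y \<Longrightarrow> y \<sqsubseteq> x \<Longrightarrow> x \<in> univ R \<Longrightarrow> y \<in> univ R \<Longrightarrow> x = y"
  unfolding le_def by (metis meet_comm)

lemma meet_lb1 [simp]: "x \<in> univ R \<Longrightarrow> y \<in> univ R \<Longrightarrow> x \<sqinter> y \<sqsubseteq> x"
  unfolding le_def by (metis closed(2) meet_assoc meet_comm meet_idem)

lemma meet_lb2 [simp]: "x \<in> univ R \<Longrightarrow> y \<in> univ R \<Longrightarrow> x \<sqinter> y \<sqsubseteq> y"
  by (metis meet_comm meet_lb1)

lemma le_meet_iff:
  "x \<in> univ R \<Longrightarrow> y \<in> univ R \<Longrightarrow> z \<in> univ R \<Longrightarrow> z \<sqsubseteq> x \<sqinter> y \<longleftrightarrow> z \<sqsubseteq> x \<and> z \<sqsubseteq> y"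
  by (metis closed(2) le_def le_trans meet_assoc meet_lb1 meet_lb2)

lemma join_ub1 [simp]: "x \<in> univ R \<Longrightarrow> y \<in> univ R \<Longrightarrow> x \<sqsubseteq> x \<squnion> y"
  by (simp add: le_def meet_absorb)

lemma join_ub2 [simp]: "x \<in> univ R \<Longrightarrow> y \<in> univ R \<Longrightarrow> y \<sqsubseteq> x \<squnion> y"
  by (metis join_comm join_ub1)

lemma join_le_iff:
  "x \<in> univ R \<Longrightarrow> y \<in> univ R \<Longrightarrow> z \<in> univ R \<Longrightarrow> x \<squnion> y \<sqsubseteq> z \<longleftrightarrow> x \<sqsubseteq> z \<and> y \<sqsubseteq> z"
  by (metis closed(1) join_assoc join_ub1 join_ub2 le_iff_join le_trans)

text \<open>An element is determined by what lies below it, so laws of residuation reduce to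
  rewriting conditions of the form \<open>z \<sqsubseteq> x\<close>.\<close>

lemma eqI_le:
  "x \<in> univ R \<Longrightarrow> y \<in> univ R \<Longrightarrow> (\<And>z. z \<in> univ R \<Longrightarrow> z \<sqsubseteq> x \<longleftrightarrow> z \<sqsubseteq> y) \<Longrightarrow> x = y"
  by (metis le_antisym le_refl)

lemma eqI_ge:
  "x \<in> univ R \<Longrightarrow> y \<in> univ R \<Longrightarrow> (\<And>z. z \<in> univ R \<Longrightarrow> x \<sqsubseteq> z \<longleftrightarrow> y \<sqsubseteq> z) \<Longrightarrow> x = y"
  by (metis le_antisym le_refl)

lemma impl_mp: "x \<in> univ R \<Longrightarrow> y \<in> univ R \<Longrightarrow> (x \<rightarrow> y) \<odot> x \<sqsubseteq> y"
  by (simp add: residuation)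

lemma mult_mono1: "x \<sqsubseteq> y \<Longrightarrow> x \<in> univ R \<Longrightarrow> y \<in> univ R \<Longrightarrow> z \<in> univ R \<Longrightarrow> x \<odot> z \<sqsubseteq> y \<odot> z"
  by (metis closed(3) closed(4) le_refl le_trans residuation)

lemma mult_mono:
  assumes "x \<sqsubseteq> y" "z \<sqsubseteq> w" "x \<in> univ R" "y \<in> univ R" "z \<in> univ R" "w \<in> univ R"
  shows "x \<odot> z \<sqsubseteq> y \<odot> w"
proof -
  have "x \<odot> z \<sqsubseteq> y \<odot> z" "y \<odot> z \<sqsubseteq> y \<odot> w"
    using mult_mono1[OF assms(1), of z] mult_mono1[OF assms(2), of y] assms
      mult_comm[of z y] mult_comm[of w y] by simp_all
  then show ?thesis using le_trans assms by (meson closed(3))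
qed

lemma mult_join_distrib:
  assumes "x \<in> univ R" "y \<in> univ R" "z \<in> univ R"
  shows "(x \<squnion> y) \<odot> z = x \<odot> z \<squnion> y \<odot> z"
  using assms by (intro eqI_ge) (auto simp: residuation join_le_iff)

lemma impl_impl:
  assumes "x \<in> univ R" "y \<in> univ R" "z \<in> univ R"
  shows "x \<rightarrow> (y \<rightarrow> z) = (x \<odot> y) \<rightarrow> z"
  using assms by (intro eqI_le) (auto simp: residuation[symmetric] mult_assoc)

lemma one_impl [simp]: "x \<in> univ R \<Longrightarrow> \<one> \<rightarrow> x = x"
  by (rule eqI_le) (auto simp: residuation[symmetric])

lemma impl_meet:
  assumes "x \<in> univ R" "y \<in> univ R" "z \<in> univ R"
  shows "x \<rightarrow> (y \<sqinter> z) = (x \<rightarrow> y) \<sqinter> (x \<rightarrow> z)"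
  using assms by (intro eqI_le) (auto simp: residuation[symmetric] le_meet_iff)

lemma join_impl:
  assumes "x \<in> univ R" "y \<in> univ R" "z \<in> univ R"
  shows "(x \<squnion> y) \<rightarrow> z = (x \<rightarrow> z) \<sqinter> (y \<rightarrow> z)"
proof (rule eqI_le)
  fix w assume w: "w \<in> univ R"
  have "w \<odot> (x \<squnion> y) = w \<odot> x \<squnion> w \<odot> y"
    using mult_join_distrib[of x y w] assms w mult_comm by simp
  then show "w \<sqsubseteq> (x \<squnion> y) \<rightarrow> z \<longleftrightarrow> w \<sqsubseteq> (x \<rightarrow> z) \<sqinter> (y \<rightarrow> z)"
    using assms w by (simp add: residuation[symmetric] le_meet_iff join_le_iff)
qed (use assms in auto)

lemma impl_mono2:
  "y \<sqsubseteq> z \<Longrightarrow> x \<in> univ R \<Longrightarrow> y \<in> univ R \<Longrightarrow> z \<in> univ R \<Longrightarrow> x \<rightarrow> y \<sqsubseteq> x \<rightarrow> z"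
  by (metis impl_meet le_def)

text \<open>Yields transitivity of the congruence of a filter, and its compatibility with
  implication.\<close>

lemma impl_chain:
  assumes "x \<in> univ R" "y \<in> univ R" "z \<in> univ R"
  shows "(x \<rightarrow> y) \<odot> (y \<rightarrow> z) \<sqsubseteq> x \<rightarrow> z"
proof -
  have "((x \<rightarrow> y) \<odot> (y \<rightarrow> z)) \<odot> x = (y \<rightarrow> z) \<odot> ((x \<rightarrow> y) \<odot> x)"
    using assms by (metis closed(4) mult_assoc mult_comm)
  moreover have "(y \<rightarrow> z) \<odot> ((x \<rightarrow> y) \<odot> x) \<sqsubseteq> (y \<rightarrow> z) \<odot> y"
    using assms by (intro mult_mono impl_mp) auto
  ultimately have "((x \<rightarrow> y) \<odot> (y \<rightarrow> z)) \<odot> x \<sqsubseteq> z"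
    using assms impl_mp[of y z] by (metis closed(3) closed(4) le_trans)
  then show ?thesis using assms by (simp add: residuation)
qed

end

locale cirl = crl +
  assumes le_one [simp]: "x \<in> univ R \<Longrightarrow> x \<sqsubseteq> \<one>"
begin

lemma mult_le1 [simp]: "x \<in> univ R \<Longrightarrow> y \<in> univ R \<Longrightarrow> x \<odot> y \<sqsubseteq> x"
  using mult_mono[of x x y \<one>] by simp

lemma mult_le2 [simp]: "x \<in> univ R \<Longrightarrow> y \<in> univ R \<Longrightarrow> x \<odot> y \<sqsubseteq> y"
  using mult_le1[of y x] mult_comm by simp

lemma one_le_iff: "x \<in> univ R \<Longrightarrow> \<one> \<sqsubseteq> x \<longleftrightarrow> x = \<one>"
  using le_antisym[of \<one> x] by auto

lemma impl_eq_one: "x \<in> univ R \<Longrightarrow> y \<in> univ R \<Longrightarrow> x \<rightarrow> y = \<one> \<longleftrightarrow> x \<sqsubseteq> y"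
  using residuation[of \<one> x y] one_le_iff[of "x \<rightarrow> y"] by auto

lemma impl_self [simp]: "x \<in> univ R \<Longrightarrow> x \<rightarrow> x = \<one>"
  and impl_one [simp]: "x \<in> univ R \<Longrightarrow> x \<rightarrow> \<one> = \<one>"
  by (simp_all add: impl_eq_one)

lemma le_impl [simp]: "x \<in> univ R \<Longrightarrow> y \<in> univ R \<Longrightarrow> y \<sqsubseteq> x \<rightarrow> y"
  by (simp add: residuation[symmetric])

lemma meet_one [simp]: "x \<in> univ R \<Longrightarrow> x \<sqinter> \<one> = x" "x \<in> univ R \<Longrightarrow> \<one> \<sqinter> x = x"
  using le_one meet_comm by (auto simp: le_def)

lemma join_one [simp]: "x \<in> univ R \<Longrightarrow> x \<squnion> \<one> = \<one>" "x \<in> univ R \<Longrightarrow> \<one> \<squnion> x = \<one>"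
  using le_one le_iff_join join_comm by auto

lemma mult_le_meet: "x \<in> univ R \<Longrightarrow> y \<in> univ R \<Longrightarrow> x \<odot> y \<sqsubseteq> x \<sqinter> y"
  by (simp add: le_meet_iff)

text \<open>For \<open>x \<squnion> y\<close> in a filter \<open>F\<close>, this makes \<open>{z. z \<squnion> y \<in> F}\<close> a filter, which is how primeness
  of maximal filters is obtained below without powers.\<close>

lemma join_mult_le:
  assumes "x \<in> univ R" "y \<in> univ R" "z \<in> univ R"
  shows "(x \<squnion> z) \<odot> (y \<squnion> z) \<sqsubseteq> (x \<odot> y) \<squnion> z"
proof -
  have "(x \<squnion> z) \<odot> (y \<squnion> z) = x \<odot> (y \<squnion> z) \<squnion> z \<odot> (y \<squnion> z)"
    using assms by (simp add: mult_join_distrib)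
  moreover have "x \<odot> (y \<squnion> z) = x \<odot> y \<squnion> x \<odot> z"
    using assms mult_join_distrib[of y z x] mult_comm by simp
  moreover have "x \<odot> z \<sqsubseteq> (x \<odot> y) \<squnion> z" "z \<odot> (y \<squnion> z) \<sqsubseteq> (x \<odot> y) \<squnion> z"
    using assms by (meson closed join_ub2 le_trans mult_le1 mult_le2)+
  ultimately show ?thesis
    using assms by (simp add: join_le_iff)
qed

end

lemma CIRL_iff: "R \<in> CIRL \<longleftrightarrow> cirl R"
  unfolding CIRL_def cirl_def cirl_axioms_def crl_def by auto

subsection \<open>Equational presentations\<close>

definition val :: "'a \<Rightarrow> 'a \<Rightarrow> 'a \<Rightarrow> nat \<Rightarrow> 'a" where
  "val x y z n = (if n = 0 then x else if n = 1 then y else z)"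

lemma val_simps [simp]: "val x y z 0 = x" "val x y z (Suc 0) = y" "val x y z 2 = z"
  by (simp_all add: val_def)

text \<open>Moves one concrete identity in at most three variables from \<open>A\<close> to chosen
  elements of \<open>B\<close>. The classes under study are closed under models of the theory of a
  member because their axioms can be brought into this form.\<close>

lemma eq_theory_transfer:
  assumes sub: "eq_theory A \<subseteq> eq_theory B" and wf: "wf_trm s" "wf_trm t"
    and hold: "\<And>v. (\<And>n. v n \<in> univ A) \<Longrightarrow> eval_trm A v s = eval_trm A v t"
    and B: "x \<in> univ B" "y \<in> univ B" "z \<in> univ B"
  shows "eval_trm B (val x y z) s = eval_trm B (val x y z) t"
proof -
  have "(s, t) \<in> eq_theory A" using wf hold by (simp add: mem_eq_theory)
  then have "(s, t) \<in> eq_theory B" using sub by blast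
  then show ?thesis using B by (auto simp: mem_eq_theory val_def)
qed

abbreviation (input) "X0 \<equiv> Var 0"
abbreviation (input) "X1 \<equiv> Var (Suc 0)"
abbreviation (input) "X2 \<equiv> Var 2"
abbreviation (input) "tJ s t \<equiv> App Join [s, t]"
abbreviation (input) "tM s t \<equiv> App Meet [s, t]"
abbreviation (input) "tP s t \<equiv> App Mult [s, t]"
abbreviation (input) "tI s t \<equiv> App Impl [s, t]"
abbreviation (input) "t1 \<equiv> App One []"

lemma eval_rl [simp]:
  "eval_trm R v (tJ s t) = eval_trm R v s \<squnion>\<^bsub>R\<^esub> eval_trm R v t"
  "eval_trm R v (tM s t) = eval_trm R v s \<sqinter>\<^bsub>R\<^esub> eval_trm R v t"
  "eval_trm R v (tP s t) = eval_trm R v s \<odot>\<^bsub>R\<^esub> eval_trm R v t"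
  "eval_trm R v (tI s t) = eval_trm R v s \<rightarrow>\<^bsub>R\<^esub> eval_trm R v t"
  "eval_trm R v t1 = \<one>\<^bsub>R\<^esub>"
  by (simp_all add: join_def meet_def mult_def impl_def one_def)

declare eval_trm.simps(2) [simp del]

text \<open>Residuation is an equivalence and not an identity. It is recovered from three
  identities: (y \<rightarrow> z)y \<le> z, distributivity of the product over joins, and x \<le> y
  \<rightarrow> (xy \<squnion> z).\<close>

lemma is_CRL_transfer:
  assumes R: "is_CRL R" and S: "is_algebra S" and sub: "eq_theory R \<subseteq> eq_theory S"
  shows "is_CRL S"
proof -
  interpret crl R using R by unfold_locales
  have S_closed:
    "x \<in> univ S \<Longrightarrow> y \<in> univ S \<Longrightarrow> x \<squnion>\<^bsub>S\<^esub> y \<in> univ S"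
    "x \<in> univ S \<Longrightarrow> y \<in> univ S \<Longrightarrow> x \<odot>\<^bsub>S\<^esub> y \<in> univ S"
    "x \<in> univ S \<Longrightarrow> y \<in> univ S \<Longrightarrow> x \<rightarrow>\<^bsub>S\<^esub> y \<in> univ S" for x y
    using S by (auto simp: is_algebra_rl_sym join_def mult_def impl_def)
  note tr = eq_theory_transfer[OF sub, where x = x and y = y and z = z for x y z]
  show ?thesis
    unfolding is_CRL_def
  proof (intro conjI ballI S)
    fix x y z assume xyz: "x \<in> univ S" "y \<in> univ S" "z \<in> univ S"
    show "(x \<squnion>\<^bsub>S\<^esub> y) \<squnion>\<^bsub>S\<^esub> z = x \<squnion>\<^bsub>S\<^esub> (y \<squnion>\<^bsub>S\<^esub> z)"
      using tr[of "tJ (tJ X0 X1) X2" "tJ X0 (tJ X1 X2)" x y z] xyz by (simp add: join_assoc)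
    show jc: "x \<squnion>\<^bsub>S\<^esub> y = y \<squnion>\<^bsub>S\<^esub> x" if "x \<in> univ S" "y \<in> univ S" for x y
      using tr[of "tJ X0 X1" "tJ X1 X0" x y z] that xyz by (simp add: join_comm)
    show ja: "x \<squnion>\<^bsub>S\<^esub> (x \<sqinter>\<^bsub>S\<^esub> y) = x" if "x \<in> univ S" "y \<in> univ S" for x y
      using tr[of "tJ X0 (tM X0 X1)" "X0" x y z] that xyz by (simp add: join_absorb)
    show "(x \<sqinter>\<^bsub>S\<^esub> y) \<sqinter>\<^bsub>S\<^esub> z = x \<sqinter>\<^bsub>S\<^esub> (y \<sqinter>\<^bsub>S\<^esub> z)"
      using tr[of "tM (tM X0 X1) X2" "tM X0 (tM X1 X2)" x y z] xyz by (simp add: meet_assoc)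
    show mc: "x \<sqinter>\<^bsub>S\<^esub> y = y \<sqinter>\<^bsub>S\<^esub> x" if "x \<in> univ S" "y \<in> univ S" for x y
      using tr[of "tM X0 X1" "tM X1 X0" x y z] that xyz by (simp add: meet_comm)
    show ma: "x \<sqinter>\<^bsub>S\<^esub> (x \<squnion>\<^bsub>S\<^esub> y) = x" if "x \<in> univ S" "y \<in> univ S" for x y
      using tr[of "tM X0 (tJ X0 X1)" "X0" x y z] that xyz by (simp add: meet_absorb)
    show "(x \<odot>\<^bsub>S\<^esub> y) \<odot>\<^bsub>S\<^esub> z = x \<odot>\<^bsub>S\<^esub> (y \<odot>\<^bsub>S\<^esub> z)"
      using tr[of "tP (tP X0 X1) X2" "tP X0 (tP X1 X2)" x y z] xyz by (simp add: mult_assoc)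
    show "x \<odot>\<^bsub>S\<^esub> y = y \<odot>\<^bsub>S\<^esub> x"
      using tr[of "tP X0 X1" "tP X1 X0" x y z] xyz by (simp add: mult_comm)
    show "x \<odot>\<^bsub>S\<^esub> \<one>\<^bsub>S\<^esub> = x"
      using tr[of "tP X0 t1" "X0" x y z] xyz by simp
    have le_join: "x \<sqsubseteq>\<^bsub>S\<^esub> y \<longleftrightarrow> x \<squnion>\<^bsub>S\<^esub> y = y" if "x \<in> univ S" "y \<in> univ S" for x y
      unfolding le_def using ja jc ma mc that by metis
    have mp: "(y \<rightarrow>\<^bsub>S\<^esub> z) \<odot>\<^bsub>S\<^esub> y \<squnion>\<^bsub>S\<^esub> z = z"
      using tr[of "tJ (tP (tI X1 X2) X1) X2" "X2" x y z] xyz by (simp add: le_iff_join[symmetric] impl_mp)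
    have dist: "(x \<squnion>\<^bsub>S\<^esub> w) \<odot>\<^bsub>S\<^esub> y = x \<odot>\<^bsub>S\<^esub> y \<squnion>\<^bsub>S\<^esub> w \<odot>\<^bsub>S\<^esub> y" if "w \<in> univ S" for w
      using tr[of "tP (tJ X0 X2) X1" "tJ (tP X0 X1) (tP X2 X1)" x y w] that xyz
      by (simp add: mult_join_distrib)
    have unit: "x \<sqinter>\<^bsub>S\<^esub> (y \<rightarrow>\<^bsub>S\<^esub> (x \<odot>\<^bsub>S\<^esub> y \<squnion>\<^bsub>S\<^esub> z)) = x"
      using tr[of "tM X0 (tI X1 (tJ (tP X0 X1) X2))" "X0" x y z] xyz
      by (simp add: le_def[symmetric] residuation[symmetric])
    \<comment> \<open>Associativity of the join at products, again taken as an identity in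
      \<open>x\<close>, \<open>y\<close>, \<open>z\<close>; it lets the inequality for x \<squnion>
      (y \<rightarrow> z), multiplied by y, be combined with \<open>mp\<close>.\<close>
    have assoc: "(x \<odot>\<^bsub>S\<^esub> y \<squnion>\<^bsub>S\<^esub> (y \<rightarrow>\<^bsub>S\<^esub> z) \<odot>\<^bsub>S\<^esub> y) \<squnion>\<^bsub>S\<^esub> z = x \<odot>\<^bsub>S\<^esub> y \<squnion>\<^bsub>S\<^esub> ((y \<rightarrow>\<^bsub>S\<^esub> z) \<odot>\<^bsub>S\<^esub> y \<squnion>\<^bsub>S\<^esub> z)"
      using tr[of "tJ (tJ (tP X0 X1) (tP (tI X1 X2) X1)) X2" "tJ (tP X0 X1) (tJ (tP (tI X1 X2) X1) X2)" x y z] xyz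
      by (simp add: join_assoc)
    show "x \<odot>\<^bsub>S\<^esub> y \<sqsubseteq>\<^bsub>S\<^esub> z \<longleftrightarrow> x \<sqsubseteq>\<^bsub>S\<^esub> y \<rightarrow>\<^bsub>S\<^esub> z"
    proof
      assume "x \<odot>\<^bsub>S\<^esub> y \<sqsubseteq>\<^bsub>S\<^esub> z"
      then have "x \<odot>\<^bsub>S\<^esub> y \<squnion>\<^bsub>S\<^esub> z = z" using le_join xyz S_closed by simp
      then show "x \<sqsubseteq>\<^bsub>S\<^esub> y \<rightarrow>\<^bsub>S\<^esub> z" using unit by (simp add: le_def)
    next
      assume "x \<sqsubseteq>\<^bsub>S\<^esub> y \<rightarrow>\<^bsub>S\<^esub> z"
      then have "x \<squnion>\<^bsub>S\<^esub> (y \<rightarrow>\<^bsub>S\<^esub> z) = y \<rightarrow>\<^bsub>S\<^esub> z" using le_join xyz S_closed by simp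
      then have "x \<odot>\<^bsub>S\<^esub> y \<squnion>\<^bsub>S\<^esub> (y \<rightarrow>\<^bsub>S\<^esub> z) \<odot>\<^bsub>S\<^esub> y = (y \<rightarrow>\<^bsub>S\<^esub> z) \<odot>\<^bsub>S\<^esub> y"
        using dist[of "y \<rightarrow>\<^bsub>S\<^esub> z"] xyz S_closed by simp
      then show "x \<odot>\<^bsub>S\<^esub> y \<sqsubseteq>\<^bsub>S\<^esub> z" using assoc mp le_join xyz S_closed by simp
    qed
  qed
qed

lemma CIRL_transfer:
  assumes R: "R \<in> CIRL" and S: "is_algebra S" and sub: "eq_theory R \<subseteq> eq_theory S"
  shows "S \<in> CIRL"
proof -
  interpret cirl R using R by (simp add: CIRL_iff)
  have "x \<sqsubseteq>\<^bsub>S\<^esub> \<one>\<^bsub>S\<^esub>" if "x \<in> univ S" for x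
    using eq_theory_transfer[OF sub, of "tM X0 t1" X0 x x x] that by (simp add: le_def)
  then show ?thesis
    using is_CRL_transfer[OF CRL S sub] by (simp add: CIRL_def)
qed

subsection \<open>Bounded algebras\<close>

lemma rl_algebra_simps [simp]:
  "univ (rl_algebra U jn mt ml im e) = U"
  "x \<squnion>\<^bsub>rl_algebra U jn mt ml im e\<^esub> y = jn x y"
  "x \<sqinter>\<^bsub>rl_algebra U jn mt ml im e\<^esub> y = mt x y"
  "x \<odot>\<^bsub>rl_algebra U jn mt ml im e\<^esub> y = ml x y"
  "x \<rightarrow>\<^bsub>rl_algebra U jn mt ml im e\<^esub> y = im x y"
  "\<one>\<^bsub>rl_algebra U jn mt ml im e\<^esub> = e"
  by (simp_all add: rl_algebra_def join_def meet_def mult_def impl_def one_def)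

lemma with_zero_simps [simp]:
  "univ (with_zero R z) = univ R" "rl (with_zero R z) = R" "zero (with_zero R z) = z"
  by (simp_all add: with_zero_def rl_def zero_def)

lemma univ_rl [simp]: "univ (rl A) = univ A"
  by (simp add: rl_def)

lemma rl_univ_update [simp]:
  "rl (A\<lparr>univ := S\<rparr>) = (rl A)\<lparr>univ := S\<rparr>" "zero (A\<lparr>univ := S\<rparr>) = zero A"
  by (simp_all add: rl_def zero_def)

lemma oper_univ_update [simp]:
  "x \<squnion>\<^bsub>R\<lparr>univ := S\<rparr>\<^esub> y = x \<squnion>\<^bsub>R\<^esub> y" "x \<sqinter>\<^bsub>R\<lparr>univ := S\<rparr>\<^esub> y = x \<sqinter>\<^bsub>R\<^esub> y"
  "x \<odot>\<^bsub>R\<lparr>univ := S\<rparr>\<^esub> y = x \<odot>\<^bsub>R\<^esub> y" "x \<rightarrow>\<^bsub>R\<lparr>univ := S\<rparr>\<^esub> y = x \<rightarrow>\<^bsub>R\<^esub> y"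
  "\<one>\<^bsub>R\<lparr>univ := S\<rparr>\<^esub> = \<one>\<^bsub>R\<^esub>" "x \<sqsubseteq>\<^bsub>R\<lparr>univ := S\<rparr>\<^esub> y \<longleftrightarrow> x \<sqsubseteq>\<^bsub>R\<^esub> y"
  by (simp_all add: join_def meet_def mult_def impl_def one_def le_def)

lemma is_algebra_rl:
  "is_algebra R \<longleftrightarrow>
     \<one>\<^bsub>R\<^esub> \<in> univ R \<and>
     (\<forall>x\<in>univ R. \<forall>y\<in>univ R. x \<squnion>\<^bsub>R\<^esub> y \<in> univ R \<and> x \<sqinter>\<^bsub>R\<^esub> y \<in> univ R \<and>
        x \<odot>\<^bsub>R\<^esub> y \<in> univ R \<and> x \<rightarrow>\<^bsub>R\<^esub> y \<in> univ R)"
  by (simp add: is_algebra_rl_sym join_def meet_def mult_def impl_def one_def)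

lemma all_brl_sym: "(\<forall>f. P f) \<longleftrightarrow> (\<forall>g. P (RL g)) \<and> P Zero"
  by (metis brl_sym.exhaust)

lemma is_algebra_brl: "is_algebra A \<longleftrightarrow> is_algebra (rl A) \<and> zero A \<in> univ A"
  unfolding is_algebra_def all_brl_sym args_def by (auto simp: rl_def zero_def)

lemma is_hom_rl_iff:
  "is_hom h R S \<longleftrightarrow> (\<forall>x\<in>univ R. h x \<in> univ S) \<and> h \<one>\<^bsub>R\<^esub> = \<one>\<^bsub>S\<^esub> \<and>
     (\<forall>x\<in>univ R. \<forall>y\<in>univ R. h (x \<squnion>\<^bsub>R\<^esub> y) = h x \<squnion>\<^bsub>S\<^esub> h y \<and> h (x \<sqinter>\<^bsub>R\<^esub> y) = h x \<sqinter>\<^bsub>S\<^esub> h y \<and>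
        h (x \<odot>\<^bsub>R\<^esub> y) = h x \<odot>\<^bsub>S\<^esub> h y \<and> h (x \<rightarrow>\<^bsub>R\<^esub> y) = h x \<rightarrow>\<^bsub>S\<^esub> h y)"
proof -
  have *: "length xs = 2 \<and> set xs \<subseteq> U \<longleftrightarrow> (\<exists>x\<in>U. \<exists>y\<in>U. xs = [x, y])" for xs :: "'a list" and U
    by (auto simp: length_Suc_conv numeral_2_eq_2)
  have all: "(\<forall>f. P f) \<longleftrightarrow> P Join \<and> P Meet \<and> P Mult \<and> P Impl \<and> P One" for P
    by (metis rl_sym.exhaust)
  show ?thesis
    unfolding is_hom_def args_def all join_def meet_def mult_def impl_def one_def image_subset_iff
    by (auto simp: *)
qed

lemma is_hom_brl_iff: "is_hom h A B \<longleftrightarrow> is_hom h (rl A) (rl B) \<and> h (zero A) = zero B"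
  unfolding is_hom_def all_brl_sym args_def by (auto simp: rl_def zero_def)

lemma eval_map_RL: "eval_trm A v (map_trm RL t) = eval_trm (rl A) v t"
  by (induction t) (simp_all add: eval_trm.simps(2) rl_def cong: map_cong)

lemma wf_map_RL [simp]: "wf_trm (map_trm RL t) \<longleftrightarrow> wf_trm t"
  by (induction t) auto

lemma eq_theory_rl_mono: "eq_theory A \<subseteq> eq_theory B \<Longrightarrow> eq_theory (rl A) \<subseteq> eq_theory (rl B)"
proof safe
  fix s t assume sub: "eq_theory A \<subseteq> eq_theory B" and st: "(s, t) \<in> eq_theory (rl A)"
  then have "(map_trm RL s, map_trm RL t) \<in> eq_theory A"
    by (simp add: mem_eq_theory eval_map_RL)
  then have "(map_trm RL s, map_trm RL t) \<in> eq_theory B" using sub by blast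
  then show "(s, t) \<in> eq_theory (rl B)" by (simp add: mem_eq_theory eval_map_RL)
qed

abbreviation (input) "bJ s t \<equiv> App (RL Join) [s, t]"
abbreviation (input) "bM s t \<equiv> App (RL Meet) [s, t]"
abbreviation (input) "bP s t \<equiv> App (RL Mult) [s, t]"
abbreviation (input) "bI s t \<equiv> App (RL Impl) [s, t]"
abbreviation (input) "b1 \<equiv> App (RL One) []"
abbreviation (input) "b0 \<equiv> App Zero []"

lemma eval_brl [simp]:
  "eval_trm A v (bJ s t) = eval_trm A v s \<squnion>\<^bsub>rl A\<^esub> eval_trm A v t"
  "eval_trm A v (bM s t) = eval_trm A v s \<sqinter>\<^bsub>rl A\<^esub> eval_trm A v t"
  "eval_trm A v (bP s t) = eval_trm A v s \<odot>\<^bsub>rl A\<^esub> eval_trm A v t"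
  "eval_trm A v (bI s t) = eval_trm A v s \<rightarrow>\<^bsub>rl A\<^esub> eval_trm A v t"
  "eval_trm A v b1 = \<one>\<^bsub>rl A\<^esub>"
  "eval_trm A v b0 = zero A"
  by (simp_all add: eval_trm.simps(2) join_def meet_def mult_def impl_def one_def zero_def rl_def)

locale bcrl = cirl +
  fixes B
  assumes R_def: "R = rl B"
    and zero_closed [simp]: "zero B \<in> univ R"
    and zero_le [simp]: "x \<in> univ R \<Longrightarrow> zero B \<sqsubseteq> x"
begin

lemma neg_eq: "neg B x = x \<rightarrow> zero B"
  by (simp add: neg_def R_def)

lemma neg_closed [simp]: "x \<in> univ R \<Longrightarrow> neg B x \<in> univ R"
  by (simp add: neg_eq)

lemma le_zero_iff: "x \<in> univ R \<Longrightarrow> x \<sqsubseteq> zero B \<longleftrightarrow> x = zero B"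
  using le_antisym[of x "zero B"] by auto

lemma neg_eq_one_iff: "x \<in> univ R \<Longrightarrow> neg B x = \<one> \<longleftrightarrow> x = zero B"
  by (simp add: neg_eq impl_eq_one le_zero_iff)

lemma zero_impl [simp]: "x \<in> univ R \<Longrightarrow> zero B \<rightarrow> x = \<one>"
  by (simp add: impl_eq_one)

lemma zero_mult [simp]: "x \<in> univ R \<Longrightarrow> zero B \<odot> x = zero B" "x \<in> univ R \<Longrightarrow> x \<odot> zero B = zero B"
  using le_zero_iff by (metis closed(3) mult_le1 zero_closed, metis closed(3) mult_le2 zero_closed)

lemma zero_join [simp]: "x \<in> univ R \<Longrightarrow> zero B \<squnion> x = x" "x \<in> univ R \<Longrightarrow> x \<squnion> zero B = x"
  using le_iff_join join_comm by (metis zero_closed zero_le)+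

lemma zero_meet [simp]: "x \<in> univ R \<Longrightarrow> zero B \<sqinter> x = zero B" "x \<in> univ R \<Longrightarrow> x \<sqinter> zero B = zero B"
  using meet_comm zero_le unfolding le_def by (metis zero_closed)+

end

lemma BCRL_iff: "B \<in> BCRL \<longleftrightarrow> bcrl (rl B) B"
  unfolding BCRL_def bcrl_def bcrl_axioms_def CIRL_iff
  by (auto simp: is_algebra_brl CIRL_def CIRL_iff[symmetric] is_CRL_def)

lemma BCRL_transfer:
  assumes B: "B \<in> BCRL" and C: "is_algebra C" and sub: "eq_theory B \<subseteq> eq_theory C"
  shows "C \<in> BCRL"
proof -
  interpret bcrl "rl B" B using B by (simp add: BCRL_iff)
  have "rl C \<in> CIRL"
    using CIRL_transfer[of "rl B" "rl C"] B C eq_theory_rl_mono[OF sub]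
    by (simp add: BCRL_def is_algebra_brl)
  moreover have "zero C \<sqsubseteq>\<^bsub>rl C\<^esub> x" if "x \<in> univ C" for x
    using eq_theory_transfer[OF sub, of "bM b0 X0" b0 x x x] that by (simp add: le_def)
  ultimately show ?thesis using C by (simp add: BCRL_def)
qed

section \<open>Bounded K-lattices\<close>

lemma neg_cone_simps [simp]:
  "univ (neg_cone A) = {a \<in> univ A. a \<sqsubseteq>\<^bsub>rl A\<^esub> \<one>\<^bsub>rl A\<^esub>}"
  "x \<squnion>\<^bsub>rl (neg_cone A)\<^esub> y = x \<squnion>\<^bsub>rl A\<^esub> y"
  "x \<sqinter>\<^bsub>rl (neg_cone A)\<^esub> y = x \<sqinter>\<^bsub>rl A\<^esub> y"
  "x \<odot>\<^bsub>rl (neg_cone A)\<^esub> y = x \<odot>\<^bsub>rl A\<^esub> y"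
  "x \<rightarrow>\<^bsub>rl (neg_cone A)\<^esub> y = (x \<rightarrow>\<^bsub>rl A\<^esub> y) \<sqinter>\<^bsub>rl A\<^esub> \<one>\<^bsub>rl A\<^esub>"
  "\<one>\<^bsub>rl (neg_cone A)\<^esub> = \<one>\<^bsub>rl A\<^esub>"
  "x \<sqsubseteq>\<^bsub>rl (neg_cone A)\<^esub> y \<longleftrightarrow> x \<sqsubseteq>\<^bsub>rl A\<^esub> y"
  "zero (neg_cone A) = zero A"
  "neg (neg_cone A) x = (x \<rightarrow>\<^bsub>rl A\<^esub> zero A) \<sqinter>\<^bsub>rl A\<^esub> \<one>\<^bsub>rl A\<^esub>"
  by (simp_all add: neg_cone_def Let_def le_def neg_def)

lemma K_simps [simp]:
  "univ (K C) = univ C \<times> univ C"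
  "(a, b) \<squnion>\<^bsub>rl (K C)\<^esub> (c, d) = (a \<squnion>\<^bsub>rl C\<^esub> c, b \<sqinter>\<^bsub>rl C\<^esub> d)"
  "(a, b) \<sqinter>\<^bsub>rl (K C)\<^esub> (c, d) = (a \<sqinter>\<^bsub>rl C\<^esub> c, b \<squnion>\<^bsub>rl C\<^esub> d)"
  "(a, b) \<odot>\<^bsub>rl (K C)\<^esub> (c, d) = (a \<odot>\<^bsub>rl C\<^esub> c, (a \<rightarrow>\<^bsub>rl C\<^esub> d) \<sqinter>\<^bsub>rl C\<^esub> (c \<rightarrow>\<^bsub>rl C\<^esub> b))"
  "(a, b) \<rightarrow>\<^bsub>rl (K C)\<^esub> (c, d) = ((a \<rightarrow>\<^bsub>rl C\<^esub> c) \<sqinter>\<^bsub>rl C\<^esub> (d \<rightarrow>\<^bsub>rl C\<^esub> b), a \<odot>\<^bsub>rl C\<^esub> d)"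
  "\<one>\<^bsub>rl (K C)\<^esub> = (\<one>\<^bsub>rl C\<^esub>, \<one>\<^bsub>rl C\<^esub>)"
  "zero (K C) = (zero C, \<one>\<^bsub>rl C\<^esub>)"
  by (simp_all add: K_def Let_def)

locale bkl = crl +
  fixes A
  assumes R_def: "R = rl A" and bkl: "is_bounded_K_lattice A"
begin

abbreviation involution ("\<sim> _" [80] 80) where "\<sim> x \<equiv> inv_neg R x"
abbreviation cone_implication (infixr "\<rightarrow>\<^sup>-" 60) where "x \<rightarrow>\<^sup>- y \<equiv> (x \<rightarrow> y) \<sqinter> \<one>"

lemma univ_A: "univ A = univ R"
  by (simp add: R_def)

lemma alg_A: "is_algebra A"
  using bkl by (simp add: is_bounded_K_lattice_def)

lemma K: "is_K_lattice R"
  using bkl by (simp add: is_bounded_K_lattice_def R_def)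

lemma zero_closed [simp]: "zero A \<in> univ R"
  using alg_A by (simp add: is_algebra_brl univ_A)

lemma zero_le [simp]: "x \<in> univ R \<Longrightarrow> zero A \<sqsubseteq> x"
  using bkl by (simp add: is_bounded_K_lattice_def R_def)

lemma inv_closed [simp]: "x \<in> univ R \<Longrightarrow> \<sim> x \<in> univ R"
  by (simp add: inv_neg_def)

lemma inv_inv [simp]: "x \<in> univ R \<Longrightarrow> \<sim> \<sim> x = x"
  using K by (simp add: is_K_lattice_def)

lemma inv_one [simp]: "\<sim> \<one> = \<one>"
  by (simp add: inv_neg_def)

lemma inv_join: "x \<in> univ R \<Longrightarrow> y \<in> univ R \<Longrightarrow> \<sim> (x \<squnion> y) = \<sim> x \<sqinter> \<sim> y"
  by (simp add: inv_neg_def join_impl)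

lemma inv_meet: "x \<in> univ R \<Longrightarrow> y \<in> univ R \<Longrightarrow> \<sim> (x \<sqinter> y) = \<sim> x \<squnion> \<sim> y"
  using inv_join[of "\<sim> x" "\<sim> y"] inv_inv[of "\<sim> x \<squnion> \<sim> y"] by simp

lemma inv_mult: "x \<in> univ R \<Longrightarrow> y \<in> univ R \<Longrightarrow> \<sim> (x \<odot> y) = x \<rightarrow> \<sim> y"
  by (simp add: inv_neg_def impl_impl)

lemma inv_impl: "x \<in> univ R \<Longrightarrow> y \<in> univ R \<Longrightarrow> x \<rightarrow> y = \<sim> (x \<odot> \<sim> y)"
  by (simp add: inv_mult)

lemma distrib:
  assumes "x \<in> univ R" "y \<in> univ R" "z \<in> univ R" "x = \<one> \<or> y = \<one> \<or> z = \<one>"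
  shows "x \<sqinter> (y \<squnion> z) = (x \<sqinter> y) \<squnion> (x \<sqinter> z)" "x \<squnion> (y \<sqinter> z) = (x \<squnion> y) \<sqinter> (x \<squnion> z)"
  using K assms unfolding is_K_lattice_def by blast+

lemma mult_meet_one: "x \<in> univ R \<Longrightarrow> y \<in> univ R \<Longrightarrow> (x \<odot> y) \<sqinter> \<one> = (x \<sqinter> \<one>) \<odot> (y \<sqinter> \<one>)"
  using K unfolding is_K_lattice_def by blast

lemma join_meet_one: "x \<in> univ R \<Longrightarrow> y \<in> univ R \<Longrightarrow> (x \<squnion> y) \<sqinter> \<one> = (x \<sqinter> \<one>) \<squnion> (y \<sqinter> \<one>)"
  using distrib(1)[of \<one> x y] meet_comm by simp

lemma meet_meet_one: "x \<in> univ R \<Longrightarrow> y \<in> univ R \<Longrightarrow> (x \<sqinter> y) \<sqinter> \<one> = (x \<sqinter> \<one>) \<sqinter> (y \<sqinter> \<one>)"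
  by (metis closed(2) closed(5) meet_assoc meet_comm meet_idem)

text \<open>If z and a lie below 1 then so does za; hence cutting y off at 1 does not change which z
  \<le> 1 satisfy za \<le> y.\<close>

lemma cone_impl:
  assumes "a \<in> univ R" "y \<in> univ R" "a \<sqsubseteq> \<one>"
  shows "a \<rightarrow>\<^sup>- (y \<sqinter> \<one>) = a \<rightarrow>\<^sup>- y"
proof (rule eqI_le)
  fix z assume z: "z \<in> univ R"
  have "z \<odot> a \<sqsubseteq> \<one>" if "z \<sqsubseteq> \<one>"
    using mult_mono[OF that assms(3)] z assms by simp
  then show "z \<sqsubseteq> a \<rightarrow>\<^sup>- (y \<sqinter> \<one>) \<longleftrightarrow> z \<sqsubseteq> a \<rightarrow>\<^sup>- y"
    using z assms by (auto simp: le_meet_iff residuation[symmetric])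
qed (use assms in auto)

text \<open>The last K-lattice identity, taken at x and \<sim>y and met with 1. The right-hand side
  is the second coordinate of a product in \<open>K\<close>, computed in the negative cone.\<close>

lemma inv_mult_meet_one:
  assumes x: "x \<in> univ R" and y: "y \<in> univ R"
  shows "\<sim> (x \<odot> y) \<sqinter> \<one> =
    ((x \<sqinter> \<one>) \<rightarrow>\<^sup>- (\<sim> y \<sqinter> \<one>)) \<sqinter> ((y \<sqinter> \<one>) \<rightarrow>\<^sup>- (\<sim> x \<sqinter> \<one>))"
proof -
  have "((x \<sqinter> \<one>) \<rightarrow> \<sim> y) \<sqinter> ((\<sim> \<sim> y \<sqinter> \<one>) \<rightarrow> \<sim> x) = x \<rightarrow> \<sim> y"
    using K x inv_closed[OF y] unfolding is_K_lattice_def by blast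
  then have "\<sim> (x \<odot> y) \<sqinter> \<one> = ((x \<sqinter> \<one>) \<rightarrow>\<^sup>- \<sim> y) \<sqinter> ((y \<sqinter> \<one>) \<rightarrow>\<^sup>- \<sim> x)"
    using x y by (simp add: inv_mult meet_meet_one[symmetric])
  then show ?thesis using x y by (simp add: cone_impl)
qed

text \<open>Applying the involution to the last hypothesis gives x \<squnion> 1 = y \<squnion> 1.
  Distributivity at 1 then yields x = x \<sqinter> (y \<squnion> 1) = (x \<sqinter> y) \<squnion> (y
  \<sqinter> 1) \<le> y, and symmetry does the rest.\<close>

lemma cone_determines:
  assumes "x \<in> univ R" "y \<in> univ R" "x \<sqinter> \<one> = y \<sqinter> \<one>" "\<sim> x \<sqinter> \<one> = \<sim> y \<sqinter> \<one>"
  shows "x = y"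
proof -
  have le: "x \<sqsubseteq> y"
    if xy: "x \<in> univ R" "y \<in> univ R" "x \<sqinter> \<one> = y \<sqinter> \<one>" "\<sim> x \<sqinter> \<one> = \<sim> y \<sqinter> \<one>" for x y
  proof -
    have "\<sim> (\<sim> z \<sqinter> \<one>) = z \<squnion> \<one>" if "z \<in> univ R" for z
      using that by (simp add: inv_meet)
    then have "x \<squnion> \<one> = y \<squnion> \<one>" using xy by metis
    then have "x = x \<sqinter> (y \<squnion> \<one>)" using meet_absorb[of x \<one>] xy by simp
    also have "\<dots> = (x \<sqinter> y) \<squnion> (y \<sqinter> \<one>)" using distrib(1)[of x y \<one>] xy by simp
    finally have "x = (x \<sqinter> y) \<squnion> (y \<sqinter> \<one>)" .
    moreover have "(x \<sqinter> y) \<squnion> (y \<sqinter> \<one>) \<sqsubseteq> y" using xy by (simp add: join_le_iff)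
    ultimately show ?thesis by simp
  qed
  show ?thesis using le[of x y] le[of y x] assms by (auto intro: le_antisym)
qed

text \<open>Closure under the product is monotonicity: factors below 1 have a product below
  1.\<close>

lemma is_algebra_neg_cone: "is_algebra (neg_cone A)"
  using mult_mono[of _ \<one> _ \<one>]
  by (auto simp: is_algebra_brl is_algebra_rl R_def[symmetric] univ_A join_le_iff
      intro: le_trans[OF meet_lb1])

lemma neg_cone_BCRL: "neg_cone A \<in> BCRL"
proof -
  have "x \<odot> y \<sqsubseteq> z \<longleftrightarrow> x \<sqsubseteq> y \<rightarrow>\<^sup>- z"
    if "x \<in> univ R" "y \<in> univ R" "z \<in> univ R" "x \<sqsubseteq> \<one>" for x y z
    using that by (simp add: le_meet_iff residuation)
  moreover have "is_algebra (rl (neg_cone A))"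
    using is_algebra_neg_cone by (simp add: is_algebra_brl)
  ultimately have "is_CRL (rl (neg_cone A))"
    unfolding is_CRL_def
    by (auto simp: R_def[symmetric] univ_A join_absorb meet_absorb
        intro: join_assoc join_comm meet_assoc meet_comm mult_assoc mult_comm)
  then show ?thesis
    using is_algebra_neg_cone by (simp add: BCRL_def CIRL_def R_def[symmetric] univ_A)
qed

text \<open>Every homomorphism out of the negative cone extends to \<open>A\<close>. The two
  coordinates of a product come from \<open>mult_meet_one\<close> and
  \<open>inv_mult_meet_one\<close>.\<close>

lemma is_hom_cone:
  assumes g: "is_hom g (neg_cone A) C"
  shows "is_hom (\<lambda>x. (g (x \<sqinter> \<one>), g (\<sim> x \<sqinter> \<one>))) A (K C)"
proof -
  let ?N = "rl (neg_cone A)"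
  have gh: "\<And>a. a \<in> univ R \<Longrightarrow> a \<sqsubseteq> \<one> \<Longrightarrow> g a \<in> univ C"
    "g \<one> = \<one>\<^bsub>rl C\<^esub>" "g (zero A) = zero C"
    "\<And>a b. a \<in> univ R \<Longrightarrow> b \<in> univ R \<Longrightarrow> a \<sqsubseteq> \<one> \<Longrightarrow> b \<sqsubseteq> \<one> \<Longrightarrow> g (a \<squnion> b) = g a \<squnion>\<^bsub>rl C\<^esub> g b"
    "\<And>a b. a \<in> univ R \<Longrightarrow> b \<in> univ R \<Longrightarrow> a \<sqsubseteq> \<one> \<Longrightarrow> b \<sqsubseteq> \<one> \<Longrightarrow> g (a \<sqinter> b) = g a \<sqinter>\<^bsub>rl C\<^esub> g b"
    "\<And>a b. a \<in> univ R \<Longrightarrow> b \<in> univ R \<Longrightarrow> a \<sqsubseteq> \<one> \<Longrightarrow> b \<sqsubseteq> \<one> \<Longrightarrow> g (a \<odot> b) = g a \<odot>\<^bsub>rl C\<^esub> g b"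
    "\<And>a b. a \<in> univ R \<Longrightarrow> b \<in> univ R \<Longrightarrow> a \<sqsubseteq> \<one> \<Longrightarrow> b \<sqsubseteq> \<one> \<Longrightarrow> g (a \<rightarrow>\<^sup>- b) = g a \<rightarrow>\<^bsub>rl C\<^esub> g b"
    using g by (auto simp: is_hom_brl_iff is_hom_rl_iff R_def[symmetric] univ_A)
  define h where "h x = (g (x \<sqinter> \<one>), g (\<sim> x \<sqinter> \<one>))" for x
  have h_mult: "h (x \<odot> y) = h x \<odot>\<^bsub>rl (K C)\<^esub> h y" if "x \<in> univ R" "y \<in> univ R" for x y
    using that by (simp add: h_def mult_meet_one inv_mult_meet_one gh)
  have h_inv: "h (\<sim> x) = prod.swap (h x)" if "x \<in> univ R" for x
    using that by (simp add: h_def)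
  \<comment> \<open>The involution becomes the exchange of coordinates, and x \<rightarrow> y =
    \<sim>(x \<odot> \<sim>y) holds on both sides, so implication reduces to the product.\<close>
  have swap: "p \<rightarrow>\<^bsub>rl (K C)\<^esub> q = prod.swap (p \<odot>\<^bsub>rl (K C)\<^esub> prod.swap q)" for p q
    by (cases p; cases q) simp
  have h_impl: "h (x \<rightarrow> y) = h x \<rightarrow>\<^bsub>rl (K C)\<^esub> h y" if "x \<in> univ R" "y \<in> univ R" for x y
    using that by (simp add: inv_impl h_inv h_mult swap)
  have zero: "zero A \<sqinter> \<one> = zero A" "\<sim> (zero A) \<sqinter> \<one> = \<one>"
  proof -
    show "zero A \<sqinter> \<one> = zero A" using zero_le[of \<one>] by (simp add: le_def)
    have "\<one> \<sqsubseteq> \<sim> (zero A)" by (simp add: inv_neg_def residuation[symmetric])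
    then show "\<sim> (zero A) \<sqinter> \<one> = \<one>" by (simp add: le_def meet_comm[of "\<sim> (zero A)"])
  qed
  have "is_hom h A (K C)"
    unfolding is_hom_brl_iff is_hom_rl_iff R_def[symmetric]
    using h_mult h_impl zero
    by (auto simp: h_def gh join_meet_one meet_meet_one inv_join inv_meet)
  then show ?thesis by (simp add: h_def[abs_def])
qed

end

section \<open>Classes of K-lattices and models of the theory of a member\<close>

lemma bkl_iff: "bkl (rl A) A \<longleftrightarrow> is_bounded_K_lattice A"
  unfolding bkl_def bkl_axioms_def crl_def by (auto simp: is_bounded_K_lattice_def is_K_lattice_def)

text \<open>The distributive laws are conditional on one of the three elements being 1. Placing the
  constant in each of the three positions turns them into six genuine identities in two
  variables.\<close>

lemma bounded_K_lattice_transfer: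
  assumes A: "is_bounded_K_lattice A" and B: "is_algebra B" and sub: "eq_theory A \<subseteq> eq_theory B"
  shows "is_bounded_K_lattice B"
proof -
  interpret bkl "rl A" A using A by (simp add: bkl_iff)
  note [simp] = closed[unfolded univ_rl]
  note tr = eq_theory_transfer[OF sub]
  let ?S = "rl B"
  have d1: "\<one>\<^bsub>?S\<^esub> \<sqinter>\<^bsub>?S\<^esub> (x \<squnion>\<^bsub>?S\<^esub> y) = (\<one>\<^bsub>?S\<^esub> \<sqinter>\<^bsub>?S\<^esub> x) \<squnion>\<^bsub>?S\<^esub> (\<one>\<^bsub>?S\<^esub> \<sqinter>\<^bsub>?S\<^esub> y)"
    "x \<sqinter>\<^bsub>?S\<^esub> (\<one>\<^bsub>?S\<^esub> \<squnion>\<^bsub>?S\<^esub> y) = (x \<sqinter>\<^bsub>?S\<^esub> \<one>\<^bsub>?S\<^esub>) \<squnion>\<^bsub>?S\<^esub> (x \<sqinter>\<^bsub>?S\<^esub> y)"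
    "x \<sqinter>\<^bsub>?S\<^esub> (y \<squnion>\<^bsub>?S\<^esub> \<one>\<^bsub>?S\<^esub>) = (x \<sqinter>\<^bsub>?S\<^esub> y) \<squnion>\<^bsub>?S\<^esub> (x \<sqinter>\<^bsub>?S\<^esub> \<one>\<^bsub>?S\<^esub>)"
    "\<one>\<^bsub>?S\<^esub> \<squnion>\<^bsub>?S\<^esub> (x \<sqinter>\<^bsub>?S\<^esub> y) = (\<one>\<^bsub>?S\<^esub> \<squnion>\<^bsub>?S\<^esub> x) \<sqinter>\<^bsub>?S\<^esub> (\<one>\<^bsub>?S\<^esub> \<squnion>\<^bsub>?S\<^esub> y)"
    "x \<squnion>\<^bsub>?S\<^esub> (\<one>\<^bsub>?S\<^esub> \<sqinter>\<^bsub>?S\<^esub> y) = (x \<squnion>\<^bsub>?S\<^esub> \<one>\<^bsub>?S\<^esub>) \<sqinter>\<^bsub>?S\<^esub> (x \<squnion>\<^bsub>?S\<^esub> y)"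
    "x \<squnion>\<^bsub>?S\<^esub> (y \<sqinter>\<^bsub>?S\<^esub> \<one>\<^bsub>?S\<^esub>) = (x \<squnion>\<^bsub>?S\<^esub> y) \<sqinter>\<^bsub>?S\<^esub> (x \<squnion>\<^bsub>?S\<^esub> \<one>\<^bsub>?S\<^esub>)"
    if "x \<in> univ B" "y \<in> univ B" for x y
  proof -
    note xy = that
    show "\<one>\<^bsub>?S\<^esub> \<sqinter>\<^bsub>?S\<^esub> (x \<squnion>\<^bsub>?S\<^esub> y) = (\<one>\<^bsub>?S\<^esub> \<sqinter>\<^bsub>?S\<^esub> x) \<squnion>\<^bsub>?S\<^esub> (\<one>\<^bsub>?S\<^esub> \<sqinter>\<^bsub>?S\<^esub> y)"
      using xy tr[of "bM b1 (bJ X0 X1)" "bJ (bM b1 X0) (bM b1 X1)" x y x] by (simp add: distrib(1)[where x = "\<one>\<^bsub>rl A\<^esub>"])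
    show "x \<sqinter>\<^bsub>?S\<^esub> (\<one>\<^bsub>?S\<^esub> \<squnion>\<^bsub>?S\<^esub> y) = (x \<sqinter>\<^bsub>?S\<^esub> \<one>\<^bsub>?S\<^esub>) \<squnion>\<^bsub>?S\<^esub> (x \<sqinter>\<^bsub>?S\<^esub> y)"
      using xy tr[of "bM X0 (bJ b1 X1)" "bJ (bM X0 b1) (bM X0 X1)" x y x] by (simp add: distrib(1)[where y = "\<one>\<^bsub>rl A\<^esub>"])
    show "x \<sqinter>\<^bsub>?S\<^esub> (y \<squnion>\<^bsub>?S\<^esub> \<one>\<^bsub>?S\<^esub>) = (x \<sqinter>\<^bsub>?S\<^esub> y) \<squnion>\<^bsub>?S\<^esub> (x \<sqinter>\<^bsub>?S\<^esub> \<one>\<^bsub>?S\<^esub>)"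
      using xy tr[of "bM X0 (bJ X1 b1)" "bJ (bM X0 X1) (bM X0 b1)" x y x] by (simp add: distrib(1)[where z = "\<one>\<^bsub>rl A\<^esub>"])
    show "\<one>\<^bsub>?S\<^esub> \<squnion>\<^bsub>?S\<^esub> (x \<sqinter>\<^bsub>?S\<^esub> y) = (\<one>\<^bsub>?S\<^esub> \<squnion>\<^bsub>?S\<^esub> x) \<sqinter>\<^bsub>?S\<^esub> (\<one>\<^bsub>?S\<^esub> \<squnion>\<^bsub>?S\<^esub> y)"
      using xy tr[of "bJ b1 (bM X0 X1)" "bM (bJ b1 X0) (bJ b1 X1)" x y x] by (simp add: distrib(2)[where x = "\<one>\<^bsub>rl A\<^esub>"])
    show "x \<squnion>\<^bsub>?S\<^esub> (\<one>\<^bsub>?S\<^esub> \<sqinter>\<^bsub>?S\<^esub> y) = (x \<squnion>\<^bsub>?S\<^esub> \<one>\<^bsub>?S\<^esub>) \<sqinter>\<^bsub>?S\<^esub> (x \<squnion>\<^bsub>?S\<^esub> y)"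
      using xy tr[of "bJ X0 (bM b1 X1)" "bM (bJ X0 b1) (bJ X0 X1)" x y x] by (simp add: distrib(2)[where y = "\<one>\<^bsub>rl A\<^esub>"])
    show "x \<squnion>\<^bsub>?S\<^esub> (y \<sqinter>\<^bsub>?S\<^esub> \<one>\<^bsub>?S\<^esub>) = (x \<squnion>\<^bsub>?S\<^esub> y) \<sqinter>\<^bsub>?S\<^esub> (x \<squnion>\<^bsub>?S\<^esub> \<one>\<^bsub>?S\<^esub>)"
      using xy tr[of "bJ X0 (bM X1 b1)" "bM (bJ X0 X1) (bJ X0 b1)" x y x] by (simp add: distrib(2)[where z = "\<one>\<^bsub>rl A\<^esub>"])
  qed
  have "inv_neg ?S (inv_neg ?S x) = x" if "x \<in> univ B" for x
    using that tr[of "bI (bI X0 b1) b1" X0 x x x] inv_inv by (simp add: inv_neg_def)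
  moreover have "(x \<odot>\<^bsub>?S\<^esub> y) \<sqinter>\<^bsub>?S\<^esub> \<one>\<^bsub>?S\<^esub> = (x \<sqinter>\<^bsub>?S\<^esub> \<one>\<^bsub>?S\<^esub>) \<odot>\<^bsub>?S\<^esub> (y \<sqinter>\<^bsub>?S\<^esub> \<one>\<^bsub>?S\<^esub>)"
    if "x \<in> univ B" "y \<in> univ B" for x y
    using that tr[of "bM (bP X0 X1) b1" "bP (bM X0 b1) (bM X1 b1)" x y x]
    by (simp add: mult_meet_one)
  moreover have "((x \<sqinter>\<^bsub>?S\<^esub> \<one>\<^bsub>?S\<^esub>) \<rightarrow>\<^bsub>?S\<^esub> y) \<sqinter>\<^bsub>?S\<^esub> ((inv_neg ?S y \<sqinter>\<^bsub>?S\<^esub> \<one>\<^bsub>?S\<^esub>) \<rightarrow>\<^bsub>?S\<^esub> inv_neg ?S x) =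
      x \<rightarrow>\<^bsub>?S\<^esub> y"
    if "x \<in> univ B" "y \<in> univ B" for x y
  proof -
    have "((x \<sqinter>\<^bsub>rl A\<^esub> \<one>\<^bsub>rl A\<^esub>) \<rightarrow>\<^bsub>rl A\<^esub> y) \<sqinter>\<^bsub>rl A\<^esub> ((inv_neg (rl A) y \<sqinter>\<^bsub>rl A\<^esub> \<one>\<^bsub>rl A\<^esub>) \<rightarrow>\<^bsub>rl A\<^esub> inv_neg (rl A) x) =
      x \<rightarrow>\<^bsub>rl A\<^esub> y" if "x \<in> univ A" "y \<in> univ A" for x y
      using K that unfolding is_K_lattice_def by simp
    then show ?thesis
      using that tr[of "bM (bI (bM X0 b1) X1) (bI (bM (bI X1 b1) b1) (bI X0 b1))" "bI X0 X1" x y x]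
      by (simp add: inv_neg_def)
  qed
  moreover have "zero B \<sqsubseteq>\<^bsub>?S\<^esub> x" if "x \<in> univ B" for x
    using that tr[of "bM b0 X0" b0 x x x] zero_le by (simp add: le_def)
  moreover have "is_CRL ?S"
    using is_CRL_transfer[OF CRL, of ?S] B eq_theory_rl_mono[OF sub] by (simp add: is_algebra_brl)
  ultimately show ?thesis
    using B d1 unfolding is_bounded_K_lattice_def is_K_lattice_def by auto
qed

text \<open>A condition on the negative cone becomes an identity of the whole algebra once each
  variable x is replaced by x \<sqinter> 1 and each implication is met with 1.\<close>

lemma K_class_SRL_transfer:
  assumes A: "A \<in> K_class SRL" and B: "is_algebra B" and sub: "eq_theory A \<subseteq> eq_theory B"
  shows "B \<in> K_class SRL"
proof -
  interpret bkl "rl A" A using A by (simp add: bkl_iff K_class_def)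
  note [simp] = closed[unfolded univ_rl]
  have KB: "is_bounded_K_lattice B"
    using bounded_K_lattice_transfer[OF _ B sub] A by (simp add: K_class_def)
  then interpret B: bkl "rl B" B by (simp add: bkl_iff)
  have "neg (neg_cone A) (x \<sqinter>\<^bsub>rl A\<^esub> \<one>\<^bsub>rl A\<^esub>) \<squnion>\<^bsub>rl A\<^esub> neg (neg_cone A) (neg (neg_cone A) (x \<sqinter>\<^bsub>rl A\<^esub> \<one>\<^bsub>rl A\<^esub>)) = \<one>\<^bsub>rl A\<^esub>"
    if "x \<in> univ A" for x
    using A that closed(2)[of x "\<one>\<^bsub>rl A\<^esub>"] closed(5) meet_lb2[of x "\<one>\<^bsub>rl A\<^esub>"]
    by (simp add: K_class_def SRL_def del: neg_cone_simps(9))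
  then have "((x \<sqinter>\<^bsub>rl B\<^esub> \<one>\<^bsub>rl B\<^esub>) \<rightarrow>\<^bsub>rl B\<^esub> zero B) \<sqinter>\<^bsub>rl B\<^esub> \<one>\<^bsub>rl B\<^esub> \<squnion>\<^bsub>rl B\<^esub>
    ((((x \<sqinter>\<^bsub>rl B\<^esub> \<one>\<^bsub>rl B\<^esub>) \<rightarrow>\<^bsub>rl B\<^esub> zero B) \<sqinter>\<^bsub>rl B\<^esub> \<one>\<^bsub>rl B\<^esub>) \<rightarrow>\<^bsub>rl B\<^esub> zero B) \<sqinter>\<^bsub>rl B\<^esub> \<one>\<^bsub>rl B\<^esub> = \<one>\<^bsub>rl B\<^esub>"
    if "x \<in> univ B" for x
    using that eq_theory_transfer[OF sub,
        of "bJ (bM (bI (bM X0 b1) b0) b1) (bM (bI (bM (bI (bM X0 b1) b0) b1) b0) b1)" b1 x x x]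
    by simp
  then have "neg (neg_cone B) x \<squnion>\<^bsub>rl (neg_cone B)\<^esub> neg (neg_cone B) (neg (neg_cone B) x) = \<one>\<^bsub>rl (neg_cone B)\<^esub>"
    if "x \<in> univ (neg_cone B)" for x
    using that by (simp add: le_def) metis
  then show ?thesis
    using KB B.neg_cone_BCRL by (auto simp: K_class_def SRL_def)
qed

lemma K_class_BA_transfer:
  assumes A: "A \<in> K_class BA" and B: "is_algebra B" and sub: "eq_theory A \<subseteq> eq_theory B"
  shows "B \<in> K_class BA"
proof -
  interpret bkl "rl A" A using A by (simp add: bkl_iff K_class_def)
  note [simp] = closed[unfolded univ_rl]
  have KB: "is_bounded_K_lattice B"
    using bounded_K_lattice_transfer[OF _ B sub] A by (simp add: K_class_def)
  then interpret B: bkl "rl B" B by (simp add: bkl_iff)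
  have cone: "x \<sqinter>\<^bsub>rl A\<^esub> \<one>\<^bsub>rl A\<^esub> \<in> univ (neg_cone A)" if "x \<in> univ A" for x
    using that closed(2)[of x "\<one>\<^bsub>rl A\<^esub>"] closed(5) meet_lb2[of x "\<one>\<^bsub>rl A\<^esub>"] by simp
  have "(x \<sqinter>\<^bsub>rl A\<^esub> \<one>\<^bsub>rl A\<^esub>) \<odot>\<^bsub>rl A\<^esub> (y \<sqinter>\<^bsub>rl A\<^esub> \<one>\<^bsub>rl A\<^esub>) = (x \<sqinter>\<^bsub>rl A\<^esub> \<one>\<^bsub>rl A\<^esub>) \<sqinter>\<^bsub>rl A\<^esub> (y \<sqinter>\<^bsub>rl A\<^esub> \<one>\<^bsub>rl A\<^esub>)"
    if "x \<in> univ A" "y \<in> univ A" for x y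
    using A cone[OF that(1)] cone[OF that(2)] unfolding K_class_def BA_def by simp
  then have BP: "(x \<sqinter>\<^bsub>rl B\<^esub> \<one>\<^bsub>rl B\<^esub>) \<odot>\<^bsub>rl B\<^esub> (y \<sqinter>\<^bsub>rl B\<^esub> \<one>\<^bsub>rl B\<^esub>) = (x \<sqinter>\<^bsub>rl B\<^esub> \<one>\<^bsub>rl B\<^esub>) \<sqinter>\<^bsub>rl B\<^esub> (y \<sqinter>\<^bsub>rl B\<^esub> \<one>\<^bsub>rl B\<^esub>)"
    if "x \<in> univ B" "y \<in> univ B" for x y
    using that eq_theory_transfer[OF sub, of "bP (bM X0 b1) (bM X1 b1)" "bM (bM X0 b1) (bM X1 b1)" x y x]
    by simp
  have "(x \<sqinter>\<^bsub>rl A\<^esub> \<one>\<^bsub>rl A\<^esub>) \<squnion>\<^bsub>rl A\<^esub> ((x \<sqinter>\<^bsub>rl A\<^esub> \<one>\<^bsub>rl A\<^esub>) \<rightarrow>\<^bsub>rl A\<^esub> zero A) \<sqinter>\<^bsub>rl A\<^esub> \<one>\<^bsub>rl A\<^esub> = \<one>\<^bsub>rl A\<^esub>"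
    if "x \<in> univ A" for x
    using A cone[OF that] unfolding K_class_def BA_def by simp
  then have BJ: "(x \<sqinter>\<^bsub>rl B\<^esub> \<one>\<^bsub>rl B\<^esub>) \<squnion>\<^bsub>rl B\<^esub> ((x \<sqinter>\<^bsub>rl B\<^esub> \<one>\<^bsub>rl B\<^esub>) \<rightarrow>\<^bsub>rl B\<^esub> zero B) \<sqinter>\<^bsub>rl B\<^esub> \<one>\<^bsub>rl B\<^esub> = \<one>\<^bsub>rl B\<^esub>"
    if "x \<in> univ B" for x
    using that eq_theory_transfer[OF sub, of "bJ (bM X0 b1) (bM (bI (bM X0 b1) b0) b1)" b1 x x x]
    by simp
  have "\<forall>x\<in>univ (neg_cone B). \<forall>y\<in>univ (neg_cone B).
      x \<odot>\<^bsub>rl (neg_cone B)\<^esub> y = x \<sqinter>\<^bsub>rl (neg_cone B)\<^esub> y"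
  proof (intro ballI)
    fix x y assume "x \<in> univ (neg_cone B)" "y \<in> univ (neg_cone B)"
    then show "x \<odot>\<^bsub>rl (neg_cone B)\<^esub> y = x \<sqinter>\<^bsub>rl (neg_cone B)\<^esub> y"
      using BP[of x y] by (simp add: le_def)
  qed
  moreover have "\<forall>x\<in>univ (neg_cone B). x \<squnion>\<^bsub>rl (neg_cone B)\<^esub> neg (neg_cone B) x = \<one>\<^bsub>rl (neg_cone B)\<^esub>"
  proof
    fix x assume "x \<in> univ (neg_cone B)"
    then show "x \<squnion>\<^bsub>rl (neg_cone B)\<^esub> neg (neg_cone B) x = \<one>\<^bsub>rl (neg_cone B)\<^esub>"
      using BJ[of x] by (simp add: le_def)
  qed
  ultimately show ?thesis
    using KB B.neg_cone_BCRL unfolding K_class_def BA_def by blast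
qed

section \<open>Filters\<close>

definition is_filter :: "(rl_sym, 'a) algebra \<Rightarrow> 'a set \<Rightarrow> bool" where
  "is_filter R F \<longleftrightarrow> F \<subseteq> univ R \<and> \<one>\<^bsub>R\<^esub> \<in> F \<and> (\<forall>x\<in>F. \<forall>y\<in>F. x \<odot>\<^bsub>R\<^esub> y \<in> F) \<and>
     (\<forall>x\<in>F. \<forall>y\<in>univ R. x \<sqsubseteq>\<^bsub>R\<^esub> y \<longrightarrow> y \<in> F)"

definition prime_filter :: "(rl_sym, 'a) algebra \<Rightarrow> 'a set \<Rightarrow> bool" where
  "prime_filter R F \<longleftrightarrow> is_filter R F \<and>
     (\<forall>x\<in>univ R. \<forall>y\<in>univ R. x \<squnion>\<^bsub>R\<^esub> y \<in> F \<longrightarrow> x \<in> F \<or> y \<in> F)"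

text \<open>Membership of this element in a filter is the congruence of that filter; for the filter
  {1} it is equality.\<close>

definition biimpl :: "(rl_sym, 'a) algebra \<Rightarrow> 'a \<Rightarrow> 'a \<Rightarrow> 'a" where
  "biimpl R x y = (x \<rightarrow>\<^bsub>R\<^esub> y) \<sqinter>\<^bsub>R\<^esub> (y \<rightarrow>\<^bsub>R\<^esub> x)"

context cirl
begin

lemma filter_one: "is_filter R {\<one>}"
  using one_le_iff by (auto simp: is_filter_def)

lemma filter_up: "is_filter R F \<Longrightarrow> x \<in> F \<Longrightarrow> x \<sqsubseteq> y \<Longrightarrow> y \<in> univ R \<Longrightarrow> y \<in> F"
  and filter_mult: "is_filter R F \<Longrightarrow> x \<in> F \<Longrightarrow> y \<in> F \<Longrightarrow> x \<odot> y \<in> F"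
  and filter_univ: "is_filter R F \<Longrightarrow> x \<in> F \<Longrightarrow> x \<in> univ R"
  and filter_has_one: "is_filter R F \<Longrightarrow> \<one> \<in> F"
  by (auto simp: is_filter_def)

lemma filter_join:
  assumes F: "is_filter R F" and z: "z \<in> univ R"
  shows "is_filter R {x \<in> univ R. x \<squnion> z \<in> F}"
proof -
  have "y \<squnion> z \<in> F" if "x \<sqsubseteq> y" "x \<in> univ R" "y \<in> univ R" "x \<squnion> z \<in> F" for x y
  proof (rule filter_up[OF F that(4)])
    show "x \<squnion> z \<sqsubseteq> y \<squnion> z"
      using that z le_trans[OF that(1) join_ub1[of y z]] by (simp add: join_le_iff)
  qed (use that z in simp)
  moreover have "(x \<odot> y) \<squnion> z \<in> F" if "x \<squnion> z \<in> F" "y \<squnion> z \<in> F" "x \<in> univ R" "y \<in> univ R" for x y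
    using filter_up[OF F filter_mult[OF F that(1,2)] join_mult_le[of x y z]] that z by simp
  ultimately show ?thesis
    using filter_has_one[OF F] z unfolding is_filter_def by auto
qed

lemma biimpl_closed [simp]: "x \<in> univ R \<Longrightarrow> y \<in> univ R \<Longrightarrow> biimpl R x y \<in> univ R"
  by (simp add: biimpl_def)

lemma biimpl_filter:
  assumes F: "is_filter R F" and x: "x \<in> univ R" and y: "y \<in> univ R"
  shows "biimpl R x y \<in> F \<longleftrightarrow> x \<rightarrow> y \<in> F \<and> y \<rightarrow> x \<in> F"
proof
  assume "biimpl R x y \<in> F"
  then show "x \<rightarrow> y \<in> F \<and> y \<rightarrow> x \<in> F"
    using filter_up[OF F, of "biimpl R x y" "x \<rightarrow> y"] filter_up[OF F, of "biimpl R x y" "y \<rightarrow> x"] x y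
    by (simp add: biimpl_def)
next
  assume "x \<rightarrow> y \<in> F \<and> y \<rightarrow> x \<in> F"
  then show "biimpl R x y \<in> F"
    using filter_up[OF F filter_mult[OF F, of "x \<rightarrow> y" "y \<rightarrow> x"] mult_le_meet] x y
    by (simp add: biimpl_def)
qed

lemma biimpl_eq_one:
  assumes x: "x \<in> univ R" and y: "y \<in> univ R"
  shows "biimpl R x y = \<one> \<longleftrightarrow> x = y"
  using biimpl_filter[OF filter_one x y] x y by (auto simp: impl_eq_one intro: le_antisym)

text \<open>Take F maximal among the filters avoiding c, and let x \<squnion> y be in F with neither
  x nor y in F. The filter of all w with w \<squnion> y in F properly extends F, by x, so it
  contains c. Now the filter of all w with w \<squnion> c in F properly extends F, by y, so it
  contains c as well, and c = c \<squnion> c lies in F.\<close>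

lemma prime_filter_avoiding:
  assumes c: "c \<in> univ R" "c \<noteq> \<one>"
  shows "\<exists>F. prime_filter R F \<and> c \<notin> F"
proof -
  let ?\<F> = "{F. is_filter R F \<and> c \<notin> F}"
  have "\<exists>M\<in>?\<F>. \<forall>X\<in>?\<F>. M \<subseteq> X \<longrightarrow> X = M"
  proof (rule subset_Zorn_nonempty)
    show "?\<F> \<noteq> {}" using filter_one c by blast
    fix \<C> assume ne: "\<C> \<noteq> {}" and ch: "subset.chain ?\<F> \<C>"
    have mem: "F \<in> \<C> \<Longrightarrow> is_filter R F \<and> c \<notin> F" for F
      using ch by (auto simp: subset.chain_def)
    have "x \<odot> y \<in> \<Union>\<C>" if "x \<in> \<Union>\<C>" "y \<in> \<Union>\<C>" for x y
    proof -
      obtain F G where FG: "F \<in> \<C>" "G \<in> \<C>" "x \<in> F" "y \<in> G" using \<open>x \<in> \<Union>\<C>\<close> \<open>y \<in> \<Union>\<C>\<close> by blast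
      then have "F \<subseteq> G \<or> G \<subseteq> F" using ch by (auto simp: subset.chain_def)
      then show ?thesis using FG mem[of F] mem[of G] unfolding is_filter_def by blast
    qed
    then show "\<Union>\<C> \<in> ?\<F>"
      using ne mem unfolding is_filter_def by blast
  qed
  then obtain F where F: "is_filter R F" "c \<notin> F"
    and max: "\<And>G. is_filter R G \<Longrightarrow> c \<notin> G \<Longrightarrow> F \<subseteq> G \<Longrightarrow> G = F" by blast
  have "x \<in> F \<or> y \<in> F" if xy: "x \<in> univ R" "y \<in> univ R" "x \<squnion> y \<in> F" for x y
  proof (rule ccontr)
    assume no: "\<not> (x \<in> F \<or> y \<in> F)"
    \<comment> \<open>Both extensions contain \<open>F\<close> because filters are closed
      upwards.\<close>
    have sub: "F \<subseteq> {w \<in> univ R. w \<squnion> z \<in> F}" if "z \<in> univ R" for z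
    proof
      fix w assume w: "w \<in> F"
      then have "w \<in> univ R" by (rule filter_univ[OF F(1)])
      then show "w \<in> {w \<in> univ R. w \<squnion> z \<in> F}"
        using filter_up[OF F(1) w join_ub1[of w z]] that by simp
    qed
    have "c \<squnion> y \<in> F"
      using max[OF filter_join[OF F(1) xy(2)] _ sub[OF xy(2)]] xy no c by blast
    then have "y \<squnion> c \<in> F" using join_comm c xy by simp
    then have "c \<squnion> c \<in> F"
      using max[OF filter_join[OF F(1) c(1)] _ sub[OF c(1)]] xy no c by blast
    then show False using F c by simp
  qed
  then show ?thesis using F unfolding prime_filter_def by blast
qed

end

section \<open>Quotients of bounded residuated lattices by filters\<close>

lemma congruence_map_brl:
  fixes B :: "(brl_sym, 'c) algebra"
  assumes B: "is_algebra B"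
    and op: "\<And>x x' y y'. \<lbrakk>x \<in> univ B; x' \<in> univ B; y \<in> univ B; y' \<in> univ B; r x = r x'; r y = r y'\<rbrakk> \<Longrightarrow>
      r (x \<squnion>\<^bsub>rl B\<^esub> y) = r (x' \<squnion>\<^bsub>rl B\<^esub> y') \<and> r (x \<sqinter>\<^bsub>rl B\<^esub> y) = r (x' \<sqinter>\<^bsub>rl B\<^esub> y') \<and>
      r (x \<odot>\<^bsub>rl B\<^esub> y) = r (x' \<odot>\<^bsub>rl B\<^esub> y') \<and> r (x \<rightarrow>\<^bsub>rl B\<^esub> y) = r (x' \<rightarrow>\<^bsub>rl B\<^esub> y')"
  shows "congruence_map r B"
proof -
  have 2: "length xs = 2 \<Longrightarrow> \<exists>x y. xs = [x, y]" for xs :: "'c list"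
    by (auto simp: length_Suc_conv numeral_2_eq_2)
  have "r (oper B (RL g) xs) = r (oper B (RL g) ys)"
    if "xs \<in> args B (RL g)" "ys \<in> args B (RL g)" "map r xs = map r ys" for g xs ys
  proof (cases "g = One")
    case True
    then show ?thesis using that by (simp add: args_def)
  next
    case False
    then have "length xs = 2" "length ys = 2"
      using that by (cases g; simp add: args_def)+
    then obtain x y x' y' where xs: "xs = [x, y]" and ys: "ys = [x', y']"
      using 2[of xs] 2[of ys] by blast
    have "x \<in> univ B" "x' \<in> univ B" "y \<in> univ B" "y' \<in> univ B" "r x = r x'" "r y = r y'"
      using that xs ys by (simp_all add: args_def)
    note eqs = op[OF this, unfolded join_def meet_def mult_def impl_def rl_def algebra.simps]
    show ?thesis
      unfolding xs ys
    proof (cases g)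
      case Join show "r (oper B (RL g) [x, y]) = r (oper B (RL g) [x', y'])"
        unfolding Join by (rule eqs[THEN conjunct1])
    next
      case Meet show "r (oper B (RL g) [x, y]) = r (oper B (RL g) [x', y'])"
        unfolding Meet by (rule eqs[THEN conjunct2, THEN conjunct1])
    next
      case Mult show "r (oper B (RL g) [x, y]) = r (oper B (RL g) [x', y'])"
        unfolding Mult by (rule eqs[THEN conjunct2, THEN conjunct2, THEN conjunct1])
    next
      case Impl show "r (oper B (RL g) [x, y]) = r (oper B (RL g) [x', y'])"
        unfolding Impl by (rule eqs[THEN conjunct2, THEN conjunct2, THEN conjunct2])
    qed (use False in simp)
  qed
  moreover have "r (oper B Zero xs) = r (oper B Zero ys)"
    if "xs \<in> args B Zero" "ys \<in> args B Zero" for xs ys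
    using that by (simp add: args_def)
  ultimately have "r (oper B f xs) = r (oper B f ys)"
    if "xs \<in> args B f" "ys \<in> args B f" "map r xs = map r ys" for f xs ys
    using that by (cases f) blast+
  then show ?thesis unfolding congruence_map_def by blast
qed

locale bcrl_filter = bcrl +
  fixes F assumes F: "is_filter R F"
begin

text \<open>A representative of the class of \<open>x\<close>, so that the quotient stays on the
  type of \<open>B\<close>. Congruent elements define the same predicate and therefore choose the
  same representative.\<close>

definition r :: "'a \<Rightarrow> 'a" where
  "r x = (SOME y. y \<in> univ R \<and> biimpl R x y \<in> F)"

lemma biimpl_refl: "x \<in> univ R \<Longrightarrow> biimpl R x x \<in> F"
  using F biimpl_eq_one[of x x] by (auto simp: is_filter_def)

lemma biimpl_sym: "x \<in> univ R \<Longrightarrow> y \<in> univ R \<Longrightarrow> biimpl R x y = biimpl R y x"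
  by (simp add: biimpl_def meet_comm)

lemma impl_trans:
  "x \<rightarrow> y \<in> F \<Longrightarrow> y \<rightarrow> z \<in> F \<Longrightarrow> x \<in> univ R \<Longrightarrow> y \<in> univ R \<Longrightarrow> z \<in> univ R \<Longrightarrow> x \<rightarrow> z \<in> F"
  using filter_up[OF F filter_mult[OF F] impl_chain[of x y z]] by simp

lemma biimpl_trans:
  "biimpl R x y \<in> F \<Longrightarrow> biimpl R y z \<in> F \<Longrightarrow> x \<in> univ R \<Longrightarrow> y \<in> univ R \<Longrightarrow> z \<in> univ R \<Longrightarrow>
    biimpl R x z \<in> F"
  using impl_trans by (simp add: biimpl_filter[OF F]) blast

lemma r: "x \<in> univ R \<Longrightarrow> r x \<in> univ R \<and> biimpl R x (r x) \<in> F"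
  unfolding r_def by (rule someI[of _ x]) (simp add: biimpl_refl)

lemma r_eq:
  assumes x: "x \<in> univ R" and y: "y \<in> univ R"
  shows "r x = r y \<longleftrightarrow> biimpl R x y \<in> F"
proof
  assume "r x = r y"
  then show "biimpl R x y \<in> F"
    using r[OF x] r[OF y] biimpl_trans[of x "r x" y] biimpl_sym[of y "r y"] x y by simp
next
  assume xy: "biimpl R x y \<in> F"
  have "z \<in> univ R \<and> biimpl R x z \<in> F \<longleftrightarrow> z \<in> univ R \<and> biimpl R y z \<in> F" for z
    using biimpl_trans[of x y z] biimpl_trans[of y x z] biimpl_sym[of x y] xy x y by auto
  then show "r x = r y" by (simp add: r_def)
qed

lemma up: "x \<in> F \<Longrightarrow> x \<sqsubseteq> y \<Longrightarrow> y \<in> univ R \<Longrightarrow> y \<in> F"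
  using F by (auto simp: is_filter_def)

text \<open>In each case x \<rightarrow> y lies below the implication in question, which is
  therefore in \<open>F\<close>.\<close>

lemma impl_compat:
  assumes "x \<rightarrow> y \<in> F" and xyz: "x \<in> univ R" "y \<in> univ R" "z \<in> univ R"
  shows "(x \<squnion> z) \<rightarrow> (y \<squnion> z) \<in> F" "(x \<sqinter> z) \<rightarrow> (y \<sqinter> z) \<in> F" "(x \<odot> z) \<rightarrow> (y \<odot> z) \<in> F"
    "(z \<rightarrow> x) \<rightarrow> (z \<rightarrow> y) \<in> F" "(y \<rightarrow> z) \<rightarrow> (x \<rightarrow> z) \<in> F"
proof -
  let ?i = "x \<rightarrow> y"
  have i: "?i \<in> univ R" using xyz by simp
  have "?i \<odot> (x \<squnion> z) = ?i \<odot> x \<squnion> ?i \<odot> z"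
    using xyz i mult_join_distrib[of x z ?i] mult_comm[of ?i] by simp
  also have "\<dots> \<sqsubseteq> y \<squnion> z"
    using xyz i le_trans[OF impl_mp[of x y] join_ub1[of y z]] le_trans[OF mult_le2[of ?i z] join_ub2[of y z]]
    by (simp add: join_le_iff)
  finally show "(x \<squnion> z) \<rightarrow> (y \<squnion> z) \<in> F"
    using up[OF assms(1)] xyz i by (simp add: residuation)
  have "?i \<odot> (x \<sqinter> z) \<sqsubseteq> ?i \<odot> x" using xyz i by (intro mult_mono) auto
  then have "?i \<odot> (x \<sqinter> z) \<sqsubseteq> y \<sqinter> z"
    using xyz i le_trans[OF _ impl_mp[of x y]] le_trans[OF mult_le2[of ?i "x \<sqinter> z"] meet_lb2[of x z]]
    by (simp add: le_meet_iff)
  then show "(x \<sqinter> z) \<rightarrow> (y \<sqinter> z) \<in> F"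
    using up[OF assms(1)] xyz i by (simp add: residuation)
  have "?i \<odot> (x \<odot> z) \<sqsubseteq> y \<odot> z"
    using xyz i mult_mono1[OF impl_mp[of x y], of z] by (simp add: mult_assoc)
  then show "(x \<odot> z) \<rightarrow> (y \<odot> z) \<in> F"
    using up[OF assms(1)] xyz i by (simp add: residuation)
  have "?i \<odot> (z \<rightarrow> x) \<sqsubseteq> z \<rightarrow> y"
    using xyz i impl_chain[of z x y] mult_comm[of ?i "z \<rightarrow> x"] by simp
  then show "(z \<rightarrow> x) \<rightarrow> (z \<rightarrow> y) \<in> F"
    using up[OF assms(1)] xyz i by (simp add: residuation)
  have "?i \<odot> (y \<rightarrow> z) \<sqsubseteq> x \<rightarrow> z" using xyz impl_chain by simp
  then show "(y \<rightarrow> z) \<rightarrow> (x \<rightarrow> z) \<in> F"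
    using up[OF assms(1)] xyz i by (simp add: residuation)
qed

lemma alg_B: "is_algebra B"
  using alg zero_closed by (simp add: is_algebra_brl R_def)

lemma congruence_r: "congruence_map r B"
proof (rule congruence_map_brl[OF alg_B])
  fix x x' y y'
  assume "x \<in> univ B" "x' \<in> univ B" "y \<in> univ B" "y' \<in> univ B" and r: "r x = r x'" "r y = r y'"
  then have u: "x \<in> univ R" "x' \<in> univ R" "y \<in> univ R" "y' \<in> univ R" by (simp_all add: R_def)
  have i: "x \<rightarrow> x' \<in> F" "x' \<rightarrow> x \<in> F" "y \<rightarrow> y' \<in> F" "y' \<rightarrow> y \<in> F"
    using r u by (auto simp: r_eq biimpl_filter[OF F])
  have l: "r (a \<squnion> c) = r (b \<squnion> c)" "r (a \<sqinter> c) = r (b \<sqinter> c)" "r (a \<odot> c) = r (b \<odot> c)"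
    "r (c \<rightarrow> a) = r (c \<rightarrow> b)" "r (a \<rightarrow> c) = r (b \<rightarrow> c)"
    if "a \<rightarrow> b \<in> F" "b \<rightarrow> a \<in> F" "a \<in> univ R" "b \<in> univ R" "c \<in> univ R" for a b c
    using that impl_compat[of a b c] impl_compat[of b a c] by (simp_all add: r_eq biimpl_filter[OF F])
  show "r (x \<squnion>\<^bsub>rl B\<^esub> y) = r (x' \<squnion>\<^bsub>rl B\<^esub> y') \<and> r (x \<sqinter>\<^bsub>rl B\<^esub> y) = r (x' \<sqinter>\<^bsub>rl B\<^esub> y') \<and>
      r (x \<odot>\<^bsub>rl B\<^esub> y) = r (x' \<odot>\<^bsub>rl B\<^esub> y') \<and> r (x \<rightarrow>\<^bsub>rl B\<^esub> y) = r (x' \<rightarrow>\<^bsub>rl B\<^esub> y')"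
    unfolding R_def[symmetric]
    using l[of x x' y] l[of y y' x'] i u join_comm[of x'] meet_comm[of x'] mult_comm[of x'] by simp
qed

lemma hom_r: "is_hom r B (image_algebra r B)"
  by (rule is_hom_image_algebra[OF congruence_r])

text \<open>Identities pass to homomorphic images, and residuation has already been put into
  equational form.\<close>

lemma quotient_BCRL: "image_algebra r B \<in> BCRL"
proof (rule BCRL_transfer)
  show "B \<in> BCRL" using bcrl_axioms by (simp add: BCRL_iff R_def)
  show "is_algebra (image_algebra r B)" by (rule is_algebra_image_algebra[OF congruence_r alg_B])
  show "eq_theory B \<subseteq> eq_theory (image_algebra r B)"
    by (rule eq_theory_surj[OF hom_r alg_B]) simp
qed

end

section \<open>The algebras \<open>K(2 \<oplus> D)\<close> and \<open>K\<^sub>0(2 \<oplus> D)\<close>\<close>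

lemma two_plus_simps [simp]:
  "univ (two_plus D) = insert None (Some ` univ D)"
  "None \<squnion>\<^bsub>rl (two_plus D)\<^esub> y = y" "x \<squnion>\<^bsub>rl (two_plus D)\<^esub> None = x"
  "Some a \<squnion>\<^bsub>rl (two_plus D)\<^esub> Some b = Some (a \<squnion>\<^bsub>D\<^esub> b)"
  "None \<sqinter>\<^bsub>rl (two_plus D)\<^esub> y = None" "x \<sqinter>\<^bsub>rl (two_plus D)\<^esub> None = None"
  "Some a \<sqinter>\<^bsub>rl (two_plus D)\<^esub> Some b = Some (a \<sqinter>\<^bsub>D\<^esub> b)"
  "None \<odot>\<^bsub>rl (two_plus D)\<^esub> y = None" "x \<odot>\<^bsub>rl (two_plus D)\<^esub> None = None"
  "Some a \<odot>\<^bsub>rl (two_plus D)\<^esub> Some b = Some (a \<odot>\<^bsub>D\<^esub> b)"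
  "None \<rightarrow>\<^bsub>rl (two_plus D)\<^esub> y = Some \<one>\<^bsub>D\<^esub>" "Some a \<rightarrow>\<^bsub>rl (two_plus D)\<^esub> None = None"
  "Some a \<rightarrow>\<^bsub>rl (two_plus D)\<^esub> Some b = Some (a \<rightarrow>\<^bsub>D\<^esub> b)"
  "\<one>\<^bsub>rl (two_plus D)\<^esub> = Some \<one>\<^bsub>D\<^esub>"
  "zero (two_plus D) = None"
  by (simp_all add: two_plus_def split: option.splits)

lemma is_algebra_two_plus: "is_algebra D \<Longrightarrow> is_algebra (two_plus D)"
  by (auto simp: is_algebra_brl is_algebra_rl)

lemma is_algebra_K: "is_algebra C \<Longrightarrow> is_algebra (K C)"
  by (auto simp: is_algebra_brl is_algebra_rl)

lemma is_hom_map_option: "is_hom g R S \<Longrightarrow> is_hom (map_option g) (two_plus R) (two_plus S)"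
  by (auto simp: is_hom_brl_iff is_hom_rl_iff)

lemma is_hom_map_prod:
  assumes "is_hom g A B" "is_algebra A" shows "is_hom (map_prod g g) (K A) (K B)"
  using assms by (auto simp: is_hom_brl_iff is_hom_rl_iff is_algebra_brl is_algebra_rl)

lemma eval_K0 [simp]: "eval_trm (K0 B) = eval_trm (K B)"
  by (intro ext) (simp add: K0_def)

text \<open>No operation produces (0, 0) from other pairs, and (0, 0) is not below the unit, so
  removing it leaves an admissible subalgebra. Conversely the negative cone, consisting of the pairs
  (a, 1), generates the rest: (0, d) = (d, 1) \<rightarrow> (0, 1), then (d, 0) = (0, d)
  \<rightarrow> (1, 1), and (d, e) = (0, e) \<squnion> (d, 1).\<close>

lemma univ_K0_two_plus:
  assumes D: "D \<in> CIRL"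
  shows "univ (K0 (two_plus D)) = univ (K (two_plus D)) - {(None, None)}"
proof -
  interpret cirl D using D by (simp add: CIRL_iff)
  let ?N = "univ (K (two_plus D)) - {(None, None)}"
  let ?R = "rl (K (two_plus D))"
  have "is_algebra ((K (two_plus D))\<lparr>univ := ?N\<rparr>)"
    by (auto simp: is_algebra_brl is_algebra_rl)
  moreover have "univ (neg_cone ((K (two_plus D))\<lparr>univ := ?N\<rparr>)) = univ (neg_cone (K (two_plus D)))"
  proof -
    have "\<not> (None, None) \<sqsubseteq>\<^bsub>?R\<^esub> \<one>\<^bsub>?R\<^esub>"
      by (simp add: le_def)
    moreover have "univ (neg_cone ((K (two_plus D))\<lparr>univ := ?N\<rparr>)) = {a \<in> ?N. a \<sqsubseteq>\<^bsub>?R\<^esub> \<one>\<^bsub>?R\<^esub>}"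
      by (simp only: neg_cone_simps rl_univ_update oper_univ_update) simp
    moreover have "univ (neg_cone (K (two_plus D))) = {a \<in> univ (K (two_plus D)). a \<sqsubseteq>\<^bsub>?R\<^esub> \<one>\<^bsub>?R\<^esub>}"
      by (rule neg_cone_simps)
    ultimately show ?thesis by blast
  qed
  ultimately have N: "admissible ?N (K (two_plus D))"
    unfolding admissible_def subuniverse_def by blast
  have "?N \<subseteq> S" if S: "admissible S (K (two_plus D))" for S
  proof -
    have "is_algebra ((K (two_plus D))\<lparr>univ := S\<rparr>)"
      using S unfolding admissible_def subuniverse_def by blast
    then have alg: "is_algebra (?R\<lparr>univ := S\<rparr>)" "zero (K (two_plus D)) \<in> S"
      unfolding is_algebra_brl rl_univ_update by simp_all
    have cl: "x \<squnion>\<^bsub>?R\<^esub> y \<in> S" "x \<rightarrow>\<^bsub>?R\<^esub> y \<in> S" if "x \<in> S" "y \<in> S" for x y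
      using alg(1) that unfolding is_algebra_rl oper_univ_update by simp_all
    have one: "(Some \<one>\<^bsub>D\<^esub>, Some \<one>\<^bsub>D\<^esub>) \<in> S" and zero: "(None, Some \<one>\<^bsub>D\<^esub>) \<in> S"
      using alg unfolding is_algebra_rl oper_univ_update by simp_all
    have cone_S: "univ (neg_cone (K (two_plus D))) \<subseteq> S"
    proof
      fix x assume "x \<in> univ (neg_cone (K (two_plus D)))"
      then have "x \<in> univ (neg_cone ((K (two_plus D))\<lparr>univ := S\<rparr>))"
        using S unfolding admissible_def by blast
      then show "x \<in> S" unfolding neg_cone_simps by simp
    qed
    have cone: "(Some d, Some \<one>\<^bsub>D\<^esub>) \<in> S" if "d \<in> univ D" for d
    proof -
      have "(Some d, Some \<one>\<^bsub>D\<^esub>) \<in> univ (neg_cone (K (two_plus D)))"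
        using that by (simp add: le_def)
      then show ?thesis using cone_S by blast
    qed
    have 1: "(None, Some d) \<in> S" if "d \<in> univ D" for d
      using cl(2)[OF cone[OF that] zero] that by simp
    have 2: "(Some d, None) \<in> S" if "d \<in> univ D" for d
      using cl(2)[OF 1[OF that] one] that by simp
    have 3: "(Some d, Some e) \<in> S" if "d \<in> univ D" "e \<in> univ D" for d e
      using cl(1)[OF 1[OF that(2)] cone[OF that(1)]] that by simp
    show ?thesis using 1 2 3 by auto
  qed
  then have "\<Inter>{S. admissible S (K (two_plus D))} = ?N"
    using N by blast
  then show ?thesis
    by (simp add: K0_def)
qed

lemma K0_two_plus:
  assumes D: "D \<in> CIRL"
  shows "K0 (two_plus D) = (K (two_plus D))\<lparr>univ := univ (K (two_plus D)) - {(None, None)}\<rparr>"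
proof -
  have "K0 (two_plus D) = (K (two_plus D))\<lparr>univ := univ (K0 (two_plus D))\<rparr>"
    by (simp add: K0_def)
  then show ?thesis by (simp only: univ_K0_two_plus[OF D])
qed

lemma is_algebra_K0_two_plus:
  assumes D: "D \<in> CIRL" shows "is_algebra (K0 (two_plus D))"
proof -
  interpret cirl D using D by (simp add: CIRL_iff)
  show ?thesis
    unfolding K0_two_plus[OF D] by (auto simp: is_algebra_brl is_algebra_rl)
qed

subsection \<open>Identities of \<open>K\<^sub>0(2 \<oplus> D)\<close> and identities of \<open>D\<close>\<close>

text \<open>The constructions \<open>K\<close> and \<open>2 \<oplus> _\<close> make sense for the algebra of terms, and evaluating a term
  in \<open>K(2 \<oplus> T)\<close> at a valuation whose coordinates are variables or \<open>0\<close> reduces it to a pair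
  of terms in the language of \<open>D\<close>, each possibly replaced by \<open>0\<close>.\<close>

definition term_algebra :: "('f::signature, 'f trm) algebra" where
  "term_algebra = \<lparr>univ = {t. wf_trm t}, oper = App\<rparr>"

lemma is_algebra_term_algebra: "is_algebra term_algebra"
  by (auto simp: is_algebra_def args_def term_algebra_def intro: exI[of _ "Var 0"])

lemma is_hom_eval:
  assumes "is_algebra D" "\<And>n. w n \<in> univ D"
  shows "is_hom (eval_trm D w) term_algebra D"
  using assms eval_trm_closed[of D _ w]
  by (auto simp: is_hom_def term_algebra_def args_def eval_trm.simps(2))

text \<open>The identities of \<open>K0 (two_plus D)\<close> computed from a theory \<open>J\<close>
  of \<open>D\<close>: \<open>rel_option\<close> lets 0 match only 0, and elsewhere the reduced
  terms must be equal modulo \<open>J\<close>. Barring (0, 0) as a value of \<open>p\<close> is what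
  makes this describe \<open>K0\<close> and not \<open>K\<close>.\<close>

definition star :: "(rl_sym trm \<times> rl_sym trm) set \<Rightarrow> (brl_sym trm \<times> brl_sym trm) set" where
  "star J = {(s, t). wf_trm s \<and> wf_trm t \<and>
     (\<forall>p. (\<forall>n. p n \<in> univ (K (two_plus term_algebra)) - {(None, None)}) \<longrightarrow>
        rel_prod (rel_option (\<lambda>a b. (a, b) \<in> J)) (rel_option (\<lambda>a b. (a, b) \<in> J))
          (eval_trm (K (two_plus term_algebra)) p s) (eval_trm (K (two_plus term_algebra)) p t))}"

lemma mem_star:
  "(s, t) \<in> star J \<longleftrightarrow> wf_trm s \<and> wf_trm t \<and>
     (\<forall>p. (\<forall>n. p n \<in> univ (K (two_plus term_algebra)) - {(None, None)}) \<longrightarrow>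
        rel_prod (rel_option (\<lambda>a b. (a, b) \<in> J)) (rel_option (\<lambda>a b. (a, b) \<in> J))
          (eval_trm (K (two_plus term_algebra)) p s) (eval_trm (K (two_plus term_algebra)) p t))"
  unfolding star_def by blast

lemma star_mono: assumes "J \<subseteq> J'" shows "star J \<subseteq> star J'"
proof -
  have "rel_option (\<lambda>a b. (a, b) \<in> J) \<le> rel_option (\<lambda>a b. (a, b) \<in> J')"
    using assms by (intro option.rel_mono) auto
  then have "rel_prod (rel_option (\<lambda>a b. (a, b) \<in> J)) (rel_option (\<lambda>a b. (a, b) \<in> J)) \<le>
      rel_prod (rel_option (\<lambda>a b. (a, b) \<in> J')) (rel_option (\<lambda>a b. (a, b) \<in> J'))"
    by (intro prod.rel_mono)
  then show ?thesis unfolding star_def by blast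
qed

text \<open>Each reduced pair of terms is tested separately, so the test against an intersection
  splits. Thus an identity valid in \<open>K0 (two_plus E)\<close> for a whole family of
  \<open>E\<close> follows from the identities common to the family. Nonemptiness supplies
  well-formedness and the matching of zeros.\<close>

lemma star_Inter:
  assumes "\<J> \<noteq> {}" shows "(\<Inter>J\<in>\<J>. star J) \<subseteq> star (\<Inter>\<J>)"
proof (rule subrelI)
  have rel: "rel_option (\<lambda>a b. (a, b) \<in> \<Inter>\<J>) x y"
    if "\<And>J. J \<in> \<J> \<Longrightarrow> rel_option (\<lambda>a b. (a, b) \<in> J) x y" for x y :: "rl_sym trm option"
    using that assms by (cases x; cases y) auto
  have rel2: "rel_prod (rel_option (\<lambda>a b. (a, b) \<in> \<Inter>\<J>)) (rel_option (\<lambda>a b. (a, b) \<in> \<Inter>\<J>)) p q"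
    if "\<And>J. J \<in> \<J> \<Longrightarrow> rel_prod (rel_option (\<lambda>a b. (a, b) \<in> J)) (rel_option (\<lambda>a b. (a, b) \<in> J)) p q"
    for p q
    using that unfolding rel_prod_sel by (blast intro: rel)
  fix s t assume st: "(s, t) \<in> (\<Inter>J\<in>\<J>. star J)"
  then have J: "(s, t) \<in> star J" if "J \<in> \<J>" for J using that by blast
  obtain J where "J \<in> \<J>" using assms by blast
  then have wf: "wf_trm s" "wf_trm t" using J unfolding mem_star by blast+
  show "(s, t) \<in> star (\<Inter>\<J>)"
    unfolding mem_star
  proof (intro conjI allI impI wf rel2)
    fix p :: "nat \<Rightarrow> rl_sym trm option \<times> rl_sym trm option" and J
    assume "\<forall>n. p n \<in> univ (K (two_plus term_algebra)) - {(None, None)}" "J \<in> \<J>"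
    then show "rel_prod (rel_option (\<lambda>a b. (a, b) \<in> J)) (rel_option (\<lambda>a b. (a, b) \<in> J))
        (eval_trm (K (two_plus term_algebra)) p s) (eval_trm (K (two_plus term_algebra)) p t)"
      using J unfolding mem_star by blast
  qed
qed

lemma star_sub_identities: "star J \<subseteq> identities"
  by (auto simp: star_def identities_def)

text \<open>A valuation of the variables in \<open>D\<close> is a homomorphism from the term
  algebra, and it induces one from K(2 \<oplus> T) to K(2 \<oplus> D), T being the term algebra.
  Evaluation in K(2 \<oplus> D) therefore factors through the reduced pair of terms.\<close>

lemma eq_theory_K0_two_plus:
  fixes D :: "(rl_sym, 'a) algebra"
  assumes D: "D \<in> CIRL"
  shows "eq_theory (K0 (two_plus D)) = star (eq_theory D)"
proof -
  interpret cirl D using D by (simp add: CIRL_iff)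
  let ?T = "K (two_plus (term_algebra :: (rl_sym, _) algebra))"
  let ?g = "\<lambda>w. map_option (eval_trm D w)"
  let ?h = "\<lambda>w. map_prod (?g w) (?g w)"
  let ?J = "eq_theory D"
  have algT: "is_algebra (two_plus (term_algebra :: (rl_sym, _) algebra))"
    by (intro is_algebra_two_plus is_algebra_term_algebra)
  have ev: "?h w (eval_trm ?T p t) = eval_trm (K (two_plus D)) (\<lambda>n. ?h w (p n)) t"
    if "\<And>n. w n \<in> univ D" "\<And>n. p n \<in> univ ?T" "wf_trm t" for w p t
    using that algT
    by (intro eval_hom is_hom_map_prod is_hom_map_option is_hom_eval alg is_algebra_K) auto
  have rel: "rel_option (\<lambda>a b. (a, b) \<in> ?J) x y \<longleftrightarrow> (\<forall>w. (\<forall>n. w n \<in> univ D) \<longrightarrow> ?g w x = ?g w y)"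
    if "x \<in> univ (two_plus term_algebra)" "y \<in> univ (two_plus term_algebra)" for x y
  proof -
    \<comment> \<open>Some valuation has to exist for a term and 0 to be told apart.\<close>
    have "\<exists>w. \<forall>n::nat. w n \<in> univ D" by (intro exI[of _ "\<lambda>_. \<one>\<^bsub>D\<^esub>"]) simp
    then show ?thesis
      using that by (cases x; cases y) (auto simp: mem_eq_theory term_algebra_def)
  qed
  have rel2: "rel_prod (rel_option (\<lambda>a b. (a, b) \<in> ?J)) (rel_option (\<lambda>a b. (a, b) \<in> ?J)) x y \<longleftrightarrow>
      (\<forall>w. (\<forall>n. w n \<in> univ D) \<longrightarrow> ?h w x = ?h w y)"
    if "x \<in> univ ?T" "y \<in> univ ?T" for x y
  proof (cases x; cases y)
    fix a b c d assume xy: "x = (a, b)" "y = (c, d)"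
    show ?thesis
      using that rel[of a c] rel[of b d] unfolding xy by (simp only: K_simps mem_Sigma_iff rel_prod_inject map_prod_simp prod.inject) blast
  qed
  have closedT: "eval_trm ?T p t \<in> univ ?T" if "\<And>n. p n \<in> univ ?T" "wf_trm t" for p t
    using that by (intro eval_trm_closed is_algebra_K algT) auto
  show ?thesis
  proof (intro set_eqI iffI)
    fix e assume e: "e \<in> eq_theory (K0 (two_plus D))"
    obtain s t where st: "e = (s, t)" by (cases e)
    have "?h w (eval_trm ?T p s) = ?h w (eval_trm ?T p t)"
      if p: "\<And>n. p n \<in> univ ?T - {(None, None)}" and w: "\<And>n. w n \<in> univ D" for p w
    proof -
      have "?h w (p n) \<in> univ (K0 (two_plus D))" for n
        using p[of n] eval_trm_closed[OF alg _ w]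
        by (cases "p n") (auto simp: univ_K0_two_plus[OF D] term_algebra_def)
      then have "eval_trm (K (two_plus D)) (\<lambda>n. ?h w (p n)) s = eval_trm (K (two_plus D)) (\<lambda>n. ?h w (p n)) t"
        using e st by (auto simp: mem_eq_theory)
      then show ?thesis
        using ev[OF w] p e st by (simp add: mem_eq_theory)
    qed
    then show "e \<in> star ?J"
      using e st rel2 closedT unfolding star_def by (auto simp: mem_eq_theory simp del: K_simps)
  next
    fix e assume e: "e \<in> star ?J"
    obtain s t where st: "e = (s, t)" by (cases e)
    have wf: "wf_trm s" "wf_trm t" using e st by (auto simp: star_def)
    have "eval_trm (K (two_plus D)) v s = eval_trm (K (two_plus D)) v t"
      if v: "\<And>n. v n \<in> univ (K0 (two_plus D))" for v
    proof -
      \<comment> \<open>\<open>p\<close> retains the pattern of zeros of \<open>v\<close> and names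
        the nonzero coordinates of \<open>v n\<close> by the variables 2n and 2n + 1;
        \<open>w\<close> gives these variables their values. The value 1 belonging to a zero
        coordinate is a mere default, since \<open>p\<close> does not contain that variable.\<close>
      define p where "p n = (map_option (\<lambda>_. Var (2 * n) :: rl_sym trm) (fst (v n)),
          map_option (\<lambda>_. Var (Suc (2 * n)) :: rl_sym trm) (snd (v n)))" for n
      define w where "w k = (case (if even k then fst (v (k div 2)) else snd (v (k div 2))) of
          None \<Rightarrow> \<one>\<^bsub>D\<^esub> | Some d \<Rightarrow> d)" for k :: nat
      have v': "v n \<in> univ (K (two_plus D)) - {(None, None)}" for n
        using v univ_K0_two_plus[OF D] by simp
      have w: "w k \<in> univ D" for k
        using v'[of "k div 2"] by (cases "v (k div 2)") (auto simp: w_def)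
      have p: "p n \<in> univ ?T - {(None, None)}" for n
        using v'[of n] by (cases "v n") (auto simp: p_def term_algebra_def)
      have hp: "?h w (p n) = v n" for n
        by (cases "v n"; cases "fst (v n)"; cases "snd (v n)") (auto simp: p_def w_def)
      have "rel_prod (rel_option (\<lambda>a b. (a, b) \<in> ?J)) (rel_option (\<lambda>a b. (a, b) \<in> ?J))
          (eval_trm ?T p s) (eval_trm ?T p t)"
        using e p unfolding st star_def by blast
      then have "?h w (eval_trm ?T p s) = ?h w (eval_trm ?T p t)"
        using rel2[OF closedT closedT, of p s p t] p wf w by blast
      then show ?thesis
        using ev[OF w] p wf hp by simp
    qed
    then show "e \<in> eq_theory (K0 (two_plus D))"
      using wf st by (simp add: mem_eq_theory)
  qed
qed

text \<open>Conversely, \<open>D\<close> is the range of \<open>x \<or> \<not>x\<close> on \<open>2 \<oplus> D\<close>.\<close>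

fun cone_trm :: "rl_sym trm \<Rightarrow> brl_sym trm" where
  "cone_trm (Var n) = bM (bJ (bM (Var n) b1) (bI (bM (Var n) b1) b0)) b1"
| "cone_trm (App f ts) =
     (if f = Impl then bM (App (RL f) (map cone_trm ts)) b1 else App (RL f) (map cone_trm ts))"

lemma wf_cone_trm [simp]: "wf_trm t \<Longrightarrow> wf_trm (cone_trm t)"
  by (induction t) auto

text \<open>Meeting (a, b) with 1 gives (a, 1), whose negation is (\<not>a, a). The join has first
  coordinate a \<squnion> \<not>a, which is a for a in \<open>D\<close> and 1 for a = 0, and the
  outer meet with 1 resets the second coordinate. An implication of such pairs needs the same reset,
  hence the special case for \<open>Impl\<close>.\<close>

lemma eval_cone_trm:
  assumes D: "D \<in> CIRL" and v: "\<And>n. v n \<in> univ (K (two_plus D))"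
  shows "wf_trm t \<Longrightarrow> eval_trm (K (two_plus D)) v (cone_trm t) =
    (Some (eval_trm D (\<lambda>n. case fst (v n) of None \<Rightarrow> \<one>\<^bsub>D\<^esub> | Some d \<Rightarrow> d) t), Some \<one>\<^bsub>D\<^esub>)"
proof (induction t)
  interpret cirl D using D by (simp add: CIRL_iff)
  {
    case (Var n)
    obtain a b where ab: "v n = (a, b)" "a \<in> univ (two_plus D)" "b \<in> univ (two_plus D)"
      using v[of n] by (cases "v n") auto
    then show ?case by (cases a; cases b) auto
  next
    case (App f ts)
    let ?w = "\<lambda>n. case fst (v n) of None \<Rightarrow> \<one>\<^bsub>D\<^esub> | Some d \<Rightarrow> d"
    have w: "?w n \<in> univ D" for n
      using v[of n] by (cases "v n") (auto split: option.splits)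
    show ?case
    proof (cases "f = One")
      case True
      then show ?thesis using App.prems by simp
    next
      case False
      then have "length ts = 2" using App.prems by (cases f) auto
      then obtain s t where ts: "ts = [s, t]"
        by (auto simp: length_Suc_conv numeral_2_eq_2)
      have "eval_trm D ?w s \<in> univ D" "eval_trm D ?w t \<in> univ D"
        using App.prems ts w by (auto intro!: eval_trm_closed alg)
      then show ?thesis
        using App ts False by (cases f) auto
    qed
  }
qed

lemma cone_trm_identity:
  assumes D: "D \<in> CIRL" and wf: "wf_trm s" "wf_trm t"
  shows "(cone_trm s, cone_trm t) \<in> eq_theory (K0 (two_plus D)) \<longleftrightarrow> (s, t) \<in> eq_theory D"
proof
  interpret cirl D using D by (simp add: CIRL_iff)
  have sub: "x \<in> univ (K (two_plus D))" if "x \<in> univ (K0 (two_plus D))" for x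
    using that univ_K0_two_plus[OF D] by simp
  assume hyp: "(cone_trm s, cone_trm t) \<in> eq_theory (K0 (two_plus D))"
  have "eval_trm D w s = eval_trm D w t" if w: "\<And>n. w n \<in> univ D" for w
  proof -
    let ?v = "\<lambda>n. (Some (w n), Some \<one>\<^bsub>D\<^esub>)"
    have v: "?v n \<in> univ (K0 (two_plus D))" for n
      using w by (simp add: univ_K0_two_plus[OF D])
    then have "eval_trm (K (two_plus D)) ?v (cone_trm s) = eval_trm (K (two_plus D)) ?v (cone_trm t)"
      using hyp by (simp add: mem_eq_theory)
    then show ?thesis
      using eval_cone_trm[OF D, of ?v] sub[OF v] wf by simp
  qed
  then show "(s, t) \<in> eq_theory D" using wf by (simp add: mem_eq_theory)
next
  interpret cirl D using D by (simp add: CIRL_iff)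
  assume hyp: "(s, t) \<in> eq_theory D"
  have "eval_trm (K (two_plus D)) v (cone_trm s) = eval_trm (K (two_plus D)) v (cone_trm t)"
    if "\<And>n. v n \<in> univ (K0 (two_plus D))" for v
  proof -
    have v: "v n \<in> univ (K (two_plus D))" for n
      using that[of n] univ_K0_two_plus[OF D] by simp
    have "(case fst (v n) of None \<Rightarrow> \<one>\<^bsub>D\<^esub> | Some d \<Rightarrow> d) \<in> univ D" for n
      using v[of n] by (cases "v n") (auto split: option.splits)
    then show ?thesis
      using hyp wf by (simp add: eval_cone_trm[OF D v] mem_eq_theory)
  qed
  then show "(cone_trm s, cone_trm t) \<in> eq_theory (K0 (two_plus D))"
    using wf by (simp add: mem_eq_theory)
qed

text \<open>\<open>star_mono\<close> gives one direction. For the other, \<open>cone_trm\<close>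
  encodes an identity in the same way for \<open>D\<close> and for \<open>E\<close>.\<close>

lemma eq_theory_K0_two_plus_subset_iff:
  assumes D: "D \<in> CIRL" and E: "E \<in> CIRL"
  shows "eq_theory (K0 (two_plus D)) \<subseteq> eq_theory (K0 (two_plus E)) \<longleftrightarrow> eq_theory D \<subseteq> eq_theory E"
proof
  assume "eq_theory D \<subseteq> eq_theory E"
  then show "eq_theory (K0 (two_plus D)) \<subseteq> eq_theory (K0 (two_plus E))"
    by (simp add: eq_theory_K0_two_plus D E star_mono)
next
  assume sub: "eq_theory (K0 (two_plus D)) \<subseteq> eq_theory (K0 (two_plus E))"
  show "eq_theory D \<subseteq> eq_theory E"
  proof safe
    fix s t assume st: "(s, t) \<in> eq_theory D"
    then have wf: "wf_trm s" "wf_trm t" by (auto simp: mem_eq_theory)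
    show "(s, t) \<in> eq_theory E"
      using st sub cone_trm_identity[OF D wf] cone_trm_identity[OF E wf] by blast
  qed
qed

section \<open>The structure of algebras in \<open>K(SRL)\<close>\<close>

text \<open>By the dichotomy every x other than 0 has \<not>x = 0. If xy = 0 then x \<le> \<not>y,
  so nonzero elements have nonzero products; the remaining operations follow, and the nonzero
  elements form \<open>E\<close>.\<close>

lemma two_plus_decomposition:
  fixes Q :: "(brl_sym, 'a) algebra"
  assumes Q: "Q \<in> BCRL" and nontriv: "zero Q \<noteq> \<one>\<^bsub>rl Q\<^esub>"
    and dich: "\<And>x. x \<in> univ Q \<Longrightarrow> neg Q x = \<one>\<^bsub>rl Q\<^esub> \<or> neg Q (neg Q x) = \<one>\<^bsub>rl Q\<^esub>"
  shows "\<exists>(E :: (rl_sym, 'a) algebra) \<phi>. E \<in> CIRL \<and> is_hom \<phi> Q (two_plus E) \<and>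
    \<phi> ` univ Q = univ (two_plus E) \<and> inj_on \<phi> (univ Q)"
proof -
  interpret bcrl "rl Q" Q using Q by (simp add: BCRL_iff)
  note [simp] = closed[unfolded univ_rl] zero_closed[unfolded univ_rl]
  let ?R = "rl Q"
  let ?z = "zero Q"
  let ?U = "univ Q - {?z}"
  define E where "E = ?R\<lparr>univ := ?U\<rparr>"
  define \<phi> where "\<phi> x = (if x = ?z then None else Some x)" for x
  have neg: "neg Q x = ?z" if "x \<in> ?U" for x
    using that dich[of x] neg_eq_one_iff[of x] neg_eq_one_iff[of "neg Q x"] neg_closed[of x] by auto
  have nz: "x \<squnion>\<^bsub>?R\<^esub> y \<noteq> ?z" "x \<sqinter>\<^bsub>?R\<^esub> y \<noteq> ?z" "x \<odot>\<^bsub>?R\<^esub> y \<noteq> ?z" "x \<rightarrow>\<^bsub>?R\<^esub> y \<noteq> ?z"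
    if xy: "x \<in> ?U" "y \<in> ?U" for x y
  proof -
    have u: "x \<in> univ ?R" "y \<in> univ ?R" "x \<noteq> ?z" "y \<noteq> ?z" using xy by auto
    show m: "x \<odot>\<^bsub>?R\<^esub> y \<noteq> ?z"
      using residuation[of x y ?z] u neg[OF xy(2)] le_zero_iff[of x] le_refl[of ?z] by (auto simp: neg_eq)
    show "x \<sqinter>\<^bsub>?R\<^esub> y \<noteq> ?z"
      using mult_le_meet[of x y] m u le_zero_iff[of "x \<odot>\<^bsub>?R\<^esub> y"] by auto
    show "x \<squnion>\<^bsub>?R\<^esub> y \<noteq> ?z"
      using join_ub1[of x y] u le_zero_iff[of x] by metis
    show "x \<rightarrow>\<^bsub>?R\<^esub> y \<noteq> ?z"
      using le_impl[of x y] u le_zero_iff[of y] by metis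
  qed
  have algE: "is_algebra E"
    unfolding is_algebra_rl E_def oper_univ_update using nz nontriv by simp
  moreover have "eq_theory ?R \<subseteq> eq_theory E"
    unfolding E_def by (rule eq_theory_mono_univ) auto
  ultimately have E: "E \<in> CIRL"
    using CIRL_transfer Q by (auto simp: BCRL_def)
  have "is_hom \<phi> Q (two_plus E)"
    unfolding is_hom_brl_iff is_hom_rl_iff
  proof (intro conjI ballI)
    fix x y assume "x \<in> univ (rl Q)" "y \<in> univ (rl Q)"
    then have xy: "x \<in> univ Q" "y \<in> univ Q" by simp_all
    have o: "a \<squnion>\<^bsub>E\<^esub> b = a \<squnion>\<^bsub>?R\<^esub> b" "a \<sqinter>\<^bsub>E\<^esub> b = a \<sqinter>\<^bsub>?R\<^esub> b" "a \<odot>\<^bsub>E\<^esub> b = a \<odot>\<^bsub>?R\<^esub> b"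
      "a \<rightarrow>\<^bsub>E\<^esub> b = a \<rightarrow>\<^bsub>?R\<^esub> b" "\<one>\<^bsub>E\<^esub> = \<one>\<^bsub>?R\<^esub>" for a b
      by (simp_all add: E_def)
    note z = zero_join[unfolded univ_rl] zero_meet[unfolded univ_rl] zero_mult[unfolded univ_rl]
      zero_impl[unfolded univ_rl]
    show "\<phi> (x \<squnion>\<^bsub>?R\<^esub> y) = \<phi> x \<squnion>\<^bsub>rl (two_plus E)\<^esub> \<phi> y"
      using nz(1)[of x y] xy by (cases "x = ?z"; cases "y = ?z") (simp_all add: \<phi>_def o z)
    show "\<phi> (x \<sqinter>\<^bsub>?R\<^esub> y) = \<phi> x \<sqinter>\<^bsub>rl (two_plus E)\<^esub> \<phi> y"
      using nz(2)[of x y] xy by (cases "x = ?z"; cases "y = ?z") (simp_all add: \<phi>_def o z)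
    show "\<phi> (x \<odot>\<^bsub>?R\<^esub> y) = \<phi> x \<odot>\<^bsub>rl (two_plus E)\<^esub> \<phi> y"
      using nz(3)[of x y] xy by (cases "x = ?z"; cases "y = ?z") (simp_all add: \<phi>_def o z)
    show "\<phi> (x \<rightarrow>\<^bsub>?R\<^esub> y) = \<phi> x \<rightarrow>\<^bsub>rl (two_plus E)\<^esub> \<phi> y"
      using nz(4)[of x y] xy neg[of x] nontriv
      by (cases "x = ?z"; cases "y = ?z") (simp_all add: \<phi>_def o z neg_eq)
  qed (use nontriv in \<open>auto simp: \<phi>_def E_def\<close>)
  moreover have "\<phi> ` univ Q = univ (two_plus E)"
    using zero_closed by (auto simp: \<phi>_def E_def image_iff)
  moreover have "inj_on \<phi> (univ Q)"
    by (auto simp: inj_on_def \<phi>_def split: if_splits)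
  ultimately show ?thesis using E by blast
qed

text \<open>Since \<not>y \<squnion> \<not>\<not>y = 1 is in \<open>F\<close>, primeness puts
  \<not>y or \<not>\<not>y into \<open>F\<close>. That element becomes 1 in the quotient, which is
  the dichotomy of \<open>two_plus_decomposition\<close>.\<close>

lemma (in bcrl_filter) stonean_quotient:
  assumes B: "B \<in> SRL" and prime: "prime_filter R F" and proper: "zero B \<notin> F"
  shows "\<exists>(E :: (rl_sym, 'a) algebra) g. E \<in> CIRL \<and> is_hom g B (two_plus E) \<and>
    g ` univ B = univ (two_plus E) \<and> (\<forall>x\<in>univ B. \<forall>y\<in>univ B. g x = g y \<longleftrightarrow> biimpl R x y \<in> F)"
proof -
  let ?Q = "image_algebra r B"
  have hom: "r (x \<rightarrow> y) = r x \<rightarrow>\<^bsub>rl ?Q\<^esub> r y" "r \<one> = \<one>\<^bsub>rl ?Q\<^esub>" "r (zero B) = zero ?Q"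
    if "x \<in> univ B" "y \<in> univ B" for x y
    using hom_r[unfolded is_hom_brl_iff is_hom_rl_iff, folded R_def] that
    by (simp_all add: R_def)
  have uB: "univ B = univ R" by (simp add: R_def)
  have neg: "neg ?Q (r x) = r (neg B x)" if "x \<in> univ R" for x
    unfolding neg_eq neg_def[of ?Q] using hom[of x "zero B"] that uB zero_closed by metis
  have r_one: "r x = r \<one> \<longleftrightarrow> x \<in> F" if "x \<in> univ R" for x
    using that filter_has_one[OF F] by (simp add: r_eq biimpl_def)
  have one: "r \<one> = \<one>\<^bsub>rl ?Q\<^esub>" and zero: "r (zero B) = zero ?Q"
    using hom[of \<one> \<one>] uB by simp_all
  have stone: "\<forall>x\<in>univ B. neg B x \<squnion> neg B (neg B x) = \<one>"
    using B unfolding SRL_def mem_Collect_eq R_def[symmetric] by (rule conjunct2)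
  have dich: "neg ?Q x = \<one>\<^bsub>rl ?Q\<^esub> \<or> neg ?Q (neg ?Q x) = \<one>\<^bsub>rl ?Q\<^esub>" if x: "x \<in> univ ?Q" for x
  proof -
    obtain y where y: "y \<in> univ R" "x = r y" using x uB by auto
    have "neg B y \<squnion> neg B (neg B y) = \<one>"
      using stone y(1) uB by blast
    then have "neg B y \<in> F \<or> neg B (neg B y) \<in> F"
      using prime y filter_has_one[OF F] unfolding prime_filter_def
      by (metis neg_closed)
    then show ?thesis
      using y r_one one by (simp add: neg)
  qed
  have "zero ?Q \<noteq> \<one>\<^bsub>rl ?Q\<^esub>"
    using r_one[of "zero B"] proper one zero by simp
  from two_plus_decomposition[OF quotient_BCRL this dich]
  obtain E :: "(rl_sym, 'a) algebra" and \<phi> where E: "E \<in> CIRL" and \<phi>: "is_hom \<phi> ?Q (two_plus E)"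
    "\<phi> ` univ ?Q = univ (two_plus E)" "inj_on \<phi> (univ ?Q)"
    by blast
  have "is_hom (\<lambda>x. \<phi> (r x)) B (two_plus E)"
    by (rule is_hom_compose[OF hom_r \<phi>(1)])
  moreover have "(\<lambda>x. \<phi> (r x)) ` univ B = univ (two_plus E)"
    using \<phi>(2) by (simp add: image_image)
  moreover have "\<phi> (r x) = \<phi> (r y) \<longleftrightarrow> biimpl R x y \<in> F" if "x \<in> univ B" "y \<in> univ B" for x y
    using that r_eq[of x y] inj_on_eq_iff[OF \<phi>(3), of "r x" "r y"] uB by simp
  ultimately show ?thesis
    using E by (intro exI[of _ E] exI[of _ "\<lambda>x. \<phi> (r x)"] conjI) auto
qed

section \<open>Images of a K-lattice in K(2 \<oplus> E) and its monolith\<close>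

context bkl
begin

lemma inv_cone: "x \<in> univ R \<Longrightarrow> x \<sqsubseteq> \<one> \<Longrightarrow> \<sim> x \<sqinter> \<one> = \<one>"
  using residuation[of \<one> x \<one>] by (simp add: inv_neg_def le_def meet_comm)

definition cone_map :: "('a \<Rightarrow> 'b) \<Rightarrow> 'a \<Rightarrow> 'b \<times> 'b" where
  "cone_map g x = (g (x \<sqinter> \<one>), g (\<sim> x \<sqinter> \<one>))"

lemma is_hom_cone_map: "is_hom g (neg_cone A) C \<Longrightarrow> is_hom (cone_map g) A (K C)"
  using is_hom_cone[of g C] by (simp add: cone_map_def[abs_def])

text \<open>An element y of the negative cone is sent to (g y, 1), so the image contains the whole
  negative cone of K(2 \<oplus> E). It is an admissible subalgebra and contains the least
  one.\<close>

lemma cone_map_onto_K0: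
  assumes g: "is_hom g (neg_cone A) (two_plus E)" "g ` univ (neg_cone A) = univ (two_plus E)"
    and E: "E \<in> CIRL"
  shows "univ (K0 (two_plus E)) \<subseteq> cone_map g ` univ A"
proof -
  interpret E: cirl E using E by (simp add: CIRL_iff)
  let ?S = "cone_map g ` univ A"
  have sub: "subuniverse ?S (K (two_plus E))"
    by (rule is_hom_image_subuniverse[OF is_hom_cone_map[OF g(1)] alg_A])
  have "g \<one> = \<one>\<^bsub>rl (two_plus E)\<^esub>"
    using g(1) unfolding is_hom_brl_iff is_hom_rl_iff by (simp add: R_def)
  then have g1: "g \<one> = Some \<one>\<^bsub>E\<^esub>" by simp
  have "x \<in> ?S" if x: "x \<in> univ (neg_cone (K (two_plus E)))" for x
  proof -
    obtain a b where ab: "x = (a, b)" by (cases x)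
    have "a \<in> univ (two_plus E)" "b = Some \<one>\<^bsub>E\<^esub>"
      using x unfolding ab by (cases a; cases b; auto simp: le_def)+
    then obtain y where "y \<in> univ (neg_cone A)" "g y = a"
      using g(2) by (metis imageE)
    then have y: "y \<in> univ R" "y \<sqsubseteq> \<one>" "y \<in> univ A" by (simp_all add: R_def)
    then have "cone_map g y = x"
      using inv_cone[OF y(1,2)] \<open>g y = a\<close> \<open>b = Some \<one>\<^bsub>E\<^esub>\<close> ab g1 by (simp add: cone_map_def le_def)
    then show ?thesis using y by blast
  qed
  moreover have "univ (neg_cone ((K (two_plus E))\<lparr>univ := ?S\<rparr>)) =
      {x \<in> ?S. x \<sqsubseteq>\<^bsub>rl (K (two_plus E))\<^esub> \<one>\<^bsub>rl (K (two_plus E))\<^esub>}"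
    by (simp only: neg_cone_simps rl_univ_update oper_univ_update) simp
  ultimately have "univ (neg_cone ((K (two_plus E))\<lparr>univ := ?S\<rparr>)) = univ (neg_cone (K (two_plus E)))"
    using sub unfolding subuniverse_def neg_cone_simps by blast
  then have "admissible ?S (K (two_plus E))"
    using sub by (simp only: admissible_def)
  then show ?thesis by (auto simp: K0_def)
qed

lemma cone_cirl: "bcrl (rl (neg_cone A)) (neg_cone A)"
  using neg_cone_BCRL by (simp only: BCRL_iff)

text \<open>The element \<open>c\<close> generates the filter belonging to the monolith of \<open>A\<close>.\<close>

lemma subdirectly_irreducible_cone:
  assumes si: "subdirectly_irreducible A"
  shows "\<exists>c\<in>univ (neg_cone A). c \<noteq> \<one> \<and> (\<forall>F. is_filter (rl (neg_cone A)) F \<and> F \<noteq> {\<one>} \<longrightarrow> c \<in> F)"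
proof (rule ccontr)
  assume no: "\<not> ?thesis"
  let ?N = "neg_cone A"
  interpret N: bcrl "rl ?N" ?N by (rule cone_cirl)
  let ?\<F> = "{F. is_filter (rl ?N) F \<and> F \<noteq> {\<one>}}"
  let ?r = "bcrl_filter.r (rl ?N)"
  have bf: "bcrl_filter (rl ?N) ?N F" if "F \<in> ?\<F>" for F
    using that by unfold_locales simp
  have cone: "x \<sqinter> \<one> \<in> univ (rl ?N)" if "x \<in> univ R" for x
    using that by (simp add: R_def[symmetric] univ_A)
  have one: "\<one>\<^bsub>rl ?N\<^esub> = \<one>" by (simp add: R_def)
  \<comment> \<open>Without such a \<open>c\<close> the filters other than {1} have intersection
    {1}, so their quotients separate the points of \<open>A\<close> and one of them is injective.
    That is absurd, because its filter identifies some x other than 1 with 1.\<close>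
  have "\<exists>F\<in>?\<F>. inj_on (cone_map (?r F)) (univ A)"
  proof (rule subdirectly_irreducible_separating[OF si])
    fix F assume "F \<in> ?\<F>"
    then interpret f: bcrl_filter "rl ?N" ?N F by (rule bf)
    show "is_hom (cone_map (?r F)) A (K (image_algebra (?r F) ?N))"
      by (rule is_hom_cone_map[OF f.hom_r])
  next
    fix x y assume xy: "x \<in> univ A" "y \<in> univ A"
      and eq: "\<And>F. F \<in> ?\<F> \<Longrightarrow> cone_map (?r F) x = cone_map (?r F) y"
    have *: "a = b" if ab: "a \<in> univ (rl ?N)" "b \<in> univ (rl ?N)"
      "\<And>F. F \<in> ?\<F> \<Longrightarrow> ?r F a = ?r F b" for a b
    proof -
      have "biimpl (rl ?N) a b \<in> F" if "F \<in> ?\<F>" for F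
        using bcrl_filter.r_eq[OF bf[OF that] ab(1,2)] ab(3)[OF that] by blast
      then have "biimpl (rl ?N) a b = \<one>"
        using no N.biimpl_closed[OF ab(1,2)] univ_rl[of ?N] by blast
      then show "a = b" using N.biimpl_eq_one[OF ab(1,2)] one by simp
    qed
    have u: "x \<in> univ R" "y \<in> univ R" using xy by (simp_all add: univ_A)
    show "x = y"
    proof (rule cone_determines[OF u])
      show "x \<sqinter> \<one> = y \<sqinter> \<one>"
        by (rule *[OF cone[OF u(1)] cone[OF u(2)]]) (use eq in \<open>simp add: cone_map_def\<close>)
      show "\<sim> x \<sqinter> \<one> = \<sim> y \<sqinter> \<one>"
        by (rule *[OF cone cone]) (use eq u in \<open>simp_all add: cone_map_def\<close>)
    qed
  qed
  then obtain F where F: "F \<in> ?\<F>" and inj: "inj_on (cone_map (?r F)) (univ A)" by blast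
  interpret f: bcrl_filter "rl ?N" ?N F by (rule bf[OF F])
  obtain x where x: "x \<in> F" "x \<noteq> \<one>"
    using F N.filter_has_one[of F] one by auto
  have xN: "x \<in> univ (rl ?N)" using N.filter_univ[OF _ x(1)] F by simp
  then have xR: "x \<in> univ R" "x \<sqsubseteq> \<one>" "x \<in> univ A" by (simp_all add: R_def)
  have "biimpl (rl ?N) x \<one>\<^bsub>rl ?N\<^esub> = x"
    unfolding biimpl_def N.impl_one[OF xN] N.one_impl[OF xN] N.meet_one[OF xN] by (rule refl)
  then have "?r F x = ?r F \<one>"
    using f.r_eq[OF xN N.closed(5)] x(1) one by simp
  then have "cone_map (?r F) x = cone_map (?r F) \<one>"
    using xR inv_cone[OF xR(1,2)] by (simp add: cone_map_def le_def)
  then show False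
    using inj xR x(2) by (auto simp: inj_on_def univ_A)
qed

end

text \<open>Join irreducibility of 1. If x \<squnion> y = 1 with both different from 1, the filter
  of all w with w \<squnion> y = 1 contains x, hence c; then the filter of all w with w \<squnion> c
  = 1 contains y, hence c, and c = 1.\<close>

lemma (in cirl) prime_filter_one:
  assumes c: "c \<in> univ R" "c \<noteq> \<one>" "\<And>F. is_filter R F \<Longrightarrow> F \<noteq> {\<one>} \<Longrightarrow> c \<in> F"
  shows "prime_filter R {\<one>}"
  unfolding prime_filter_def
proof (intro conjI ballI impI filter_one)
  fix x y assume xy: "x \<in> univ R" "y \<in> univ R" "x \<squnion> y \<in> {\<one>}"
  show "x \<in> {\<one>} \<or> y \<in> {\<one>}"
  proof (rule ccontr)
    assume no: "\<not> ?thesis"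
    have *: "c \<in> {x \<in> univ R. x \<squnion> z \<in> {\<one>}}"
      if "z \<in> univ R" "w \<in> univ R" "w \<squnion> z = \<one>" "w \<noteq> \<one>" for z w
    proof (rule c(3)[OF filter_join[OF filter_one that(1)]])
      show "{x \<in> univ R. x \<squnion> z \<in> {\<one>}} \<noteq> {\<one>}" using that by blast
    qed
    have "c \<squnion> y = \<one>" using *[of y x] xy no by simp
    then have "c \<squnion> c = \<one>" using *[of c y] join_comm[of c y] xy no c(1) by simp
    then show False using c by simp
  qed
qed

text \<open>The elements that a non-injective coordinate map identifies with 1 form a filter other
  than {1}, which contains c. If all coordinate maps were non-injective, they would all identify c
  with 1.\<close>

lemma (in cirl) subdirectly_irreducible_monolith:
  assumes c: "c \<in> univ R" "c \<noteq> \<one>" "\<And>F. is_filter R F \<Longrightarrow> F \<noteq> {\<one>} \<Longrightarrow> c \<in> F"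
  shows "subdirectly_irreducible R"
  unfolding subdirectly_irreducible_def
proof (intro conjI alg allI impI)
  fix I :: "'a rel set" and B :: "'a rel \<Rightarrow> (rl_sym, 'a set) algebra" and h
  assume rep: "subdirect_representation R I B h"
  show "\<exists>i\<in>I. is_hom (h i) R (B i) \<and> bij_betw (h i) (univ R) (univ (B i))"
  proof (rule ccontr)
    assume no: "\<not> ?thesis"
    have "h i c = h i \<one>" if i: "i \<in> I" for i
    proof -
      have hom: "is_hom (h i) R (B i)" and onto: "h i ` univ R = univ (B i)"
        using rep i unfolding subdirect_representation_def by blast+
      have ops: "h i (x \<odot> y) = h i x \<odot>\<^bsub>B i\<^esub> h i y" "h i (x \<squnion> y) = h i x \<squnion>\<^bsub>B i\<^esub> h i y"
        "h i (x \<rightarrow> y) = h i x \<rightarrow>\<^bsub>B i\<^esub> h i y" if "x \<in> univ R" "y \<in> univ R" for x y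
        using hom that unfolding is_hom_rl_iff by blast+
      let ?F = "{x \<in> univ R. h i x = h i \<one>}"
      have mult: "h i (x \<odot> y) = h i \<one>" if "x \<in> ?F" "y \<in> ?F" for x y
      proof -
        have "h i x \<odot>\<^bsub>B i\<^esub> h i y = h i \<one> \<odot>\<^bsub>B i\<^esub> h i \<one>" using that by simp
        then show ?thesis using that ops(1)[of x y] ops(1)[of \<one> \<one>] by simp
      qed
      have up: "h i y = h i \<one>" if "x \<in> ?F" "y \<in> univ R" "x \<sqsubseteq> y" for x y
      proof -
        have "h i y = h i (x \<squnion> y)" using that le_iff_join by simp
        also have "\<dots> = h i (\<one> \<squnion> y)" using that ops(2)[of x y] ops(2)[of \<one> y] by simp
        also have "\<dots> = h i \<one>" using that by simp
        finally show ?thesis .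
      qed
      have F: "is_filter R ?F"
        unfolding is_filter_def
      proof (intro conjI ballI impI)
        show "x \<odot> y \<in> ?F" if "x \<in> ?F" "y \<in> ?F" for x y
          using mult[OF that] that by simp
        show "y \<in> ?F" if "x \<in> ?F" "y \<in> univ R" "x \<sqsubseteq> y" for x y
          using up[OF that] that by simp
      qed auto
      obtain x y where xy: "x \<in> univ R" "y \<in> univ R" "h i x = h i y" "x \<noteq> y"
        using no i hom onto unfolding bij_betw_def inj_on_def by blast
      have "h i (x \<rightarrow> y) = h i (y \<rightarrow> y)" "h i (y \<rightarrow> x) = h i (x \<rightarrow> x)"
        using xy ops(3)[of x y] ops(3)[of y y] ops(3)[of y x] ops(3)[of x x] by simp_all
      then have "x \<rightarrow> y \<in> ?F" "y \<rightarrow> x \<in> ?F" using xy by simp_all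
      moreover have "\<not> (x \<rightarrow> y = \<one> \<and> y \<rightarrow> x = \<one>)"
        using xy le_antisym by (auto simp: impl_eq_one)
      ultimately have "?F \<noteq> {\<one>}" by (metis singletonD)
      then show "h i c = h i \<one>" using c(3)[OF F] by blast
    qed
    moreover have "(\<forall>i\<in>I. h i c = h i \<one>) \<longrightarrow> c = \<one>"
      using rep[unfolded subdirect_representation_def, THEN conjunct2] c(1) closed(5) by metis
    ultimately show False using c(2) by metis
  qed
qed

text \<open>By \<open>cone_determines\<close> one of the two coordinates differs, and a prime filter
  can avoid the biimplication there. Such a filter is proper. This plays the role of a subdirect
  representation.\<close>

lemma (in bkl) separating_prime_filter:
  assumes xy: "x \<in> univ R" "y \<in> univ R" "x \<noteq> y"
  shows "\<exists>F. prime_filter (rl (neg_cone A)) F \<and> zero A \<notin> F \<and>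
    \<not> (biimpl (rl (neg_cone A)) (x \<sqinter> \<one>) (y \<sqinter> \<one>) \<in> F \<and>
       biimpl (rl (neg_cone A)) (\<sim> x \<sqinter> \<one>) (\<sim> y \<sqinter> \<one>) \<in> F)"
proof -
  let ?N = "neg_cone A"
  interpret N: bcrl "rl ?N" ?N by (rule cone_cirl)
  have cone: "z \<sqinter> \<one> \<in> univ (rl ?N)" if "z \<in> univ R" for z
    using that by (simp add: R_def[symmetric] univ_A)
  have avoid: "\<exists>F. prime_filter (rl ?N) F \<and> zero A \<notin> F \<and> biimpl (rl ?N) a b \<notin> F"
    if ab: "a \<in> univ (rl ?N)" "b \<in> univ (rl ?N)" "a \<noteq> b" for a b
  proof -
    have "biimpl (rl ?N) a b \<noteq> \<one>\<^bsub>rl ?N\<^esub>"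
      using N.biimpl_eq_one[OF ab(1,2)] ab(3) by blast
    then obtain F where F: "prime_filter (rl ?N) F" "biimpl (rl ?N) a b \<notin> F"
      using N.prime_filter_avoiding[OF N.biimpl_closed[OF ab(1,2)]] by blast
    moreover have "zero ?N \<notin> F"
      using F N.filter_up[of F "zero ?N"] N.zero_le N.biimpl_closed[OF ab(1,2)]
      unfolding prime_filter_def by blast
    ultimately show ?thesis by auto
  qed
  have "x \<sqinter> \<one> \<noteq> y \<sqinter> \<one> \<or> \<sim> x \<sqinter> \<one> \<noteq> \<sim> y \<sqinter> \<one>"
    using cone_determines[OF xy(1,2)] xy(3) by blast
  then show ?thesis
  proof
    assume "x \<sqinter> \<one> \<noteq> y \<sqinter> \<one>"
    from avoid[OF cone[OF xy(1)] cone[OF xy(2)] this] show ?thesis by blast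
  next
    assume "\<sim> x \<sqinter> \<one> \<noteq> \<sim> y \<sqinter> \<one>"
    from avoid[OF cone[OF inv_closed[OF xy(1)]] cone[OF inv_closed[OF xy(2)]] this]
    show ?thesis by blast
  qed
qed

section \<open>Particular algebras and identities\<close>

lemma two_CIRL: "two \<in> CIRL"
  by (auto simp: CIRL_def is_CRL_def is_algebra_rl two_def le_def)

lemma two_b_simps [simp]:
  "univ two_b = UNIV" "(x \<squnion>\<^bsub>rl two_b\<^esub> y) = (x \<or> y)" "(x \<sqinter>\<^bsub>rl two_b\<^esub> y) = (x \<and> y)"
  "(x \<odot>\<^bsub>rl two_b\<^esub> y) = (x \<and> y)" "(x \<rightarrow>\<^bsub>rl two_b\<^esub> y) = (x \<longrightarrow> y)" "\<one>\<^bsub>rl two_b\<^esub> = True" "zero two_b = False"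
  by (simp_all add: two_b_def two_def)

lemma K4_simps [simp]:
  "univ K4 = UNIV"
  "(a, b) \<squnion>\<^bsub>rl K4\<^esub> (c, d) = (a \<or> c, b \<and> d)"
  "(a, b) \<sqinter>\<^bsub>rl K4\<^esub> (c, d) = (a \<and> c, b \<or> d)"
  "(a, b) \<odot>\<^bsub>rl K4\<^esub> (c, d) = (a \<and> c, (a \<longrightarrow> d) \<and> (c \<longrightarrow> b))"
  "(a, b) \<rightarrow>\<^bsub>rl K4\<^esub> (c, d) = ((a \<longrightarrow> c) \<and> (d \<longrightarrow> b), a \<and> d)"
  "\<one>\<^bsub>rl K4\<^esub> = (True, True)"
  "zero K4 = (False, True)"
  by (simp_all add: K4_def)

lemma is_algebra_K4: "is_algebra K4"
  by (simp add: is_algebra_brl is_algebra_rl)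

lemma K4_bounded_K_lattice: "is_bounded_K_lattice K4"
proof -
  have "is_CRL (rl K4)"
    using is_algebra_K4 unfolding is_CRL_def is_algebra_brl le_def univ_rl K4_simps(1)
    by (auto simp: split_paired_all)
  then show ?thesis
    using is_algebra_K4 unfolding is_bounded_K_lattice_def is_K_lattice_def le_def univ_rl K4_simps(1)
    by (auto simp: split_paired_all inv_neg_def)
qed

lemma K4_K_class_BA: "K4 \<in> K_class BA"
proof -
  interpret bkl "rl K4" K4 using K4_bounded_K_lattice by (simp add: bkl_iff)
  show ?thesis
    using K4_bounded_K_lattice neg_cone_BCRL
    by (auto simp: K_class_def BA_def le_def split_paired_all)
qed

lemma is_hom_two_plus_two_b: "is_hom (\<lambda>x. x \<noteq> None) (two_plus D) two_b"
  by (auto simp: is_hom_brl_iff is_hom_rl_iff)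

lemma is_hom_two_b_two_plus:
  assumes "D \<in> CIRL" shows "is_hom (\<lambda>b. if b then Some \<one>\<^bsub>D\<^esub> else None) two_b (two_plus D)"
proof -
  interpret cirl D using assms by (simp add: CIRL_iff)
  show ?thesis by (auto simp: is_hom_brl_iff is_hom_rl_iff)
qed

section \<open>Two identities and their join\<close>

abbreviation neg_trm :: "brl_sym trm \<Rightarrow> brl_sym trm" where
  "neg_trm s \<equiv> bM (bI s b0) b1"

text \<open>The identity \<open>\<not>\<not>(x \<and> 1) \<or> \<not>\<not>(\<sim>x \<and> 1) = 1\<close> separates \<open>K\<^sub>0(2 \<oplus> D)\<close> from \<open>K(2 \<oplus> D)\<close>, while
  \<open>(y \<and> 1) \<or> \<not>(y \<and> 1) = 1\<close> expresses that the negative cone is Boolean.\<close>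

definition nn_trm :: "brl_sym trm" where
  "nn_trm = bJ (neg_trm (neg_trm (bM X0 b1))) (neg_trm (neg_trm (bM (bI X0 b1) b1)))"

definition ba_trm :: "brl_sym trm" where
  "ba_trm = bJ (bM X1 b1) (neg_trm (bM X1 b1))"

lemma wf_nn_ba [simp]: "wf_trm nn_trm" "wf_trm ba_trm"
  by (simp_all add: nn_trm_def ba_trm_def)

text \<open>Double negation on 2 \<oplus> D sends all of \<open>D\<close> to 1 and fixes 0, so only
  both coordinates being 0 can make the value differ from 1.\<close>

lemma eval_nn_trm:
  assumes D: "D \<in> CIRL" and v: "v 0 \<in> univ (K (two_plus D))"
  shows "eval_trm (K (two_plus D)) v nn_trm =
    (if v 0 = (None, None) then None else Some \<one>\<^bsub>D\<^esub>, Some \<one>\<^bsub>D\<^esub>)"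
proof -
  interpret cirl D using D by (simp add: CIRL_iff)
  obtain a b where ab: "v 0 = (a, b)" and a: "a = None \<or> (\<exists>d\<in>univ D. a = Some d)"
    and b: "b = None \<or> (\<exists>d\<in>univ D. b = Some d)"
    using v by (cases "v 0") auto
  from a b show ?thesis by (elim disjE bexE) (simp_all add: nn_trm_def ab)
qed

lemma eval_ba_trm:
  assumes D: "D \<in> CIRL" and v: "v (Suc 0) \<in> univ (K (two_plus D))"
  shows "eval_trm (K (two_plus D)) v ba_trm =
    (case fst (v (Suc 0)) of None \<Rightarrow> Some \<one>\<^bsub>D\<^esub> | Some d \<Rightarrow> Some d, Some \<one>\<^bsub>D\<^esub>)"
proof -
  interpret cirl D using D by (simp add: CIRL_iff)
  obtain a b where ab: "v (Suc 0) = (a, b)" and a: "a = None \<or> (\<exists>d\<in>univ D. a = Some d)"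
    and b: "b = None \<or> (\<exists>d\<in>univ D. b = Some d)"
    using v by (cases "v (Suc 0)") auto
  from a b show ?thesis by (elim disjE bexE) (simp_all add: ba_trm_def ab)
qed

lemma univ_K0_two_plusD:
  assumes "D \<in> CIRL" "x \<in> univ (K0 (two_plus D))"
  shows "x \<in> univ (K (two_plus D))" "x \<noteq> (None, None)"
  using assms(2) unfolding univ_K0_two_plus[OF assms(1)] by auto

lemma nn_K0:
  assumes D: "D \<in> CIRL" shows "(nn_trm, b1) \<in> eq_theory (K0 (two_plus D))"
proof -
  have "eval_trm (K (two_plus D)) v nn_trm = eval_trm (K (two_plus D)) v b1"
    if v: "\<And>n. v n \<in> univ (K0 (two_plus D))" for v
    using eval_nn_trm[OF D, of v] univ_K0_two_plusD[OF D v[of 0]] by simp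
  then show ?thesis by (simp add: mem_eq_theory)
qed

lemma nn_K4: "(nn_trm, b1) \<notin> eq_theory K4"
proof
  assume "(nn_trm, b1) \<in> eq_theory K4"
  then have "eval_trm K4 (\<lambda>_. (False, False)) nn_trm = eval_trm K4 (\<lambda>_. (False, False)) b1"
    unfolding mem_eq_theory by simp
  then show False by (simp add: nn_trm_def)
qed

lemma ba_K4: "(ba_trm, b1) \<in> eq_theory K4"
proof -
  have "eval_trm K4 v ba_trm = eval_trm K4 v b1" for v
    by (cases "v (Suc 0)") (auto simp: ba_trm_def)
  then show ?thesis by (simp add: mem_eq_theory)
qed

lemma ba_K8: "(ba_trm, b1) \<notin> eq_theory K8"
proof
  \<comment> \<open>\<open>Some False\<close> is the middle element of the three-element chain 2
    \<oplus> 2; its negation is 0, so joining the two does not reach 1.\<close>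
  let ?v = "\<lambda>_::nat. (Some False, Some True)"
  have v: "?v n \<in> univ K8" "?v n \<in> univ (K (two_plus two))" for n
    unfolding K8_def univ_K0_two_plus[OF two_CIRL] by (auto simp: two_def)
  assume "(ba_trm, b1) \<in> eq_theory K8"
  then have "eval_trm K8 ?v ba_trm = eval_trm K8 ?v b1"
    by (rule eq_theoryD[OF _ v(1)])
  then show False
    using eval_ba_trm[OF two_CIRL v(2)] by (simp add: K8_def two_def)
qed

text \<open>The two terms use different variables, so their join equals 1 wherever one of them
  always does: the first in \<open>K0 (two_plus D)\<close>, the second in \<open>K4\<close>. In K(2
  \<oplus> D) with nontrivial \<open>D\<close> both can fail at once, at (0, 0) and (d, 1). This is
  how K(2 \<oplus> D) is kept out of the join of the two varieties.\<close>

lemma nn_ba_K0: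
  assumes "D \<in> CIRL" shows "(bJ nn_trm ba_trm, b1) \<in> eq_theory (K0 (two_plus D))"
proof -
  interpret cirl D using assms by (simp add: CIRL_iff)
  have "eval_trm (K (two_plus D)) v (bJ nn_trm ba_trm) = eval_trm (K (two_plus D)) v b1"
    if v: "\<And>n. v n \<in> univ (K0 (two_plus D))" for v
  proof -
    note vK = univ_K0_two_plusD[OF assms v]
    have "fst (v (Suc 0)) = None \<or> (\<exists>d\<in>univ D. fst (v (Suc 0)) = Some d)"
      using vK(1)[of "Suc 0"] by (cases "v (Suc 0)") auto
    then show ?thesis
      using eval_nn_trm[OF assms vK(1)] eval_ba_trm[OF assms vK(1)] vK(2)[of 0]
      by (elim disjE bexE) simp_all
  qed
  then show ?thesis by (simp add: mem_eq_theory)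
qed

lemma nn_ba_K4: "(bJ nn_trm ba_trm, b1) \<in> eq_theory K4"
proof -
  have "eval_trm K4 v (bJ nn_trm ba_trm) = eval_trm K4 v b1" for v
    by (cases "v 0"; cases "v (Suc 0)") (auto simp: nn_trm_def ba_trm_def)
  then show ?thesis by (simp add: mem_eq_theory)
qed

lemma nn_ba_K:
  assumes D: "D \<in> CIRL" and d: "d \<in> univ D" "d \<noteq> \<one>\<^bsub>D\<^esub>"
  shows "(bJ nn_trm ba_trm, b1) \<notin> eq_theory (K (two_plus D))"
proof
  interpret cirl D using D by (simp add: CIRL_iff)
  let ?v = "\<lambda>n::nat. if n = 0 then (None, None) else (Some d, Some \<one>\<^bsub>D\<^esub>)"
  have v: "?v n \<in> univ (K (two_plus D))" for n using d by simp
  assume "(bJ nn_trm ba_trm, b1) \<in> eq_theory (K (two_plus D))"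
  then have "eval_trm (K (two_plus D)) ?v (bJ nn_trm ba_trm) = eval_trm (K (two_plus D)) ?v b1"
    by (rule eq_theoryD[OF _ v])
  then show False
    using eval_nn_trm[OF D, of ?v] eval_ba_trm[OF D, of ?v] d by simp
qed

text \<open>Together with \<open>cone_map_onto_K0\<close> this makes the image exactly
  \<open>K0 (two_plus D)\<close>.\<close>

lemma nn_image:
  assumes D: "D \<in> CIRL" and h: "is_hom h B (K (two_plus D))" and B: "is_algebra B"
    and nn: "(nn_trm, b1) \<in> eq_theory B"
  shows "(None, None) \<notin> h ` univ B"
proof
  assume "(None, None) \<in> h ` univ B"
  then obtain x where x: "x \<in> univ B" "h x = (None, None)" by (metis imageE)
  have "h (eval_trm B (\<lambda>_. x) nn_trm) = h (eval_trm B (\<lambda>_. x) b1)"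
    using nn x(1) unfolding mem_eq_theory by simp
  then have "eval_trm (K (two_plus D)) (\<lambda>_. h x) nn_trm = eval_trm (K (two_plus D)) (\<lambda>_. h x) b1"
    using eval_hom[OF h B, of nn_trm "\<lambda>_. x"] eval_hom[OF h B, of b1 "\<lambda>_. x"] x(1) by simp
  then show False
    using eval_nn_trm[OF D, of "\<lambda>_. h x"] x by simp
qed

section \<open>Algebras with Boolean negative cone\<close>

text \<open>The complement law makes a prime filter contain x or \<not>x; this is what implication
  requires, as \<not>x \<le> x \<rightarrow> y.\<close>

lemma (in bcrl) is_hom_prime_filter_two_b:
  assumes P: "prime_filter R F" and proper: "zero B \<notin> F"
    and idem: "\<And>x y. x \<in> univ R \<Longrightarrow> y \<in> univ R \<Longrightarrow> x \<odot> y = x \<sqinter> y"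
    and compl: "\<And>x. x \<in> univ R \<Longrightarrow> x \<squnion> neg B x = \<one>"
  shows "is_hom (\<lambda>x. x \<in> F) B two_b"
proof -
  have F: "is_filter R F" using P by (simp add: prime_filter_def)
  have "x \<squnion> y \<in> F \<longleftrightarrow> x \<in> F \<or> y \<in> F" if "x \<in> univ R" "y \<in> univ R" for x y
    using P that filter_up[OF F, of x "x \<squnion> y"] filter_up[OF F, of y "x \<squnion> y"]
    by (auto simp: prime_filter_def)
  moreover have meet: "x \<sqinter> y \<in> F \<longleftrightarrow> x \<in> F \<and> y \<in> F" if "x \<in> univ R" "y \<in> univ R" for x y
    using that filter_up[OF F, of "x \<sqinter> y" x] filter_up[OF F, of "x \<sqinter> y" y] filter_mult[OF F, of x y]
    by (auto simp: idem)
  moreover have "x \<rightarrow> y \<in> F \<longleftrightarrow> (x \<in> F \<longrightarrow> y \<in> F)" if xy: "x \<in> univ R" "y \<in> univ R" for x y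
  proof
    assume "x \<rightarrow> y \<in> F"
    then show "x \<in> F \<longrightarrow> y \<in> F"
      using filter_up[OF F filter_mult[OF F, of "x \<rightarrow> y" x] impl_mp] xy by blast
  next
    assume imp: "x \<in> F \<longrightarrow> y \<in> F"
    have "x \<in> F \<or> neg B x \<in> F"
      using P compl[OF xy(1)] filter_has_one[OF F] xy(1) neg_closed[OF xy(1)]
      unfolding prime_filter_def by metis
    then show "x \<rightarrow> y \<in> F"
    proof
      assume "x \<in> F"
      then show ?thesis using imp filter_up[OF F, of y "x \<rightarrow> y"] xy by simp
    next
      assume "neg B x \<in> F"
      then show ?thesis
        using filter_up[OF F, of "neg B x" "x \<rightarrow> y"] impl_mono2[of "zero B" y x] xy by (simp add: neg_eq)
    qed
  qed
  ultimately show ?thesis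
    using filter_has_one[OF F] proper
    unfolding is_hom_brl_iff is_hom_rl_iff R_def[symmetric] by (simp add: idem)
qed

text \<open>A failing identity has two distinct values in \<open>B\<close>. A prime filter
  separating them maps the Boolean negative cone to 2, and the induced homomorphism into
  \<open>K4\<close> keeps the values distinct.\<close>

lemma K_class_BA_eq_theory:
  assumes B: "B \<in> K_class BA" shows "eq_theory K4 \<subseteq> eq_theory B"
proof (rule subrelI, rule ccontr)
  fix s t assume st: "(s, t) \<in> eq_theory K4" and no: "(s, t) \<notin> eq_theory B"
  interpret bkl "rl B" B using B by (simp add: bkl_iff K_class_def)
  have wf: "wf_trm s" "wf_trm t" using st by (auto simp: mem_eq_theory)
  obtain v where v: "\<And>n. v n \<in> univ B" "eval_trm B v s \<noteq> eval_trm B v t"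
    using no wf by (auto simp: mem_eq_theory)
  let ?s = "eval_trm B v s" and ?t = "eval_trm B v t"
  have u: "?s \<in> univ (rl B)" "?t \<in> univ (rl B)"
    using v(1) wf alg_A by (simp_all add: eval_trm_closed)
  let ?N = "neg_cone B"
  obtain F where P: "prime_filter (rl ?N) F" and z: "zero B \<notin> F"
    and sep: "\<not> (biimpl (rl ?N) (?s \<sqinter>\<^bsub>rl B\<^esub> \<one>\<^bsub>rl B\<^esub>) (?t \<sqinter>\<^bsub>rl B\<^esub> \<one>\<^bsub>rl B\<^esub>) \<in> F \<and>
      biimpl (rl ?N) (inv_neg (rl B) ?s \<sqinter>\<^bsub>rl B\<^esub> \<one>\<^bsub>rl B\<^esub>) (inv_neg (rl B) ?t \<sqinter>\<^bsub>rl B\<^esub> \<one>\<^bsub>rl B\<^esub>) \<in> F)"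
    using separating_prime_filter[OF u v(2)] by blast
  interpret N: bcrl "rl ?N" ?N by (rule cone_cirl)
  let ?g = "\<lambda>x. x \<in> F"
  have F: "is_filter (rl ?N) F" using P by (simp add: prime_filter_def)
  have BA: "?N \<in> BA" using B by (simp add: K_class_def)
  have g: "is_hom ?g ?N two_b"
  proof (rule N.is_hom_prime_filter_two_b[OF P])
    show "zero ?N \<notin> F" using z by simp
    show "x \<odot>\<^bsub>rl ?N\<^esub> y = x \<sqinter>\<^bsub>rl ?N\<^esub> y" if "x \<in> univ (rl ?N)" "y \<in> univ (rl ?N)" for x y
      using BA that unfolding BA_def univ_rl by blast
    show "x \<squnion>\<^bsub>rl ?N\<^esub> neg ?N x = \<one>\<^bsub>rl ?N\<^esub>" if "x \<in> univ (rl ?N)" for x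
      using BA that unfolding BA_def univ_rl by blast
  qed
  have g_eq: "biimpl (rl ?N) a b \<in> F"
    if "a \<in> univ (rl ?N)" "b \<in> univ (rl ?N)" "?g a = ?g b" for a b
    using g that unfolding is_hom_brl_iff is_hom_rl_iff
    unfolding N.biimpl_filter[OF F that(1,2)] by simp
  have cone: "x \<sqinter>\<^bsub>rl B\<^esub> \<one>\<^bsub>rl B\<^esub> \<in> univ (rl ?N)" if "x \<in> univ (rl B)" for x
    using that closed(2)[of x "\<one>\<^bsub>rl B\<^esub>"] closed(5) meet_lb2[of x "\<one>\<^bsub>rl B\<^esub>"] by simp
  have "is_hom (cone_map ?g) B K4"
    unfolding K4_def by (rule is_hom_cone_map[OF g])
  then have "cone_map ?g ?s = cone_map ?g ?t"
    using st v(1) wf by (simp add: eval_hom[OF _ alg_A] mem_eq_theory)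
  then show False
    using sep g_eq[OF cone[OF u(1)] cone[OF u(2)]]
      g_eq[OF cone[OF inv_closed[OF u(1)]] cone[OF inv_closed[OF u(2)]]]
    unfolding cone_map_def by simp
qed

lemma generated_variety_K4: "\<V> K4 = K_class BA"
proof (intro set_eqI iffI)
  fix B :: "(brl_sym, 'u) algebra"
  assume "B \<in> \<V> K4"
  then show "B \<in> K_class BA"
    using K_class_BA_transfer[OF K4_K_class_BA] by (auto simp: mem_generated_variety)
next
  fix B :: "(brl_sym, 'u) algebra"
  assume B: "B \<in> K_class BA"
  then have "is_algebra B" by (simp add: K_class_def is_bounded_K_lattice_def)
  then show "B \<in> \<V> K4"
    using K_class_BA_eq_theory[OF B] by (simp add: mem_generated_variety)
qed

section \<open>Finite subdirectly irreducible members of \<open>K(SRL)\<close>\<close>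

text \<open>Subdirect irreducibility makes {1} a prime filter, and \<open>stonean_quotient\<close>
  at {1} is an isomorphism of the negative cone onto 2 \<oplus> E. The filters of \<open>E\<close>
  pull back to the cone, so the monolith element \<open>c\<close> passes to \<open>E\<close> when
  \<open>E\<close> is nontrivial.\<close>

lemma inj_cone_map_two_plus:
  fixes A :: "(brl_sym, 'u) algebra"
  assumes A: "A \<in> K_class SRL" and si: "subdirectly_irreducible A"
  shows "\<exists>(E :: (rl_sym, 'u) algebra) h. E \<in> CIRL \<and> is_hom h A (K (two_plus E)) \<and>
    inj_on h (univ A) \<and> univ (K0 (two_plus E)) \<subseteq> h ` univ A \<and>
    ((\<exists>d\<in>univ E. d \<noteq> \<one>\<^bsub>E\<^esub>) \<longrightarrow> subdirectly_irreducible E)"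
proof -
  interpret bkl "rl A" A using A by (simp add: bkl_iff K_class_def)
  let ?N = "neg_cone A"
  interpret N: bcrl "rl ?N" ?N by (rule cone_cirl)
  have one: "\<one>\<^bsub>rl ?N\<^esub> = \<one>\<^bsub>rl A\<^esub>" by simp
  obtain c where c: "c \<in> univ (rl ?N)" "c \<noteq> \<one>\<^bsub>rl ?N\<^esub>"
    "\<And>F. is_filter (rl ?N) F \<Longrightarrow> F \<noteq> {\<one>\<^bsub>rl ?N\<^esub>} \<Longrightarrow> c \<in> F"
    using subdirectly_irreducible_cone[OF si] unfolding one univ_rl by blast
  let ?F = "{\<one>\<^bsub>rl ?N\<^esub>}"
  have P: "prime_filter (rl ?N) ?F" by (rule N.prime_filter_one[OF c])
  interpret f: bcrl_filter "rl ?N" ?N ?F by unfold_locales (rule N.filter_one)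
  have "zero ?N \<notin> ?F"
    using c(2) N.zero_le[OF c(1)] N.one_le_iff[OF c(1)] by (metis singletonD)
  moreover have "?N \<in> SRL" using A by (simp add: K_class_def)
  ultimately obtain E :: "(rl_sym, 'u) algebra" and g where E: "E \<in> CIRL"
    and g: "is_hom g ?N (two_plus E)" "g ` univ ?N = univ (two_plus E)"
    and ker: "\<forall>x\<in>univ ?N. \<forall>y\<in>univ ?N. g x = g y \<longleftrightarrow> biimpl (rl ?N) x y \<in> ?F"
    using f.stonean_quotient[OF _ P] by blast
  interpret E: cirl E using E by (simp add: CIRL_iff)
  have inj: "x = y" if "x \<in> univ (rl ?N)" "y \<in> univ (rl ?N)" "g x = g y" for x y
    using that ker N.biimpl_eq_one[OF that(1,2)] unfolding univ_rl by blast
  have cone: "x \<sqinter>\<^bsub>rl A\<^esub> \<one>\<^bsub>rl A\<^esub> \<in> univ (rl ?N)" if "x \<in> univ (rl A)" for x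
    using that closed(2)[of x "\<one>\<^bsub>rl A\<^esub>"] closed(5) meet_lb2[of x "\<one>\<^bsub>rl A\<^esub>"] by simp
  have "inj_on (cone_map g) (univ A)"
  proof (rule inj_onI)
    fix x y assume "x \<in> univ A" "y \<in> univ A" and eq: "cone_map g x = cone_map g y"
    then have u: "x \<in> univ (rl A)" "y \<in> univ (rl A)" by simp_all
    have "x \<sqinter>\<^bsub>rl A\<^esub> \<one>\<^bsub>rl A\<^esub> = y \<sqinter>\<^bsub>rl A\<^esub> \<one>\<^bsub>rl A\<^esub>"
      using inj[OF cone[OF u(1)] cone[OF u(2)]] eq unfolding cone_map_def by blast
    moreover have "inv_neg (rl A) x \<sqinter>\<^bsub>rl A\<^esub> \<one>\<^bsub>rl A\<^esub> = inv_neg (rl A) y \<sqinter>\<^bsub>rl A\<^esub> \<one>\<^bsub>rl A\<^esub>"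
      using inj[OF cone[OF inv_closed[OF u(1)]] cone[OF inv_closed[OF u(2)]]] eq
      unfolding cone_map_def by blast
    ultimately show "x = y" by (rule cone_determines[OF u])
  qed
  moreover have "subdirectly_irreducible E" if d: "d \<in> univ E" "d \<noteq> \<one>\<^bsub>E\<^esub>" for d
  proof -
    have hom: "g \<one>\<^bsub>rl ?N\<^esub> = Some \<one>\<^bsub>E\<^esub>"
      "\<And>x y. x \<in> univ (rl ?N) \<Longrightarrow> y \<in> univ (rl ?N) \<Longrightarrow> g (x \<odot>\<^bsub>rl ?N\<^esub> y) = g x \<odot>\<^bsub>rl (two_plus E)\<^esub> g y"
      "\<And>x y. x \<in> univ (rl ?N) \<Longrightarrow> y \<in> univ (rl ?N) \<Longrightarrow> g (x \<sqinter>\<^bsub>rl ?N\<^esub> y) = g x \<sqinter>\<^bsub>rl (two_plus E)\<^esub> g y"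
      "\<And>x. x \<in> univ (rl ?N) \<Longrightarrow> g x \<in> univ (two_plus E)"
      using g(1) unfolding is_hom_brl_iff is_hom_rl_iff by (simp_all only: two_plus_simps univ_rl)
    have onto: "\<exists>x\<in>univ (rl ?N). g x = Some e" if "e \<in> univ E" for e
    proof -
      have "Some e \<in> g ` univ ?N" using that unfolding g(2) by simp
      then show ?thesis unfolding univ_rl by (metis imageE)
    qed
    have c_in: "g c \<in> Some ` G" if G: "is_filter E G" "G \<noteq> {\<one>\<^bsub>E\<^esub>}" for G
    proof -
      let ?G = "{x \<in> univ (rl ?N). g x \<in> Some ` G}"
      have "is_filter (rl ?N) ?G"
        unfolding is_filter_def
      proof (intro conjI ballI impI)
        show "\<one>\<^bsub>rl ?N\<^esub> \<in> ?G"
          using N.closed(5) hom(1) E.filter_has_one[OF G(1)] by blast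
      next
        fix x y assume xy: "x \<in> ?G" "y \<in> ?G"
        then obtain a b where ab: "g x = Some a" "g y = Some b" "a \<in> G" "b \<in> G" by blast
        have xy': "x \<in> univ (rl ?N)" "y \<in> univ (rl ?N)" using xy by blast+
        have "g (x \<odot>\<^bsub>rl ?N\<^esub> y) = Some (a \<odot>\<^bsub>E\<^esub> b)"
          using hom(2)[OF xy'] ab by (simp only: two_plus_simps)
        then show "x \<odot>\<^bsub>rl ?N\<^esub> y \<in> ?G"
          using N.closed(3)[OF xy'] E.filter_mult[OF G(1) ab(3,4)] by blast
      next
        fix x y assume x: "x \<in> ?G" and y: "y \<in> univ (rl ?N)" and le: "x \<sqsubseteq>\<^bsub>rl ?N\<^esub> y"
        then obtain a where a: "g x = Some a" "a \<in> G" by blast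
        have x': "x \<in> univ (rl ?N)" using x by blast
        have eq: "Some a = Some a \<sqinter>\<^bsub>rl (two_plus E)\<^esub> g y"
          using hom(3)[OF x' y] le a(1) unfolding le_def by simp
        then obtain b where b: "g y = Some b" by (cases "g y") auto
        have "b \<in> univ E" using hom(4)[OF y] unfolding b by auto
        moreover have "a \<sqsubseteq>\<^bsub>E\<^esub> b" using eq unfolding b le_def by simp
        ultimately have "b \<in> G" using E.filter_up[OF G(1) a(2)] by blast
        then show "y \<in> ?G" using y b by blast
      qed blast
      moreover obtain a where a: "a \<in> G" "a \<noteq> \<one>\<^bsub>E\<^esub>"
        using G(2) E.filter_has_one[OF G(1)] by blast
      obtain x where x: "x \<in> univ (rl ?N)" "g x = Some a"
        using onto[OF E.filter_univ[OF G(1) a(1)]] by blast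
      have "x \<in> ?G" "x \<noteq> \<one>\<^bsub>rl ?N\<^esub>" using x a hom(1) by auto
      then have "?G \<noteq> {\<one>\<^bsub>rl ?N\<^esub>}" by blast
      ultimately show ?thesis using c(3) by blast
    qed
    \<comment> \<open>The improper filter of \<open>E\<close> shows that \<open>g c\<close> lies in
      \<open>E\<close> and is not the adjoined 0.\<close>
    have "is_filter E (univ E)" unfolding is_filter_def by simp
    moreover have "univ E \<noteq> {\<one>\<^bsub>E\<^esub>}" using d by blast
    ultimately obtain e where e: "e \<in> univ E" "g c = Some e" using c_in by blast
    have "e \<noteq> \<one>\<^bsub>E\<^esub>" using e(2) hom(1) inj[OF c(1) N.closed(5)] c(2) by auto
    then show ?thesis
      using c_in e by (intro E.subdirectly_irreducible_monolith[of e]) auto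
  qed
  ultimately show ?thesis
    using E is_hom_cone_map[OF g(1)] cone_map_onto_K0[OF g E]
    by (intro exI[of _ E] exI[of _ "cone_map g"]) blast
qed

text \<open>A prime filter separates the two values of a refuted identity. The resulting image of
  \<open>B\<close> contains \<open>K0 (two_plus E)\<close>, and \<open>nn_trm\<close> prevents it
  from containing more, so \<open>K0 (two_plus E)\<close> is itself a quotient of
  \<open>B\<close>.\<close>

lemma SRL_refute:
  fixes B :: "(brl_sym, 'u) algebra"
  assumes B: "B \<in> K_class SRL" and nn: "(nn_trm, b1) \<in> eq_theory B"
    and wf: "wf_trm s" "wf_trm t" and no: "(s, t) \<notin> eq_theory B"
  shows "\<exists>E :: (rl_sym, 'u) algebra. E \<in> CIRL \<and> eq_theory B \<subseteq> eq_theory (K0 (two_plus E)) \<and>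
    (s, t) \<notin> eq_theory (K0 (two_plus E))"
proof -
  interpret bkl "rl B" B using B by (simp add: bkl_iff K_class_def)
  obtain v where v: "\<And>n. v n \<in> univ B" "eval_trm B v s \<noteq> eval_trm B v t"
    using no wf by (auto simp: mem_eq_theory)
  let ?s = "eval_trm B v s" and ?t = "eval_trm B v t"
  have u: "?s \<in> univ (rl B)" "?t \<in> univ (rl B)"
    using v(1) wf alg_A by (simp_all add: eval_trm_closed)
  let ?N = "neg_cone B"
  obtain F where P: "prime_filter (rl ?N) F" and z: "zero B \<notin> F"
    and sep: "\<not> (biimpl (rl ?N) (?s \<sqinter>\<^bsub>rl B\<^esub> \<one>\<^bsub>rl B\<^esub>) (?t \<sqinter>\<^bsub>rl B\<^esub> \<one>\<^bsub>rl B\<^esub>) \<in> F \<and>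
      biimpl (rl ?N) (inv_neg (rl B) ?s \<sqinter>\<^bsub>rl B\<^esub> \<one>\<^bsub>rl B\<^esub>) (inv_neg (rl B) ?t \<sqinter>\<^bsub>rl B\<^esub> \<one>\<^bsub>rl B\<^esub>) \<in> F)"
    using separating_prime_filter[OF u v(2)] by blast
  interpret N: bcrl "rl ?N" ?N by (rule cone_cirl)
  interpret f: bcrl_filter "rl ?N" ?N F
    using P by unfold_locales (simp add: prime_filter_def)
  have "?N \<in> SRL" "zero ?N \<notin> F" using B z by (simp_all add: K_class_def)
  then obtain E :: "(rl_sym, 'u) algebra" and g where E: "E \<in> CIRL"
    and g: "is_hom g ?N (two_plus E)" "g ` univ ?N = univ (two_plus E)"
    and ker: "\<forall>x\<in>univ ?N. \<forall>y\<in>univ ?N. g x = g y \<longleftrightarrow> biimpl (rl ?N) x y \<in> F"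
    using f.stonean_quotient[OF _ P] by blast
  have cone: "x \<sqinter>\<^bsub>rl B\<^esub> \<one>\<^bsub>rl B\<^esub> \<in> univ ?N" if "x \<in> univ (rl B)" for x
    using that closed(2)[of x "\<one>\<^bsub>rl B\<^esub>"] closed(5) meet_lb2[of x "\<one>\<^bsub>rl B\<^esub>"] by simp
  let ?h = "cone_map g"
  have hK: "is_hom ?h B (K (two_plus E))" by (rule is_hom_cone_map[OF g(1)])
  have "(None, None) \<notin> ?h ` univ B" by (rule nn_image[OF E hK alg_A nn])
  then have im: "?h ` univ B = univ (K0 (two_plus E))"
    using cone_map_onto_K0[OF g E] hK unfolding univ_K0_two_plus[OF E] is_hom_def by blast
  have h: "is_hom ?h B (K0 (two_plus E))"
    using hK im unfolding is_hom_def by (simp add: K0_def)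
  have "?h ?s \<noteq> ?h ?t"
  proof
    assume "?h ?s = ?h ?t"
    then have "g (?s \<sqinter>\<^bsub>rl B\<^esub> \<one>\<^bsub>rl B\<^esub>) = g (?t \<sqinter>\<^bsub>rl B\<^esub> \<one>\<^bsub>rl B\<^esub>)"
      "g (inv_neg (rl B) ?s \<sqinter>\<^bsub>rl B\<^esub> \<one>\<^bsub>rl B\<^esub>) = g (inv_neg (rl B) ?t \<sqinter>\<^bsub>rl B\<^esub> \<one>\<^bsub>rl B\<^esub>)"
      unfolding cone_map_def by blast+
    then show False
      using sep ker cone[OF u(1)] cone[OF u(2)] cone[OF inv_closed[OF u(1)]] cone[OF inv_closed[OF u(2)]]
      by blast
  qed
  then have "eval_trm (K0 (two_plus E)) (\<lambda>n. ?h (v n)) s \<noteq> eval_trm (K0 (two_plus E)) (\<lambda>n. ?h (v n)) t"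
    using eval_hom[OF h alg_A wf(1) v(1)] eval_hom[OF h alg_A wf(2) v(1)] by simp
  then have "(s, t) \<notin> eq_theory (K0 (two_plus E))"
    using eq_theoryD[of s t "K0 (two_plus E)" "\<lambda>n. ?h (v n)"] is_hom_univ[OF h v(1)] by blast
  moreover have "eq_theory B \<subseteq> eq_theory (K0 (two_plus E))"
    by (rule eq_theory_surj[OF h alg_A]) (simp add: im)
  ultimately show ?thesis using E by blast
qed

section \<open>Covers\<close>

text \<open>\<open>X\<close> itself may live on another type; its copy \<open>C\<close> is the
  member of \<V> X on which an inclusion is tested.\<close>

lemma generated_variety_subset_iff:
  fixes C :: "('f::signature, 'u) algebra"
  assumes "is_algebra C" "eq_theory C = eq_theory X"
  shows "(\<V> X :: ('f, 'u) algebra set) \<subseteq> \<V> Y \<longleftrightarrow> eq_theory Y \<subseteq> eq_theory X"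
proof
  assume "(\<V> X :: ('f, 'u) algebra set) \<subseteq> \<V> Y"
  moreover have "C \<in> \<V> X" using assms by (simp add: mem_generated_variety)
  ultimately have "C \<in> \<V> Y" by blast
  then show "eq_theory Y \<subseteq> eq_theory X" using assms(2) by (simp add: mem_generated_variety)
next
  assume "eq_theory Y \<subseteq> eq_theory X"
  then show "(\<V> X :: ('f, 'u) algebra set) \<subseteq> \<V> Y"
    unfolding subset_iff mem_generated_variety by blast
qed

lemma variety_closed:
  assumes "variety W" "B \<in> W" "is_algebra C" "eq_theory B \<subseteq> eq_theory C"
  shows "C \<in> W"
proof -
  obtain E where E: "E \<subseteq> identities" "W = models E"
    using assms(1) by (auto simp: variety_def)
  show ?thesis
    using assms(2-4) unfolding E(2) models_iff[OF E(1)] by blast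
qed

text \<open>A variety strictly between gives one on the other side. \<open>up\<close> translates the
  identities common to U by \<open>star\<close>; \<open>down\<close> collects all \<open>E\<close>
  whose \<open>K0 (two_plus E)\<close> satisfies the identities of W.\<close>

lemma K0_cover_iff:
  fixes A :: "(brl_sym, 'u) algebra" and D :: "(rl_sym, 'u) algebra"
  assumes inf: "infinite (UNIV :: 'u set)" and D: "D \<in> CIRL" and A: "A \<in> K_class SRL"
    and AD: "eq_theory A = eq_theory (K0 (two_plus D))"
  shows "is_cover_in (subvarieties (K_class SRL)) (\<V> A) (\<V> K8 :: (brl_sym, 'u) algebra set) \<longleftrightarrow>
    is_cover_in (subvarieties CIRL) (\<V> D) (\<V> two :: (rl_sym, 'u) algebra set)"
    (is "is_cover_in ?LA ?VA ?V8 \<longleftrightarrow> is_cover_in ?LD ?VD ?V2")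
proof -
  have K8: "eq_theory K8 = eq_theory (K0 (two_plus two))" by (simp add: K8_def)
  have algA: "is_algebra A" using A by (simp add: K_class_def is_bounded_K_lattice_def)
  have algD: "is_algebra D" using D by (simp add: CIRL_def is_CRL_def)
  obtain T :: "(rl_sym, 'u) algebra" where T: "is_algebra T" "eq_theory T = eq_theory two"
  proof -
    have "is_algebra two" using two_CIRL by (simp add: CIRL_def is_CRL_def)
    moreover have "finite (univ two)" by (simp add: two_def)
    ultimately show thesis using copy_finite[OF _ _ inf] that by blast
  qed
  have copy_K0: "\<exists>C :: (brl_sym, 'u) algebra. is_algebra C \<and> eq_theory C = eq_theory (K0 (two_plus E))"
    if "E \<in> CIRL" for E :: "(rl_sym, 'u) algebra"
    by (rule copy_option_prod[OF is_algebra_K0_two_plus[OF that] inf])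
  have algE: "is_algebra E" if "E \<in> CIRL" for E :: "(rl_sym, 'u) algebra"
    using that by (simp add: CIRL_def is_CRL_def)
  have "T \<in> CIRL" using CIRL_transfer[OF two_CIRL T(1)] T(2) by simp
  then have T8: "eq_theory (K0 (two_plus T)) = eq_theory K8"
    using T(2) by (simp add: K8 eq_theory_K0_two_plus two_CIRL)
  obtain C8 :: "(brl_sym, 'u) algebra" where C8: "is_algebra C8" "eq_theory C8 = eq_theory K8"
    using copy_K0[OF \<open>T \<in> CIRL\<close>] T8 by auto
  have V28: "?V8 \<subseteq> ?VA \<longleftrightarrow> ?V2 \<subseteq> ?VD"
    unfolding generated_variety_subset_iff[OF C8] generated_variety_subset_iff[OF T] AD K8
    by (rule eq_theory_K0_two_plus_subset_iff[OF D two_CIRL])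
  have V82: "?VA \<subseteq> ?V8 \<longleftrightarrow> ?VD \<subseteq> ?V2"
    unfolding generated_variety_subset_iff[OF algA refl] generated_variety_subset_iff[OF algD refl] AD K8
    by (rule eq_theory_K0_two_plus_subset_iff[OF two_CIRL D])
  have VA: "?VA \<subseteq> K_class SRL"
    using K_class_SRL_transfer[OF A] by (auto simp: mem_generated_variety)
  have VD: "?VD \<subseteq> CIRL"
    using CIRL_transfer[OF D] by (auto simp: mem_generated_variety)
  have L: "?V8 \<in> ?LA \<and> ?VA \<in> ?LA" "?V2 \<in> ?LD \<and> ?VD \<in> ?LD" if "?V2 \<subseteq> ?VD"
    using that V28 VA VD by (auto simp: subvarieties_def variety_generated)
  have up: "\<exists>W\<in>?LA. ?V8 \<subset> W \<and> W \<subset> ?VA" if U: "U \<in> ?LD" "?V2 \<subset> U" "U \<subset> ?VD" for U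
  proof -
    have varU: "variety U" and UC: "U \<subseteq> CIRL" using U(1) by (auto simp: subvarieties_def)
    have "T \<in> ?V2" using T by (simp add: mem_generated_variety)
    then have TU: "T \<in> U" using U(2) by blast
    define J where "J = (\<Inter>E\<in>U. eq_theory E)"
    define W :: "(brl_sym, 'u) algebra set" where "W = models (star J)"
    have memW: "B \<in> W \<longleftrightarrow> is_algebra B \<and> star J \<subseteq> eq_theory B" for B
      by (simp add: W_def models_iff star_sub_identities)
    have W8: "?V8 \<subseteq> W"
    proof -
      have "star J \<subseteq> eq_theory K8"
        using TU T(2) unfolding K8 eq_theory_K0_two_plus[OF two_CIRL] J_def by (intro star_mono) auto
      then show ?thesis by (intro subsetI; unfold mem_generated_variety memW; blast)
    qed
    have WA: "W \<subseteq> ?VA"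
    proof -
      have "eq_theory D \<subseteq> J"
        using psubset_imp_subset[OF U(3)] unfolding J_def subset_iff[of U] mem_generated_variety by blast
      then have "eq_theory A \<subseteq> star J"
        unfolding AD eq_theory_K0_two_plus[OF D] by (rule star_mono)
      then show ?thesis by (intro subsetI; unfold mem_generated_variety memW; blast)
    qed
    \<comment> \<open>An identity defining U fails in \<open>D\<close>. Its translation by
      \<open>cone_trm\<close> holds in \<open>K0 (two_plus E)\<close> for all E in U, so it lies in
      \<open>star J\<close>, yet it fails in \<open>K0 (two_plus D)\<close>.\<close>
    have "A \<notin> W"
    proof
      assume AW: "A \<in> W"
      obtain E0 where E0: "E0 \<subseteq> identities" "U = models E0" using varU by (auto simp: variety_def)
      have "D \<notin> U"
        using U(3) variety_closed[OF varU, of D] by (auto simp: mem_generated_variety)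
      then obtain s t where st: "(s, t) \<in> E0" "(s, t) \<notin> eq_theory D"
        using E0 algD models_iff[OF E0(1), of D] by auto
      have wf: "wf_trm s" "wf_trm t" using st(1) E0(1) by (auto simp: identities_def)
      have "(cone_trm s, cone_trm t) \<in> star (eq_theory E)" if "E \<in> U" for E
        using that UC st(1) models_iff[OF E0(1), of E] E0(2) cone_trm_identity[OF _ wf, of E]
          eq_theory_K0_two_plus[of E] by blast
      then have "(cone_trm s, cone_trm t) \<in> (\<Inter>J\<in>eq_theory ` U. star J)" by blast
      then have "(cone_trm s, cone_trm t) \<in> star J"
        using star_Inter[of "eq_theory ` U"] TU unfolding J_def by blast
      then have "(cone_trm s, cone_trm t) \<in> eq_theory (K0 (two_plus D))"
        using AW AD by (auto simp: memW)
      then show False using st(2) cone_trm_identity[OF D wf] by blast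
    qed
    moreover have "A \<in> ?VA" using algA by (simp add: mem_generated_variety)
    \<comment> \<open>A member \<open>E\<close> of U outside \<V> two yields a copy of
      \<open>K0 (two_plus E)\<close>.\<close>
    moreover have "\<exists>C\<in>W. C \<notin> ?V8"
    proof -
      obtain E where E: "E \<in> U" "E \<notin> ?V2" using U(2) by blast
      have EC: "E \<in> CIRL" using E UC by blast
      have "\<not> eq_theory two \<subseteq> eq_theory E"
        using E algE[OF EC] by (simp add: mem_generated_variety)
      then have ne: "\<not> eq_theory K8 \<subseteq> eq_theory (K0 (two_plus E))"
        unfolding K8 eq_theory_K0_two_plus_subset_iff[OF two_CIRL EC] .
      obtain C :: "(brl_sym, 'u) algebra" where C: "is_algebra C" "eq_theory C = eq_theory (K0 (two_plus E))"
        using copy_K0[OF EC] by blast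
      have "J \<subseteq> eq_theory E" using E(1) by (auto simp: J_def)
      then have "C \<in> W" using C star_mono unfolding memW eq_theory_K0_two_plus[OF EC] by simp
      then show ?thesis using ne C by (auto simp: mem_generated_variety)
    qed
    ultimately have "?V8 \<subset> W" "W \<subset> ?VA" using W8 WA by blast+
    moreover have "W \<in> ?LA"
      using WA VA unfolding subvarieties_def W_def by (auto simp: variety_models star_sub_identities)
    ultimately show ?thesis by blast
  qed
  have down: "\<exists>U\<in>?LD. ?V2 \<subset> U \<and> U \<subset> ?VD" if W: "W \<in> ?LA" "?V8 \<subset> W" "W \<subset> ?VA" for W
  proof -
    have varW: "variety W" and WS: "W \<subseteq> K_class SRL" using W(1) by (auto simp: subvarieties_def)
    obtain E1 where E1: "E1 \<subseteq> identities" "W = models E1" using varW by (auto simp: variety_def)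
    have memW: "B \<in> W \<longleftrightarrow> is_algebra B \<and> E1 \<subseteq> eq_theory B" for B
      unfolding E1(2) by (rule models_iff[OF E1(1)])
    define U0 :: "(rl_sym, 'u) algebra set" where
      "U0 = {E \<in> CIRL. E1 \<subseteq> eq_theory (K0 (two_plus E))}"
    define Z where "Z = (\<Inter>E\<in>U0. eq_theory E)"
    have "C8 \<in> ?V8" using C8 by (simp add: mem_generated_variety)
    then have "C8 \<in> W" using W(2) by blast
    then have E18: "E1 \<subseteq> eq_theory K8" using C8 by (simp add: memW)
    have V2U: "E \<in> U0" if "E \<in> ?V2" for E
    proof -
      have E: "is_algebra E" "eq_theory two \<subseteq> eq_theory E" using that by (simp_all add: mem_generated_variety)
      then have EC: "E \<in> CIRL" using CIRL_transfer[OF two_CIRL] by blast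
      then have "eq_theory K8 \<subseteq> eq_theory (K0 (two_plus E))"
        using E(2) eq_theory_K0_two_plus_subset_iff[OF two_CIRL EC] K8 by simp
      then show ?thesis using E18 EC by (auto simp: U0_def)
    qed
    have UVD: "eq_theory D \<subseteq> eq_theory E" if "E \<in> U0" for E
    proof -
      have EC: "E \<in> CIRL" and E: "E1 \<subseteq> eq_theory (K0 (two_plus E))" using that by (simp_all add: U0_def)
      obtain C :: "(brl_sym, 'u) algebra" where C: "is_algebra C" "eq_theory C = eq_theory (K0 (two_plus E))"
        using copy_K0[OF EC] by blast
      then have "C \<in> W" using E memW by simp
      then have "C \<in> ?VA" using W(3) by blast
      then show ?thesis
        using C AD eq_theory_K0_two_plus_subset_iff[OF D EC] by (simp add: mem_generated_variety)
    qed
    have "T \<in> U0" using V2U T by (simp add: mem_generated_variety)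
    have ZD: "eq_theory D \<subseteq> Z" using UVD by (auto simp: Z_def)
    have Z_id: "Z \<subseteq> identities"
      using \<open>T \<in> U0\<close> eq_theory_sub_identities[of T] by (auto simp: Z_def)
    \<comment> \<open>That \<open>U0\<close> is a variety rests on \<open>star_Inter\<close>:
      identities holding in every \<open>K0 (two_plus E)\<close> with \<open>E\<close> in
      \<open>U0\<close> are consequences of the common identities \<open>Z\<close>.\<close>
    have U0: "models Z = U0"
    proof (intro set_eqI iffI)
      fix F :: "(rl_sym, 'u) algebra" assume "F \<in> models Z"
      then have F: "is_algebra F" "Z \<subseteq> eq_theory F" by (simp_all add: models_iff[OF Z_id])
      then have FC: "F \<in> CIRL" using CIRL_transfer[OF D] ZD by blast
      have "E1 \<subseteq> (\<Inter>J\<in>eq_theory ` U0. star J)"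
        using eq_theory_K0_two_plus by (fastforce simp: U0_def)
      also have "\<dots> \<subseteq> star Z"
        using star_Inter[of "eq_theory ` U0"] \<open>T \<in> U0\<close> unfolding Z_def by blast
      also have "\<dots> \<subseteq> eq_theory (K0 (two_plus F))"
        unfolding eq_theory_K0_two_plus[OF FC] by (rule star_mono[OF F(2)])
      finally show "F \<in> U0" using FC by (simp add: U0_def)
    next
      fix F assume F: "F \<in> U0"
      then have "Z \<subseteq> eq_theory F" by (auto simp: Z_def)
      then show "F \<in> models Z"
        using F algE by (simp add: models_iff[OF Z_id] U0_def)
    qed
    have "variety U0"
      unfolding U0[symmetric] by (rule variety_models[OF Z_id])
    then have "U0 \<in> ?LD"
      by (simp add: subvarieties_def) (simp add: U0_def)
    moreover have "?V2 \<subset> U0"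
    proof -
      \<comment> \<open>Such a \<open>B\<close> lies in \<V> A and hence satisfies the
        \<open>nn_trm\<close> identity, so \<open>SRL_refute\<close> carries the failure of an
        identity of \<open>K8\<close> to some \<open>K0 (two_plus E)\<close> that is still a model
        of \<open>E1\<close>.\<close>
      obtain B where B: "B \<in> W" "B \<notin> ?V8" using W(2) by blast
      have algB: "is_algebra B" using B(1) by (simp add: memW)
      obtain s t where st: "(s, t) \<in> eq_theory K8" "(s, t) \<notin> eq_theory B"
        using B(2) algB by (auto simp: mem_generated_variety)
      have "B \<in> ?VA" using B(1) W(3) by blast
      then have "(nn_trm, b1) \<in> eq_theory B"
        using nn_K0[OF D] AD unfolding mem_generated_variety by blast
      moreover have wf: "wf_trm s" "wf_trm t" using st(1) by (auto simp: mem_eq_theory)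
      ultimately obtain E :: "(rl_sym, 'u) algebra" where E: "E \<in> CIRL"
        "eq_theory B \<subseteq> eq_theory (K0 (two_plus E))" "(s, t) \<notin> eq_theory (K0 (two_plus E))"
        using SRL_refute[of B s t] B(1) WS st(2) by blast
      have "E \<in> U0" using E B(1) by (auto simp: U0_def memW)
      moreover have "E \<notin> ?V2"
        using E st(1) eq_theory_K0_two_plus_subset_iff[OF two_CIRL E(1)]
        by (auto simp: mem_generated_variety K8)
      ultimately show ?thesis using V2U by blast
    qed
    moreover have "U0 \<subset> ?VD"
    proof -
      have "D \<notin> U0"
      proof
        assume "D \<in> U0"
        then have "A \<in> W" using algA AD by (simp add: memW U0_def)
        then have "?VA \<subseteq> W"
          using variety_closed[OF varW] unfolding subset_iff[of ?VA] mem_generated_variety by blast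
        then show False using W(3) by blast
      qed
      moreover have "D \<in> ?VD" using algD by (simp add: mem_generated_variety)
      moreover have "U0 \<subseteq> ?VD"
        using UVD algE unfolding mem_generated_variety subset_iff[of U0]
        by (simp add: U0_def)
      ultimately show ?thesis by blast
    qed
    ultimately show ?thesis by blast
  qed
  have strict: "?V8 \<subset> ?VA \<longleftrightarrow> ?V2 \<subset> ?VD"
    using V28 V82 by blast
  show ?thesis
  proof
    assume "is_cover_in ?LA ?VA ?V8"
    then have sub: "?V2 \<subset> ?VD" and no: "\<not> (\<exists>W\<in>?LA. ?V8 \<subset> W \<and> W \<subset> ?VA)"
      unfolding is_cover_in_def strict by simp_all
    have "\<not> (\<exists>U\<in>?LD. ?V2 \<subset> U \<and> U \<subset> ?VD)" using no up by metis
    then show "is_cover_in ?LD ?VD ?V2"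
      unfolding is_cover_in_def using L(2)[OF psubset_imp_subset[OF sub]] sub by simp
  next
    assume "is_cover_in ?LD ?VD ?V2"
    then have sub: "?V2 \<subset> ?VD" and no: "\<not> (\<exists>U\<in>?LD. ?V2 \<subset> U \<and> U \<subset> ?VD)"
      unfolding is_cover_in_def by simp_all
    have "\<not> (\<exists>W\<in>?LA. ?V8 \<subset> W \<and> W \<subset> ?VA)" using no down by metis
    then show "is_cover_in ?LA ?VA ?V8"
      unfolding is_cover_in_def strict using L(1)[OF psubset_imp_subset[OF sub]] sub by simp
  qed
qed

theorem theorem3p16:
  fixes A :: "(brl_sym, 'u) algebra"
  assumes "infinite (UNIV :: 'u set)"
    and "A \<in> K_class SRL" and "finite (univ A)" and "subdirectly_irreducible A"
  shows "(\<V> K4 :: (brl_sym, 'u) algebra set) = K_class BA \<and>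
    (is_cover_in (subvarieties (K_class SRL)) (\<V> A :: (brl_sym, 'u) algebra set) (\<V> K8) \<and>
     \<not> is_cover_in (subvarieties (K_class SRL)) (\<V> A :: (brl_sym, 'u) algebra set) (\<V> K4)
     \<longleftrightarrow>
     (\<exists>D :: (rl_sym, 'u) algebra. D \<in> CIRL \<and> finite (univ D) \<and> subdirectly_irreducible D \<and>
        is_cover_in (subvarieties CIRL) (\<V> D :: (rl_sym, 'u) algebra set) (\<V> two) \<and>
        A \<simeq> K0 (two_plus D)))"
    (is "_ \<and> (is_cover_in ?L ?VA ?V8 \<and> \<not> is_cover_in ?L ?VA ?V4 \<longleftrightarrow> ?rhs)")
proof (intro conjI iffI)
  show "(\<V> K4 :: (brl_sym, 'u) algebra set) = K_class BA" by (rule generated_variety_K4)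
next
  note inf = assms(1) and A = assms(2) and fin = assms(3) and si = assms(4)
  assume "is_cover_in ?L ?VA ?V8 \<and> \<not> is_cover_in ?L ?VA ?V4"
  then have cover: "is_cover_in ?L ?VA ?V8" by blast
  have algA: "is_algebra A" using A by (simp add: K_class_def is_bounded_K_lattice_def)
  have alg8: "is_algebra K8" unfolding K8_def by (rule is_algebra_K0_two_plus[OF two_CIRL])
  have "finite (univ K8)" unfolding K8_def univ_K0_two_plus[OF two_CIRL] by (simp add: two_def)
  then obtain C8 :: "(brl_sym, 'u) algebra" where C8: "is_algebra C8" "eq_theory C8 = eq_theory K8"
    using copy_finite[OF alg8 _ inf] by blast
  obtain C4 :: "(brl_sym, 'u) algebra" where C4: "is_algebra C4" "eq_theory C4 = eq_theory K4"
    using copy_finite[OF is_algebra_K4 _ inf] by auto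
  have A8: "eq_theory A \<subseteq> eq_theory K8"
    using cover generated_variety_subset_iff[OF C8, of A] by (auto simp: is_cover_in_def)
  obtain E :: "(rl_sym, 'u) algebra" and h where E: "E \<in> CIRL" and h: "is_hom h A (K (two_plus E))"
    and inj: "inj_on h (univ A)" and onto: "univ (K0 (two_plus E)) \<subseteq> h ` univ A"
    and siE: "(\<exists>d\<in>univ E. d \<noteq> \<one>\<^bsub>E\<^esub>) \<longrightarrow> subdirectly_irreducible E"
    using inj_cone_map_two_plus[OF A si] by blast
  interpret E: cirl E using E by (simp add: CIRL_iff)
  have hU: "h ` univ A \<subseteq> univ (K (two_plus E))" using h by (auto simp: is_hom_def)
  have alg2E: "is_algebra (two_plus E)" by (rule is_algebra_two_plus[OF E.alg])
  \<comment> \<open>For trivial \<open>E\<close> the algebra 2 \<oplus> E is 2, so \<open>A\<close>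
    would embed in \<open>K4\<close> and satisfy the \<open>ba_trm\<close> identity.
    \<open>K8\<close> refutes it, although all identities of \<open>A\<close> hold in
    \<open>K8\<close>.\<close>
  have "\<exists>d\<in>univ E. d \<noteq> \<one>\<^bsub>E\<^esub>"
  proof (rule ccontr)
    assume triv: "\<not> ?thesis"
    let ?k = "map_prod (\<lambda>x. x \<noteq> None) (\<lambda>x. x \<noteq> None)"
    have k: "is_hom ?k (K (two_plus E)) K4"
      unfolding K4_def by (rule is_hom_map_prod[OF is_hom_two_plus_two_b alg2E])
    have "inj_on ?k (univ (K (two_plus E)))"
      using triv by (auto simp: inj_on_def; metis)
    then have "inj_on (\<lambda>x. ?k (h x)) (univ A)"
      using comp_inj_on[OF inj inj_on_subset[OF _ hU], of ?k] unfolding comp_def by blast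
    then have "eq_theory K4 \<subseteq> eq_theory A"
      by (rule eq_theory_inj[OF is_hom_compose[OF h k] algA])
    then show False using A8 ba_K4 ba_K8 by blast
  qed
  then obtain d where d: "d \<in> univ E" "d \<noteq> \<one>\<^bsub>E\<^esub>" by blast
  have "(None, None) \<notin> h ` univ A"
  proof
    assume "(None, None) \<in> h ` univ A"
    then have full: "univ (K (two_plus E)) \<subseteq> h ` univ A"
      using onto unfolding univ_K0_two_plus[OF E] by blast
    have AK: "eq_theory A \<subseteq> eq_theory (K (two_plus E))"
      by (rule eq_theory_surj[OF h algA full])
    let ?q = "\<lambda>b. if b then Some \<one>\<^bsub>E\<^esub> else None"
    have "is_hom (map_prod ?q ?q) K4 (K (two_plus E))"
      unfolding K4_def
      by (rule is_hom_map_prod[OF is_hom_two_b_two_plus[OF E]]) (simp add: is_algebra_brl is_algebra_rl)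
    then have "eq_theory (K (two_plus E)) \<subseteq> eq_theory K4"
      by (rule eq_theory_inj[OF _ is_algebra_K4]) (auto simp: inj_on_def split: if_splits)
    then have A4: "eq_theory A \<subseteq> eq_theory K4" using AK by blast
    \<comment> \<open>The models of the common identities form the join of the two varieties.
      \<open>K4\<close> is outside \<V> K8 by \<open>nn_trm\<close>, and \<open>A\<close> is outside
      the join by \<open>bJ nn_trm ba_trm\<close>, so the join lies strictly between \<V> K8 and
      \<V> A.\<close>
    let ?I = "eq_theory K8 \<inter> eq_theory K4"
    let ?W = "models ?I :: (brl_sym, 'u) algebra set"
    have I: "?I \<subseteq> identities" using eq_theory_sub_identities by blast
    have W8: "?V8 \<subseteq> ?W" and WA: "?W \<subseteq> ?VA"
      using A8 A4 unfolding subset_iff[of "\<V> K8"] subset_iff[of ?W] mem_generated_variety models_iff[OF I]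
      by blast+
    have "C4 \<in> ?W" using C4 by (simp add: models_iff[OF I])
    moreover have "C4 \<notin> ?V8"
      using C4 nn_K4 nn_K0[OF two_CIRL] by (auto simp: mem_generated_variety K8_def)
    moreover have "A \<in> ?VA" using algA by (simp add: mem_generated_variety)
    moreover have "A \<notin> ?W"
      using AK nn_ba_K[OF E d] nn_ba_K0[OF two_CIRL] nn_ba_K4
      unfolding models_iff[OF I] unfolding K8_def by blast
    moreover have "?W \<in> ?L"
      using cover WA variety_models[OF I] by (auto simp: is_cover_in_def subvarieties_def)
    ultimately show False
      using cover W8 WA unfolding is_cover_in_def by blast
  qed
  then have im: "h ` univ A = univ (K0 (two_plus E))"
    using onto hU unfolding univ_K0_two_plus[OF E] by blast
  have hom0: "is_hom h A (K0 (two_plus E))"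
    using h im unfolding is_hom_def by (simp add: K0_def)
  then have iso: "A \<simeq> K0 (two_plus E)"
    using inj im by (auto simp: isomorphic_def bij_betw_def)
  have "finite (univ E)"
  proof (rule inj_on_finite)
    show "inj_on (\<lambda>e. (Some e, Some \<one>\<^bsub>E\<^esub>)) (univ E)" by (auto simp: inj_on_def)
    show "(\<lambda>e. (Some e, Some \<one>\<^bsub>E\<^esub>)) ` univ E \<subseteq> h ` univ A"
      unfolding im univ_K0_two_plus[OF E] by auto
    show "finite (h ` univ A)" using fin by simp
  qed
  moreover have "is_cover_in (subvarieties CIRL) (\<V> E :: (rl_sym, 'u) algebra set) (\<V> two)"
    using K0_cover_iff[OF inf E A eq_theory_isomorphic[OF algA iso]] cover by blast
  ultimately show ?rhs using E siE d iso by blast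
next
  note inf = assms(1) and A = assms(2)
  have algA: "is_algebra A" using A by (simp add: K_class_def is_bounded_K_lattice_def)
  obtain C4 :: "(brl_sym, 'u) algebra" where C4: "is_algebra C4" "eq_theory C4 = eq_theory K4"
    using copy_finite[OF is_algebra_K4 _ inf] by auto
  assume ?rhs
  then obtain D :: "(rl_sym, 'u) algebra" where D: "D \<in> CIRL"
    and cover: "is_cover_in (subvarieties CIRL) (\<V> D :: (rl_sym, 'u) algebra set) (\<V> two)"
    and iso: "A \<simeq> K0 (two_plus D)" by blast
  have AD: "eq_theory A = eq_theory (K0 (two_plus D))"
    by (rule eq_theory_isomorphic[OF algA iso])
  show "is_cover_in ?L ?VA ?V8"
    using K0_cover_iff[OF inf D A AD] cover by blast
  \<comment> \<open>\<V> K4 is not even contained in \<V> A: \<open>A\<close> satisfies the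
    \<open>nn_trm\<close> identity and \<open>K4\<close> does not.\<close>
  show "\<not> is_cover_in ?L ?VA ?V4"
    using nn_K0[OF D] nn_K4 AD generated_variety_subset_iff[OF C4, of A]
    by (auto simp: is_cover_in_def)
qed

end
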